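(* Let $1 \le d \le n$ be integers and let $\mathcal A_1, \dots, \mathcal A_d$ be nonempty compact convex sets in $\mathbb R^n$. Let $G(d,n)$ be the Grassmannian of $d$-dimensional linear subspaces of $\mathbb R^n$, endowed with its unique $O(n)$-invariant probability measure, and for each element of $G(d,n)$ let $P$ denote the orthogonal projection of $\mathbb R^n$ onto that $d$-dimensional subspace (identified isometrically with $\mathbb R^d$). Then the average over $G(d,n)$ with respect to this probability measure satisfies \[ \operatorname*{Avg}_{P \in G(d,n)} V\big(P(\mathcal A_1), \dots, P(\mathcal A_d)\big) \;\le\; \frac{\mathrm{Vol}(B^d)}{\mathrm{Vol}(B^n)}\, V(\mathcal A_1, \dots, \mathcal A_d, \underbrace{B^n, \dots, B^n}_{n-d}), \] where on the left $V$ is the $d$-dimensional mixed volume and on the right $V$ is the $n$-dimensional mixed volume.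
   Context: $B^m$ denotes the closed Euclidean unit ball of $\mathbb R^m$, and $\mathrm{Vol}$ on $\mathbb R^m$ is the $m$-dimensional Lebesgue measure. For nonempty compact convex sets $\mathcal K_1,\dots,\mathcal K_m \subset \mathbb R^m$ (possibly with empty interior), the mixed volume is \[ V(\mathcal K_1, \dots, \mathcal K_m) = \frac{1}{m!} \frac{\partial^m}{\partial t_1 \partial t_2 \cdots \partial t_m} \mathrm{Vol}(t_1 \mathcal K_1 + \cdots + t_m \mathcal K_m), \] where $t_1,\dots,t_m \ge 0$, sums are Minkowski sums, and the derivative is taken at $t=0$; equivalently, $V(\mathcal K_1,\dots,\mathcal K_m)$ is $\frac{1}{m!}$ times the coefficient of $t_1 t_2 \cdots t_m$ in the polynomial $\mathrm{Vol}(t_1 \mathcal K_1 + \cdots + t_m \mathcal K_m)$. With this normalization $V(\mathcal K,\dots,\mathcal K)=\mathrm{Vol}(\mathcal K)$. The mixed volume in a $d$-dimensional linear subspace of $\mathbb R^n$ is defined by identifying that subspace isometrically with $\mathbb R^d$ (the value does not depend on the identification). *)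

theory Defs
  imports "HOL-Probability.Probability"
begin

text \<open>
  \<open>orthant_partials [i1, ..., ik] f t\<close> is the iterated partial derivative
  \<open>\<partial>\<^sup>k f / (\<partial>t\<^bsub>i1\<^esub> \<cdots> \<partial>t\<^bsub>ik\<^esub>)\<close> of a function of
  the variables \<open>t\<^sub>0, t\<^sub>1, \<dots> \<ge> 0\<close>. The derivatives are taken within
  \<open>[0, \<infinity>)\<close>, so at the boundary of the orthant they are one-sided.
\<close>

primrec orthant_partials ::
  "nat list \<Rightarrow> ((nat \<Rightarrow> real) \<Rightarrow> real) \<Rightarrow> (nat \<Rightarrow> real) \<Rightarrow> real" where
  "orthant_partials [] f t = f t"
| "orthant_partials (i # is) f t =
     vector_derivative (\<lambda>s. orthant_partials is f (t(i := s))) (at (t i) within {0..})"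

text \<open>
  In dimension \<open>m = DIM('a)\<close> only the first \<open>m\<close> members of the family \<open>K\<close> matter.
  The sum of sets is the Minkowski sum.
\<close>

definition mixed_volume :: "(nat \<Rightarrow> 'a::euclidean_space set) \<Rightarrow> real" where
  "mixed_volume K =
     orthant_partials [0..<DIM('a)]
       (\<lambda>t. measure lebesgue (\<Sum>i<DIM('a). (\<lambda>x. t i *\<^sub>R x) ` K i)) (\<lambda>_. 0)
     / fact (DIM('a))"

definition orthogonal_projection :: "'a::euclidean_space set \<Rightarrow> 'a \<Rightarrow> 'a" where
  "orthogonal_projection S x = (THE y. y \<in> S \<and> (\<forall>z\<in>S. orthogonal (x - y) z))"

text \<open>
  An isometric identification of a linear subspace \<open>S\<close> with \<open>'b\<close>; it exists
  whenever \<open>dim S = DIM('b)\<close>.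
\<close>

definition subspace_identification ::
  "'a::euclidean_space set \<Rightarrow> 'a \<Rightarrow> 'b::euclidean_space" where
  "subspace_identification S =
     (SOME f. linear f \<and> (\<forall>x\<in>S. norm (f x) = norm x) \<and> f ` S = UNIV)"

definition grassmannian :: "nat \<Rightarrow> 'a::euclidean_space set set" where
  "grassmannian d = {S. subspace S \<and> dim S = d}"

text \<open>
  The Grassmannian carries the topology that makes \<open>S \<mapsto> P\<^sub>S\<close>, the matrix of the
  orthogonal projection onto \<open>S\<close>, a homeomorphism onto its image. Its Borel
  sets are therefore the preimages of the Borel sets of matrices.
\<close>

definition grassmannian_borel :: "nat \<Rightarrow> (real ^ 'n) set measure" where
  "grassmannian_borel d =
     vimage_algebra (grassmannian d) (\<lambda>S. matrix (orthogonal_projection S)) borel"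

text \<open>There is exactly one such measure whenever \<open>d \<le> CARD('n)\<close>.\<close>

definition invariant_grassmannian_probability ::
  "nat \<Rightarrow> (real ^ 'n) set measure \<Rightarrow> bool" where
  "invariant_grassmannian_probability d M \<longleftrightarrow>
     prob_space M \<and> sets M = sets (grassmannian_borel d) \<and>
     (\<forall>g. orthogonal_transformation g \<longrightarrow> distr M M (\<lambda>S. g ` S) = M)"

end

theory Submission
  imports Defs
begin

text \<open>Equality holds, by a Kubota formula. The volume of a convex body is the integral of the
  determinant of the Hessian of a convex function whose gradient maps onto the body up to its
  boundary. Such functions add under Minkowski sums, so volumes of Minkowski sums are polynomials in
  the coefficients, and by interpolation it suffices to relate, for a single body \<open>K\<close>, the coefficient
  of \<open>s\<^sup>k\<close> with \<open>k = n - d\<close> in the Steiner polynomial \<open>Vol(K + s B)\<close> to the mean volume of the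
  \<open>d\<close>-dimensional projections of \<open>K\<close>.

  The ball is, up to scaling, the mean of the segments \<open>[-u, u]\<close> for \<open>u\<close> uniform in the ball, and
  the Hessians of the segments have rank one. Hence the expected volume of
  \<open>K + r ([-u\<^sub>1, u\<^sub>1] + \<cdots> + [-u\<^sub>k, u\<^sub>k])\<close> is a polynomial in \<open>r\<close> whose leading coefficient is, up to
  a factor independent of \<open>K\<close>, that coefficient of the Steiner polynomial. On the other hand, dividing
  by \<open>r\<^sup>k\<close> and letting \<open>r\<close> tend to infinity gives the volume of the zonotope times the volume of the
  projection of \<open>K\<close> onto \<open>{u\<^sub>1, \<dots>, u\<^sub>k}\<^sup>\<bottom>\<close>. Averaging over rotations, realised as Gram--Schmidt frames of
  independent points of the ball, replaces this subspace by a uniformly distributed one, and the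
  constants are found by taking \<open>K\<close> to be the ball.\<close>

section \<open>Isometries and change of variables\<close>

text \<open>Mixed volumes are iterated one-sided derivatives at the boundary of the orthant, so
  polynomiality of the volume of a Minkowski sum must come first; determinants of sums of Hessians
  have it at every \<open>x\<close>, and integration preserves it. Interpolation then writes a mixed
  volume as a combination of volumes of single bodies with weights of both signs, so an inequality
  for single bodies would not carry over: the formula for one body has to be an equality. Rank one
  matters because a determinant is affine along a rank one matrix, so averaging over one segment
  adds exactly a first derivative. The normal flat of a random zonotope occurs weighted by the
  volume of the zonotope. An independent random rotation of the body separates this weight from the
  projection, and the comparison with the unit ball absorbs both the weight and the constant
  \<open>ball_mean\<close>, so neither is ever evaluated. The measure on the Grassmannian is
  accessible only through its invariance; Fubini compares it with the random rotations.\<close>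

lemma borel_measurable_linear:
  fixes f :: "'a::euclidean_space \<Rightarrow> 'b::euclidean_space"
  shows "linear f \<Longrightarrow> f \<in> borel_measurable borel"
  by (intro borel_measurable_continuous_onI linear_continuous_on) (simp add: linear_linear)

text \<open>The uniqueness proof for Haar measure: the integral of
  \<open>indicator C x * indicator D (x + y)\<close> over both variables is computed in either
  order, and translations inside the inner integrals exchange the roles of \<open>C\<close> and
  \<open>D\<close>. The cross-multiplied form avoids division by values that may be 0 or infinite.
  It serves twice, for isometries and for cylinders.\<close>

lemma translation_invariant_measure_unique:
  fixes \<nu> :: "'a::euclidean_space measure"
  assumes sets [measurable_cong]: "sets \<nu> = sets borel"
    and transl: "\<And>c. distr \<nu> borel ((+) c) = \<nu>"
    and fin: "\<And>r. emeasure \<nu> (cball 0 r) < \<infinity>"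
    and C [measurable]: "C \<in> sets borel" and D [measurable]: "D \<in> sets borel"
  shows "emeasure \<nu> C * emeasure lborel D = emeasure \<nu> D * emeasure lborel C"
proof -
  have sp: "space \<nu> = UNIV"
    using sets_eq_imp_space_eq[OF sets] by simp
  interpret \<nu>: sigma_finite_measure \<nu>
  proof
    show "\<exists>A. countable A \<and> A \<subseteq> sets \<nu> \<and> \<Union>A = space \<nu> \<and> (\<forall>a\<in>A. emeasure \<nu> a \<noteq> \<infinity>)"
    proof (intro exI conjI)
      show "\<Union>(range (\<lambda>n::nat. cball (0::'a) (real n))) = space \<nu>"
        unfolding sp by (auto simp: real_arch_simple)
    qed (use fin in \<open>auto simp: less_top[symmetric] sets\<close>)
  qed
  interpret P: pair_sigma_finite lborel \<nu> by standard
  have lb_neg: "distr lborel borel (\<lambda>y::'a. c - y) = lborel" for c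
    using lborel_affine[of "-1" c] by (simp add: density_1)
  have tr\<nu>: "(\<integral>\<^sup>+x. f (c + x) \<partial>\<nu>) = (\<integral>\<^sup>+x. f x \<partial>\<nu>)" if [measurable]: "f \<in> borel_measurable borel" for f c
    by (subst (2) transl[of c, symmetric], subst nn_integral_distr) auto
  have trl: "(\<integral>\<^sup>+y. f (x + y) \<partial>lborel) = (\<integral>\<^sup>+y. f y \<partial>lborel)"
    if [measurable]: "f \<in> borel_measurable borel" for f and x :: 'a
    by (subst (2) lborel_distr_plus[of x, symmetric], subst nn_integral_distr) auto
  have trn: "(\<integral>\<^sup>+y. f (x - y) \<partial>lborel) = (\<integral>\<^sup>+y. f y \<partial>lborel)"
    if [measurable]: "f \<in> borel_measurable borel" for f and x :: 'a
    by (subst (2) lb_neg[of x, symmetric], subst nn_integral_distr) auto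
  have "emeasure \<nu> C * emeasure lborel D = (\<integral>\<^sup>+x. indicator C x * (\<integral>\<^sup>+y. indicator D y \<partial>lborel) \<partial>\<nu>)"
    by (simp add: nn_integral_multc)
  also have "\<dots> = (\<integral>\<^sup>+x. (\<integral>\<^sup>+y. indicator C x * indicator D (x + y) \<partial>lborel) \<partial>\<nu>)"
  proof (rule nn_integral_cong)
    fix x :: 'a
    show "indicator C x * (\<integral>\<^sup>+y. indicator D y \<partial>lborel) = (\<integral>\<^sup>+y. indicator C x * indicator D (x + y) \<partial>lborel)"
      by (subst trl[symmetric, where x = x]) (auto simp: nn_integral_cmult)
  qed
  also have "\<dots> = (\<integral>\<^sup>+y. (\<integral>\<^sup>+x. indicator C x * indicator D (x + y) \<partial>\<nu>) \<partial>lborel)"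
    by (rule P.Fubini') measurable
  also have "\<dots> = (\<integral>\<^sup>+y. (\<integral>\<^sup>+x. indicator C (x - y) * indicator D x \<partial>\<nu>) \<partial>lborel)"
  proof (rule nn_integral_cong)
    fix y :: 'a
    show "(\<integral>\<^sup>+x. indicator C x * indicator D (x + y) \<partial>\<nu>) = (\<integral>\<^sup>+x. indicator C (x - y) * indicator D x \<partial>\<nu>)"
      using tr\<nu>[of "\<lambda>x. indicator C (x - y) * indicator D x" y] by (simp add: add.commute)
  qed
  also have "\<dots> = (\<integral>\<^sup>+x. (\<integral>\<^sup>+y. indicator C (x - y) * indicator D x \<partial>lborel) \<partial>\<nu>)"
    by (rule P.Fubini'[symmetric]) measurable
  also have "\<dots> = (\<integral>\<^sup>+x. indicator D x * (\<integral>\<^sup>+y. indicator C y \<partial>lborel) \<partial>\<nu>)"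
  proof (rule nn_integral_cong)
    fix x :: 'a
    show "(\<integral>\<^sup>+y. indicator C (x - y) * indicator D x \<partial>lborel) = indicator D x * (\<integral>\<^sup>+y. indicator C y \<partial>lborel)"
      by (subst trn[where x = x, symmetric]) (auto simp: nn_integral_multc mult.commute)
  qed
  also have "\<dots> = emeasure \<nu> D * emeasure lborel C"
    by (simp add: nn_integral_multc)
  finally show ?thesis .
qed

text \<open>The push-forward is translation invariant, hence proportional to Lebesgue measure, and
  the unit ball, whose preimage is the unit ball, makes the factor 1. Domain and codomain are
  separate types so that coordinates can be relabelled.\<close>

lemma lborel_distr_isometry:
  fixes f :: "'a::euclidean_space \<Rightarrow> 'b::euclidean_space"
  assumes lin: "linear f" and norm: "\<And>x. norm (f x) = norm x" and surj: "surj f"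
  shows "distr lborel borel f = lborel"
proof -
  have [measurable]: "f \<in> borel_measurable borel"
    using lin by (rule borel_measurable_linear)
  have inj: "inj f"
    unfolding linear_injective_0[OF lin] using norm by (metis norm_eq_zero)
  have dim: "DIM('a) = DIM('b)"
    using dim_image_eq[OF lin, of UNIV] inj surj by simp
  let ?\<nu> = "distr lborel borel f"
  have pre: "f -` cball 0 r = cball 0 r" for r
    by (auto simp: norm)
  have cb: "emeasure ?\<nu> (cball 0 r) = emeasure lborel (cball (0::'a) r)" for r
    by (simp add: emeasure_distr pre)
  have eq: "emeasure ?\<nu> C * emeasure lborel D = emeasure ?\<nu> D * emeasure lborel C"
    if "C \<in> sets borel" "D \<in> sets borel" for C D
  proof (rule translation_invariant_measure_unique[OF _ _ _ that])
    fix c :: 'b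
    obtain c' where c': "c = f c'" using surj by auto
    have "distr ?\<nu> borel ((+) c) = distr lborel borel (f \<circ> ((+) c'))"
      by (subst distr_distr) (auto simp: o_def c' linear_add[OF lin])
    also have "\<dots> = distr (distr lborel borel ((+) c')) borel f"
      by (subst distr_distr) auto
    also have "\<dots> = ?\<nu>" by (simp add: lborel_distr_plus)
    finally show "distr ?\<nu> borel ((+) c) = ?\<nu>" .
  next
    show "emeasure ?\<nu> (cball 0 r) < \<infinity>" for r
      using emeasure_lborel_cball_finite[of "0::'a" r] by (simp add: cb)
  qed simp
  show ?thesis
  proof (rule measure_eqI)
    fix C assume "C \<in> sets ?\<nu>"
    then have C: "C \<in> sets borel" by simp
    let ?v = "emeasure lborel (cball (0::'b) 1)"
    have v: "emeasure ?\<nu> (cball 0 1) = ?v"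
      by (simp add: cb emeasure_cball dim)
    have "?v \<noteq> 0" "?v \<noteq> \<infinity>"
      by (auto simp: emeasure_cball unit_ball_vol_pos less_imp_le[OF unit_ball_vol_pos] ennreal_eq_0_iff not_le)
    moreover have "?v * emeasure ?\<nu> C = ?v * emeasure lborel C"
      using eq[OF C, of "cball 0 1"] v by (simp add: mult.commute)
    ultimately show "emeasure ?\<nu> C = emeasure lborel C"
      by (simp add: ennreal_mult_cancel_left)
  qed simp
qed

lemma emeasure_isometry_image:
  fixes f :: "'a::euclidean_space \<Rightarrow> 'b::euclidean_space"
  assumes lin: "linear f" and norm: "\<And>x. norm (f x) = norm x" and surj: "surj f"
    and C: "f ` C \<in> sets borel"
  shows "emeasure lborel (f ` C) = emeasure lborel C"
proof -
  have [measurable]: "f \<in> borel_measurable borel"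
    using lin by (rule borel_measurable_linear)
  have inj: "inj f"
    unfolding linear_injective_0[OF lin] using norm by (metis norm_eq_zero)
  have "emeasure lborel (f ` C) = emeasure (distr lborel borel f) (f ` C)"
    using lborel_distr_isometry[OF lin norm surj] by simp
  also have "\<dots> = emeasure lborel C"
    using C by (simp add: emeasure_distr inj_vimage_image_eq[OF inj])
  finally show ?thesis .
qed

text \<open>Conjugation by \<open>\<sigma>\<close> is a sign-preserving bijection between the
  permutations of the two index types.\<close>

lemma det_reindex:
  fixes \<sigma> :: "'m::finite \<Rightarrow> 'n::finite" and A :: "real ^ 'n ^ 'n"
  assumes "bij \<sigma>"
  shows "det (\<chi> i j. A $ \<sigma> i $ \<sigma> j) = det A"
proof -
  have inj: "inj \<sigma>" and ii [simp]: "inv \<sigma> (\<sigma> x) = x" for x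
    using assms by (auto simp: bij_is_inj)
  have ss [simp]: "\<sigma> (inv \<sigma> y) = y" for y
    using assms by (meson bij_inv_eq_iff)
  let ?c = "\<lambda>p. \<sigma> \<circ> p \<circ> inv \<sigma>"
  have mp: "map_permutation UNIV \<sigma> p = ?c p" for p
    using assms by (simp add: map_permutation_def fun_eq_iff bij_is_surj)
  have bc: "bij_betw ?c {p. p permutes (UNIV::'m set)} {p. p permutes (UNIV::'n set)}"
  proof (rule bij_betw_byWitness[where f' = "\<lambda>q. inv \<sigma> \<circ> q \<circ> \<sigma>"])
    show "?c ` {p. p permutes UNIV} \<subseteq> {p. p permutes UNIV}"
      using map_permutation_permutes[of \<sigma> UNIV UNIV] assms by (auto simp: mp[symmetric])
    have "inv \<sigma> \<circ> q \<circ> \<sigma> permutes UNIV" if "q permutes UNIV" for q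
    proof (rule bij_imp_permutes)
      show "bij_betw (inv \<sigma> \<circ> q \<circ> \<sigma>) UNIV UNIV"
        using permutes_bij[OF that] assms by (intro bij_comp bij_imp_bij_inv) auto
    qed auto
    then show "(\<lambda>q. inv \<sigma> \<circ> q \<circ> \<sigma>) ` {p. p permutes UNIV} \<subseteq> {p. p permutes UNIV}"
      by auto
  qed (auto simp: fun_eq_iff)
  have sgn: "sign (?c p) = sign p" if "p permutes UNIV" for p
    using sign_map_permutation[of \<sigma> UNIV p] inj that by (simp add: mp)
  have pr: "(\<Prod>i\<in>UNIV. A $ i $ (?c p) i) = (\<Prod>i\<in>UNIV. A $ \<sigma> i $ \<sigma> (p i))" for p
    by (rule prod.reindex_bij_betw[OF assms, symmetric, THEN trans]) simp
  show ?thesis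
    unfolding det_def
    by (subst sum.reindex_bij_betw[OF bc, symmetric]) (auto intro!: sum.cong simp: sgn pr simp del: o_apply)
qed

text \<open>The change of variables theorem of the library is restricted to well-ordered index types.
  Every finite type has a well-ordered copy, to which the theorem is transferred.\<close>

typedef 'n wo_copy = "UNIV :: 'n set" by simp

instance wo_copy :: (finite) finite
proof
  show "finite (UNIV :: 'a wo_copy set)"
    by (rule finite_imageD[where f = Rep_wo_copy]) (auto simp: inj_on_def Rep_wo_copy_inject)
qed

definition wo_index :: "'n::finite wo_copy \<Rightarrow> nat" where
  "wo_index = (SOME f. inj f)"

lemma inj_wo_index: "inj (wo_index :: 'n::finite wo_copy \<Rightarrow> nat)"
proof -
  obtain f :: "'n wo_copy \<Rightarrow> nat" where "inj f"
    using finite_imp_inj_to_nat_seg[of "UNIV :: 'n wo_copy set"] by auto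
  then show ?thesis
    unfolding wo_index_def by (rule someI[where P = inj])
qed

instantiation wo_copy :: (finite) wellorder
begin
definition "x \<le> y \<longleftrightarrow> wo_index x \<le> wo_index y"
definition "x < y \<longleftrightarrow> wo_index x < wo_index y"
instance
proof
  fix P :: "'a wo_copy \<Rightarrow> bool" and a
  assume step: "\<And>x. (\<And>y. y < x \<Longrightarrow> P y) \<Longrightarrow> P x"
  show "P a"
    by (rule measure_induct_rule[of wo_index P], rule step) (simp add: less_wo_copy_def)
qed (auto simp: less_eq_wo_copy_def less_wo_copy_def intro: injD[OF inj_wo_index])
end

lemma bij_Rep_wo_copy: "bij Rep_wo_copy"
  by (rule bij_betw_byWitness[where f' = Abs_wo_copy]) (auto simp: Abs_wo_copy_inverse Rep_wo_copy_inverse)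

lemma emeasure_range_inj_derivative:
  fixes G :: "real ^ 'n \<Rightarrow> real ^ 'n" and H :: "real ^ 'n \<Rightarrow> real ^ 'n ^ 'n"
  assumes der: "\<And>x. (G has_derivative (*v) (H x)) (at x)" and inj: "inj G"
    and bnd: "bounded (range G)" and cont: "continuous_on UNIV H"
  shows "emeasure lborel (range G) = (\<integral>\<^sup>+x. ennreal \<bar>det (H x)\<bar> \<partial>lborel)"
proof -
  define \<phi> :: "real ^ 'n \<Rightarrow> real ^ 'n wo_copy" where "\<phi> = (\<lambda>x. \<chi> i. x $ Rep_wo_copy i)"
  define \<psi> :: "real ^ 'n wo_copy \<Rightarrow> real ^ 'n" where "\<psi> = (\<lambda>x. \<chi> i. x $ Abs_wo_copy i)"
  have \<phi>\<psi> [simp]: "\<phi> (\<psi> y) = y" "\<psi> (\<phi> x) = x" for x y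
    by (simp_all add: \<phi>_def \<psi>_def vec_eq_iff Abs_wo_copy_inverse Rep_wo_copy_inverse)
  have lin: "linear \<phi>" "linear \<psi>"
    by (auto simp: \<phi>_def \<psi>_def vec_eq_iff intro!: linearI)
  have norm\<phi>: "norm (\<phi> x) = norm x" for x
    unfolding norm_vec_def L2_set_def \<phi>_def
    by (simp add: sum.reindex_bij_betw[OF bij_Rep_wo_copy, of "\<lambda>i. (x $ i)\<^sup>2"])
  have norm\<psi>: "norm (\<psi> x) = norm x" for x
    using norm\<phi>[of "\<psi> x"] by simp
  have surj: "surj \<phi>" "surj \<psi>"
    by (rule surjI[of \<phi> \<psi>], simp) (rule surjI[of \<psi> \<phi>], simp)
  have [measurable]: "\<phi> \<in> borel_measurable borel" "\<psi> \<in> borel_measurable borel"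
    using lin by (auto intro: borel_measurable_linear)
  have contG: "continuous_on UNIV G"
    using der by (meson continuous_at_imp_continuous_on has_derivative_continuous)
  have detc: "(\<lambda>x. det (H x)) \<in> borel_measurable borel"
    by (intro borel_measurable_continuous_onI) (unfold det_def, intro continuous_intros cont)
  \<comment> \<open>\<open>F\<close> is \<open>G\<close> with its coordinates relabelled by the
    well-ordered index type; \<open>\<phi>\<close> and \<open>\<psi>\<close> are isometries, so
    neither volumes nor determinants change.\<close>
  define F where "F = \<phi> \<circ> G \<circ> \<psi>"
  define M where "M = (\<lambda>y. (\<chi> i j. H (\<psi> y) $ Rep_wo_copy i $ Rep_wo_copy j) :: real ^ 'n wo_copy ^ 'n wo_copy)"
  have Mv: "M y *v h = \<phi> (H (\<psi> y) *v \<psi> h)" for y h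
  proof -
    have "(\<Sum>j\<in>UNIV. H (\<psi> y) $ Rep_wo_copy i $ Rep_wo_copy j * h $ j) =
        (\<Sum>k\<in>UNIV. H (\<psi> y) $ Rep_wo_copy i $ k * h $ Abs_wo_copy k)" for i
      using sum.reindex_bij_betw[OF bij_Rep_wo_copy, of "\<lambda>k. H (\<psi> y) $ Rep_wo_copy i $ k * h $ Abs_wo_copy k"]
      by (simp add: Rep_wo_copy_inverse)
    then show ?thesis
      by (simp add: vec_eq_iff M_def matrix_vector_mult_def \<phi>_def \<psi>_def)
  qed
  have derF: "(F has_derivative (*v) (M y)) (at y within UNIV)" for y
  proof -
    have "((\<lambda>y. \<phi> (G (\<psi> y))) has_derivative (\<lambda>h. \<phi> (H (\<psi> y) *v \<psi> h))) (at y)"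
      by (intro has_derivative_compose[OF _ linear_imp_has_derivative, of _ _ _ _ \<phi>]
                has_derivative_compose[OF linear_imp_has_derivative der] lin)
    then show ?thesis by (simp add: F_def o_def Mv[symmetric])
  qed
  have injF: "inj_on F UNIV"
  proof (rule injI)
    fix x y assume "F x = F y"
    then have "\<psi> (F x) = \<psi> (F y)" by simp
    then have "\<psi> x = \<psi> y" using inj by (simp add: F_def inj_eq)
    then have "\<phi> (\<psi> x) = \<phi> (\<psi> y)" by simp
    then show "x = y" by simp
  qed
  have rF: "range F = \<phi> ` range G"
  proof -
    have "range F = \<phi> ` G ` range \<psi>" by (simp add: F_def image_image)
    then show ?thesis using surj(2) by simp
  qed
  have mF: "range G \<in> sets borel" "range F \<in> sets borel"
  proof -
    have "continuous_on UNIV F"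
      using derF by (meson continuous_at_imp_continuous_on has_derivative_continuous)
    \<comment> \<open>The whole space is a countable union of closed balls, so its continuous image
      is a countable union of compact sets.\<close>
    have borel_range: "range g \<in> sets borel" if "continuous_on UNIV g"
      for g :: "'a::euclidean_space \<Rightarrow> 'b::euclidean_space"
    proof -
      have "range g = (\<Union>n::nat. g ` cball 0 (real n))"
      proof (intro equalityI subsetI)
        fix y assume "y \<in> range g"
        then obtain x where "y = g x" by auto
        moreover obtain n :: nat where "norm x \<le> real n" using real_arch_simple by blast
        ultimately show "y \<in> (\<Union>n::nat. g ` cball 0 (real n))"
          by (intro UN_I[of n] UNIV_I rev_image_eqI[of x]) auto
      qed auto
      moreover have "g ` cball 0 (real n) \<in> sets borel" for n
        by (intro borel_compact compact_continuous_image continuous_on_subset[OF that]) auto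
      ultimately show ?thesis by auto
    qed
    show "range G \<in> sets borel" "range F \<in> sets borel"
      by (auto intro!: borel_range contG \<open>continuous_on UNIV F\<close>)
  qed
  have em: "emeasure lborel (range F) = emeasure lborel (range G)"
    unfolding rF by (rule emeasure_isometry_image) (use lin norm\<phi> surj mF rF in auto)
  \<comment> \<open>Boundedness makes the volume of the range finite, so that it can enter the
    change of variables as a real number.\<close>
  have "bounded (range F)"
    unfolding rF using lin(1) bnd by (simp add: bounded_linear_image linear_linear)
  then have lm: "range F \<in> lmeasurable"
    using mF by (intro bounded_set_imp_lmeasurable) auto
  have dM: "det (M y) = det (H (\<psi> y))" for y
    unfolding M_def by (rule det_reindex[OF bij_Rep_wo_copy])
  have "((\<lambda>x. \<bar>det (matrix ((*v) (M x)))\<bar>) has_integral measure lebesgue (range F)) UNIV"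
    using has_measure_differentiable_image[of UNIV F "\<lambda>y. (*v) (M y)" "measure lebesgue (range F)"] derF injF lm
    by auto
  then have hi: "((\<lambda>x. \<bar>det (M x)\<bar>) has_integral measure lebesgue (range F)) UNIV"
    by (simp add: matrix_of_matrix_vector_mul)
  have "(\<integral>\<^sup>+x. ennreal \<bar>det (M x)\<bar> \<partial>lborel) = ennreal (measure lebesgue (range F))"
    by (rule nn_integral_has_integral_lborel[OF _ _ hi]) (use detc in \<open>auto simp: dM\<close>)
  also have "\<dots> = emeasure lborel (range F)"
    using lm mF(2) by (simp add: emeasure_eq_measure2[symmetric] fmeasurable_def)
  also note em
  finally have "emeasure lborel (range G) = (\<integral>\<^sup>+x. ennreal \<bar>det (H (\<psi> x))\<bar> \<partial>lborel)"
    by (simp add: dM)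
  also have "\<dots> = (\<integral>\<^sup>+x. ennreal \<bar>det (H x)\<bar> \<partial>distr lborel borel \<psi>)"
    using detc by (subst nn_integral_distr) auto
  also have "distr lborel borel \<psi> = lborel"
    by (rule lborel_distr_isometry) (use lin norm\<psi> surj in auto)
  finally show ?thesis .
qed

section \<open>Volume as an integral of Hessian determinants\<close>

text \<open>On the segment from the identity to \<open>A\<close> every matrix is positive definite,
  hence invertible, so the determinant keeps the sign that it has at the identity. Only the
  quadratic form enters; symmetry of the Hessians never has to be established.\<close>

lemma det_pos_of_positive_definite:
  fixes A :: "real ^ 'n ^ 'n"
  assumes pos: "\<And>v. v \<noteq> 0 \<Longrightarrow> 0 < v \<bullet> (A *v v)"
  shows "0 < det A"
proof (rule ccontr)
  assume "\<not> 0 < det A"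
  define B where "B t = (\<chi> i j. (1 - t) * (mat 1 :: real ^ 'n ^ 'n) $ i $ j + t * A $ i $ j)" for t
  have B: "B t *v v = (1 - t) *\<^sub>R v + t *\<^sub>R (A *v v)" for t v
  proof -
    have "B t = (1 - t) *\<^sub>R mat 1 + t *\<^sub>R A"
      by (simp add: B_def vec_eq_iff)
    then show ?thesis
      by (simp add: matrix_vector_mult_add_rdistrib scaleR_matrix_vector_assoc[symmetric])
  qed
  have nz: "det (B t) \<noteq> 0" if t: "0 \<le> t" "t \<le> 1" for t
  proof -
    have "v = 0" if "B t *v v = 0" for v
    proof (rule ccontr)
      assume "v \<noteq> 0"
      then have "0 < v \<bullet> v" "0 < v \<bullet> (A *v v)" using pos by auto
      moreover have "(1 - t) * (v \<bullet> v) + t * (v \<bullet> (A *v v)) = v \<bullet> (B t *v v)"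
        by (simp add: B inner_add_right)
      moreover have "v \<bullet> (B t *v v) = 0" using that by simp
      moreover have "0 < (1 - t) * (v \<bullet> v) + t * (v \<bullet> (A *v v))"
        using t \<open>0 < v \<bullet> v\<close> \<open>0 < v \<bullet> (A *v v)\<close>
        by (cases "t = 0") (auto intro!: add_nonneg_pos mult_nonneg_nonneg mult_pos_pos)
      ultimately show False by simp
    qed
    then have "invertible (B t)"
      by (simp add: invertible_left_inverse matrix_left_invertible_ker)
    then show ?thesis by (simp add: invertible_det_nz)
  qed
  have "continuous_on {0..1} (\<lambda>t. det (B t))"
    unfolding det_def B_def by (auto intro!: continuous_intros)
  moreover have "det (B 0) = 1"
  proof -
    have "B 0 = mat 1" by (simp add: B_def vec_eq_iff)
    then show ?thesis by simp
  qed
  moreover have "B 1 = A" by (simp add: B_def vec_eq_iff)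
  ultimately obtain t where "0 \<le> t" "t \<le> 1" "det (B t) = 0"
    using IVT2'[of "\<lambda>t. det (B t)" 1 0 0] \<open>\<not> 0 < det A\<close> by auto
  with nz show False by blast
qed

text \<open>The fifth clause makes \<open>f\<close> dominate the support function of \<open>K\<close> up to a sublinear error, so that
  \<open>f - p \<bullet> x\<close> attains its minimum, and \<open>G\<close> the value \<open>p\<close>, for every \<open>p\<close> in the interior of \<open>K\<close>. By the
  last clause the Hessian is degenerate only if \<open>K\<close> is flat.\<close>

definition potential ::
  "(real ^ 'n) set \<Rightarrow> (real ^ 'n \<Rightarrow> real) \<Rightarrow> (real ^ 'n \<Rightarrow> real ^ 'n) \<Rightarrow> (real ^ 'n \<Rightarrow> real ^ 'n ^ 'n) \<Rightarrow> bool" where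
  "potential K f G H \<longleftrightarrow>
     (\<forall>x. (f has_derivative (\<lambda>h. G x \<bullet> h)) (at x)) \<and>
     (\<forall>x. (G has_derivative (*v) (H x)) (at x)) \<and>
     continuous_on UNIV H \<and>
     range G \<subseteq> K \<and>
     (\<forall>e>0. \<exists>C. \<forall>x. \<forall>a\<in>K. a \<bullet> x \<le> f x + e * norm x + C) \<and>
     (\<forall>x v. 0 \<le> v \<bullet> (H x *v v)) \<and>
     (\<forall>x v. v \<bullet> (H x *v v) = 0 \<longrightarrow> (\<forall>a\<in>K. \<forall>b\<in>K. (a - b) \<bullet> v = 0))"

lemma potentialD:
  assumes "potential K f G H"
  shows "(f has_derivative (\<lambda>h. G x \<bullet> h)) (at x)"
    and "(G has_derivative (*v) (H x)) (at x)"
    and "continuous_on UNIV H"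
    and "G x \<in> K"
    and "0 < e \<Longrightarrow> \<exists>C. \<forall>x. \<forall>a\<in>K. a \<bullet> x \<le> f x + e * norm x + C"
    and "0 \<le> v \<bullet> (H x *v v)"
    and "v \<bullet> (H x *v v) = 0 \<Longrightarrow> a \<in> K \<Longrightarrow> b \<in> K \<Longrightarrow> (a - b) \<bullet> v = 0"
  using assms unfolding potential_def by auto

lemma potential_interior_subset_range:
  fixes K :: "(real ^ 'n) set"
  assumes pot: "potential K f G H"
  shows "interior K \<subseteq> range G"
proof
  fix p assume "p \<in> interior K"
  then obtain r where r: "r > 0" "cball p r \<subseteq> K"
    using mem_interior_cball by blast
  from pot r(1) obtain C where C: "\<And>x a. a \<in> K \<Longrightarrow> a \<bullet> x \<le> f x + (r/2) * norm x + C"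
    unfolding potential_def by (metis half_gt_zero)
  define F where "F = (\<lambda>x. f x - p \<bullet> x)"
  \<comment> \<open>Compare with the point of \<open>K\<close> at distance \<open>r\<close> from
    \<open>p\<close> in direction \<open>x\<close>: it gains \<open>r * norm x\<close> over
    \<open>p \<bullet> x\<close>, twice the permitted error. For \<open>x = 0\<close> the quotient
    \<open>r / norm x\<close> is 0 and the point is \<open>p\<close> itself.\<close>
  have lower: "(r/2) * norm x - C \<le> F x" for x
  proof -
    have "p + (r / norm x) *\<^sub>R x \<in> K"
      using r by (intro subsetD[OF r(2)]) (auto simp: dist_norm)
    from C[OF this, of x] show ?thesis
      by (cases "x = 0") (auto simp: F_def inner_add_left dot_square_norm power2_eq_square)
  qed
  have derF: "(F has_derivative (\<lambda>h. (G x - p) \<bullet> h)) (at x)" for x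
    using pot unfolding F_def potential_def
    by (auto intro!: derivative_eq_intros simp: inner_diff_left)
  then have contF: "continuous_on UNIV F"
    by (meson continuous_at_imp_continuous_on has_derivative_continuous)
  \<comment> \<open>Outside this ball \<open>lower\<close> already gives
    \<open>F 0 \<le> F y\<close>, so a minimum over the ball is global.\<close>
  define R where "R = max 0 (2 * (F 0 + C) / r)"
  obtain x0 where x0: "x0 \<in> cball 0 R" "\<And>y. y \<in> cball 0 R \<Longrightarrow> F x0 \<le> F y"
    using continuous_attains_inf[of "cball 0 R" F] continuous_on_subset[OF contF, of "cball 0 R"]
    by (force simp: R_def)
  have "F x0 \<le> F y" for y
  proof (cases "y \<in> cball 0 R")
    case False
    then have "2 * (F 0 + C) / r \<le> norm y" by (auto simp: R_def)
    then have "F 0 \<le> (r/2) * norm y - C" using r by (simp add: field_simps)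
    also have "\<dots> \<le> F y" by (rule lower)
    finally show ?thesis using x0(2)[of 0] by (simp add: R_def)
  qed (use x0 in auto)
  then have "(\<lambda>h. (G x0 - p) \<bullet> h) = (\<lambda>h. 0)"
    by (intro has_derivative_local_min[OF derF]) auto
  then have "(G x0 - p) \<bullet> (G x0 - p) = 0" by metis
  then show "p \<in> range G" by auto
qed

text \<open>Along the segment from \<open>y\<close> to \<open>x\<close> the function
  \<open>G \<bullet> v\<close> has positive derivative: the gradient of a strictly convex function
  separates points.\<close>

lemma potential_inj:
  fixes K :: "(real ^ 'n) set"
  assumes pot: "potential K f G H" and pd: "\<And>x v. v \<noteq> 0 \<Longrightarrow> 0 < v \<bullet> (H x *v v)"
  shows "inj G"
proof (rule injI, rule ccontr)
  fix x y assume eq: "G x = G y" and ne: "x \<noteq> y"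
  define v where "v = x - y"
  define g where "g = (\<lambda>s. G (y + s *\<^sub>R v) \<bullet> v)"
  have derG: "(G has_derivative (*v) (H x)) (at x)" for x
    using pot by (simp add: potential_def)
  have "(g has_real_derivative v \<bullet> (H (y + s *\<^sub>R v) *v v)) (at s)" for s
  proof -
    have "((\<lambda>s. G (y + s *\<^sub>R v)) has_derivative (\<lambda>h. H (y + s *\<^sub>R v) *v (h *\<^sub>R v))) (at s)"
      by (rule has_derivative_compose[OF _ derG]) (auto intro!: derivative_eq_intros)
    then have "((\<lambda>s. G (y + s *\<^sub>R v) \<bullet> v) has_derivative (\<lambda>h. (H (y + s *\<^sub>R v) *v (h *\<^sub>R v)) \<bullet> v)) (at s)"
      by (intro has_derivative_inner_left)
    then show ?thesis
      by (simp add: g_def has_field_derivative_def matrix_vector_mult_scaleR inner_commute mult.commute[of _ "_ \<bullet> _"])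
  qed
  then have "g 0 < g 1"
    using pd[of v] ne by (intro DERIV_pos_imp_increasing[of 0 1 g]) (auto simp: v_def)
  then show False by (simp add: g_def v_def eq)
qed

text \<open>If \<open>K\<close> has interior points, \<open>G\<close> is injective with range
  between \<open>interior K\<close> and \<open>K\<close>, and the frontier of a convex set is null.
  If \<open>K\<close> is flat, the gradients stay in a hyperplane, the Hessian is singular and both
  sides vanish.\<close>

lemma
  fixes K :: "(real ^ 'n) set"
  assumes pot: "potential K f G H" and K: "compact K" "convex K"
  shows potential_det_nonneg: "0 \<le> det (H x)"
    and potential_emeasure: "emeasure lborel K = (\<integral>\<^sup>+x. ennreal (det (H x)) \<partial>lborel)"
proof -
  have derG: "\<And>x. (G has_derivative (*v) (H x)) (at x)" and GK: "range G \<subseteq> K" and contH: "continuous_on UNIV H"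
    and psd: "\<And>x v. 0 \<le> v \<bullet> (H x *v v)"
    and deg: "\<And>x v a b. v \<bullet> (H x *v v) = 0 \<Longrightarrow> a \<in> K \<Longrightarrow> b \<in> K \<Longrightarrow> (a - b) \<bullet> v = 0"
    using pot unfolding potential_def by auto
  have Kb: "K \<in> sets borel" using K by (intro borel_compact)
  have "(0 \<le> det (H x)) \<and> emeasure lborel K = (\<integral>\<^sup>+x. ennreal (det (H x)) \<partial>lborel)"
  proof (cases "interior K = {}")
    case True
    then obtain v b where v: "v \<noteq> 0" "K \<subseteq> {x. v \<bullet> x = b}"
      using empty_interior_subset_hyperplane[OF K(2)] by blast
    have "det (H x) = 0" for x
    proof (rule ccontr)
      assume "det (H x) \<noteq> 0"
      \<comment> \<open>A regular Hessian maps some \<open>h\<close> to the normal \<open>v\<close>;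
        then \<open>G \<bullet> v\<close> would change along \<open>h\<close>, although it is
        constantly \<open>b\<close>.\<close>
      then obtain h where h: "H x *v h = v"
        by (metis invertible_det_nz invertible_right_inverse matrix_right_invertible_surjective surjD)
      have "((\<lambda>x. G x \<bullet> v) has_derivative (\<lambda>h. (H x *v h) \<bullet> v)) (at x)"
        by (intro has_derivative_inner_left derG)
      moreover have "(\<lambda>x. G x \<bullet> v) = (\<lambda>_. b)"
      proof
        fix x
        have "v \<bullet> G x = b" using v(2) GK by blast
        then show "G x \<bullet> v = b" by (simp add: inner_commute)
      qed
      ultimately have "(\<lambda>h. (H x *v h) \<bullet> v) = (\<lambda>_. 0)"
        by (metis has_derivative_const has_derivative_unique)
      then have "v \<bullet> v = 0" using h by metis
      then show False using v by simp
    qed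
    moreover have "emeasure lborel K = 0"
    proof -
      have "negligible K"
        using v negligible_hyperplane[of v b] by (metis negligible_subset)
      then show ?thesis
        using Kb by (auto simp: negligible_iff_null_sets null_sets_completion_iff)
    qed
    ultimately show ?thesis by simp
  next
    case False
    then obtain p r where r: "r > 0" "cball p r \<subseteq> K"
      using mem_interior_cball by blast
    \<comment> \<open>The ball around \<open>p\<close> contains points that differ in the direction
      \<open>v\<close>, so the last clause of \<open>potential\<close> excludes a degenerate
      direction.\<close>
    have pd: "0 < v \<bullet> (H x *v v)" if "v \<noteq> 0" for x v
    proof (rule ccontr)
      assume "\<not> 0 < v \<bullet> (H x *v v)"
      with psd[of v x] have "v \<bullet> (H x *v v) = 0" by simp
      moreover have "p \<in> K" "p + (r / norm v) *\<^sub>R v \<in> K"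
        using r that by (auto intro!: subsetD[OF r(2)] simp: dist_norm)
      ultimately have "(p + (r / norm v) *\<^sub>R v - p) \<bullet> v = 0" using deg by blast
      then show False using r that by simp
    qed
    then have dp: "0 < det (H x)" for x
      by (intro det_pos_of_positive_definite) auto
    have rb: "range G \<in> sets borel"
    proof -
      have "open (range G)"
        using derG potential_inj[OF pot pd]
        by (intro invariance_of_domain) (auto intro: continuous_at_imp_continuous_on has_derivative_continuous)
      then show ?thesis by auto
    qed
    have "emeasure lborel (range G) = (\<integral>\<^sup>+x. ennreal \<bar>det (H x)\<bar> \<partial>lborel)"
      using potential_inj[OF pot pd] bounded_subset[OF compact_imp_bounded[OF K(1)] GK] derG contH
      by (intro emeasure_range_inj_derivative) auto
    also have "\<dots> = (\<integral>\<^sup>+x. ennreal (det (H x)) \<partial>lborel)"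
      using dp by (simp add: less_imp_le)
    finally have 1: "emeasure lborel (range G) = (\<integral>\<^sup>+x. ennreal (det (H x)) \<partial>lborel)" .
    have "emeasure lborel (frontier K) = 0"
    proof -
      have "frontier K \<in> sets lborel" by auto
      then show ?thesis
        using negligible_convex_frontier[OF K(2)] by (auto simp: negligible_iff_null_sets null_sets_completion_iff)
    qed
    have "K \<subseteq> range G \<union> frontier K"
      using potential_interior_subset_range[OF pot] compact_imp_closed[OF K(1)] by (auto simp: frontier_def)
    then have "emeasure lborel K \<le> emeasure lborel (range G \<union> frontier K)"
      using rb by (intro emeasure_mono) auto
    also have "\<dots> \<le> emeasure lborel (range G) + emeasure lborel (frontier K)"
      using rb by (intro emeasure_subadditive) auto
    finally have "emeasure lborel K \<le> emeasure lborel (range G)"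
      using \<open>emeasure lborel (frontier K) = 0\<close> by simp
    moreover have "emeasure lborel (range G) \<le> emeasure lborel K"
      using GK Kb by (intro emeasure_mono) auto
    ultimately show ?thesis using 1 dp[of x] by simp
  qed
  then show "0 \<le> det (H x)" "emeasure lborel K = (\<integral>\<^sup>+x. ennreal (det (H x)) \<partial>lborel)"
    by auto
qed

lemma potential_add:
  fixes K L :: "(real ^ 'n) set"
  assumes "potential K f G H" "potential L f' G' H'"
  shows "potential (K + L) (\<lambda>x. f x + f' x) (\<lambda>x. G x + G' x) (\<lambda>x. H x + H' x)"
  unfolding potential_def
proof (intro conjI allI impI)
  note 1 = potentialD[OF assms(1)] and 2 = potentialD[OF assms(2)]
  show "((\<lambda>x. f x + f' x) has_derivative (\<lambda>h. (G x + G' x) \<bullet> h)) (at x)" for x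
    using 1 2 by (auto intro!: derivative_eq_intros simp: inner_add_left)
  show "((\<lambda>x. G x + G' x) has_derivative (*v) (H x + H' x)) (at x)" for x
    using 1 2 by (auto intro!: derivative_eq_intros simp: matrix_vector_mult_add_rdistrib)
  show "continuous_on UNIV (\<lambda>x. H x + H' x)"
    using 1 2 by (auto intro!: continuous_intros)
  show "range (\<lambda>x. G x + G' x) \<subseteq> K + L"
    using 1 2 by (auto intro!: set_plus_intro)
  show "\<exists>C. \<forall>x. \<forall>a\<in>K + L. a \<bullet> x \<le> f x + f' x + e * norm x + C" if "0 < e" for e
  proof -
    have "0 < e / 2" using that by simp
    obtain C where C: "\<And>x a. a \<in> K \<Longrightarrow> a \<bullet> x \<le> f x + (e/2) * norm x + C"
      using 1(5)[OF \<open>0 < e / 2\<close>] by blast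
    obtain C' where C': "\<And>x a. a \<in> L \<Longrightarrow> a \<bullet> x \<le> f' x + (e/2) * norm x + C'"
      using 2(5)[OF \<open>0 < e / 2\<close>] by blast
    have "(a + b) \<bullet> x \<le> f x + f' x + e * norm x + (C + C')" if "a \<in> K" "b \<in> L" for a b x
      using C[OF that(1), of x] C'[OF that(2), of x] by (simp add: inner_add_left)
    then show ?thesis by (intro exI[of _ "C + C'"]) (auto elim!: set_plus_elim)
  qed
  show "0 \<le> v \<bullet> ((H x + H' x) *v v)" for x v
    using 1 2 by (simp add: matrix_vector_mult_add_rdistrib inner_add_right)
  show "\<forall>a\<in>K + L. \<forall>b\<in>K + L. (a - b) \<bullet> v = 0" if "v \<bullet> ((H x + H' x) *v v) = 0" for x v
  proof -
    have "v \<bullet> (H x *v v) + v \<bullet> (H' x *v v) = 0"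
      using that by (simp add: matrix_vector_mult_add_rdistrib inner_add_right)
    moreover have "0 \<le> v \<bullet> (H x *v v)" "0 \<le> v \<bullet> (H' x *v v)" using 1 2 by auto
    ultimately have "v \<bullet> (H x *v v) = 0" "v \<bullet> (H' x *v v) = 0" by auto
    then have "\<forall>a\<in>K. \<forall>b\<in>K. (a - b) \<bullet> v = 0" "\<forall>a\<in>L. \<forall>b\<in>L. (a - b) \<bullet> v = 0" using 1(7) 2(7) by blast+
    note z = this
    show ?thesis
    proof (intro ballI)
      fix a b assume "a \<in> K + L" "b \<in> K + L"
      then obtain a1 a2 b1 b2 where ab: "a = a1 + a2" "b = b1 + b2" "a1 \<in> K" "b1 \<in> K" "a2 \<in> L" "b2 \<in> L"
        by (auto elim!: set_plus_elim)
      have "(a1 - b1) \<bullet> v = 0" "(a2 - b2) \<bullet> v = 0" using z ab by auto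
      then show "(a - b) \<bullet> v = 0" by (simp add: ab inner_diff_left inner_add_left)
    qed
  qed
qed

lemma potential_scale:
  fixes K :: "(real ^ 'n) set"
  assumes "potential K f G H" "0 \<le> t"
  shows "potential ((*\<^sub>R) t ` K) (\<lambda>x. t * f x) (\<lambda>x. t *\<^sub>R G x) (\<lambda>x. t *\<^sub>R H x)"
  unfolding potential_def
proof (intro conjI allI impI)
  note 1 = potentialD[OF assms(1)]
  show "((\<lambda>x. t * f x) has_derivative (\<lambda>h. (t *\<^sub>R G x) \<bullet> h)) (at x)" for x
    using 1 by (auto intro!: derivative_eq_intros)
  show "((\<lambda>x. t *\<^sub>R G x) has_derivative (*v) (t *\<^sub>R H x)) (at x)" for x
    using 1 by (auto intro!: derivative_eq_intros simp: scaleR_matrix_vector_assoc)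
  show "continuous_on UNIV (\<lambda>x. t *\<^sub>R H x)"
    using 1 by (auto intro!: continuous_intros)
  show "range (\<lambda>x. t *\<^sub>R G x) \<subseteq> (*\<^sub>R) t ` K"
    using 1 by auto
  show "\<exists>C. \<forall>x. \<forall>a\<in>(*\<^sub>R) t ` K. a \<bullet> x \<le> t * f x + e * norm x + C" if "0 < e" for e
  proof -
    \<comment> \<open>Dividing by \<open>t + 1\<close> instead of \<open>t\<close> includes the case
      \<open>t = 0\<close>.\<close>
    have "0 < e / (t + 1)" using that assms by simp
    with 1(5) obtain C where C: "\<And>x a. a \<in> K \<Longrightarrow> a \<bullet> x \<le> f x + e / (t + 1) * norm x + C"
      by blast
    have "t * (a \<bullet> x) \<le> t * f x + e * norm x + t * C" if "a \<in> K" for a x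
    proof -
      have "t * (a \<bullet> x) \<le> t * (f x + e / (t + 1) * norm x + C)"
        using C[OF that] assms by (intro mult_left_mono) auto
      also have "\<dots> = t * f x + (t / (t + 1)) * (e * norm x) + t * C"
        by (simp add: algebra_simps)
      also have "(t / (t + 1)) * (e * norm x) \<le> 1 * (e * norm x)"
        using assms \<open>0 < e\<close> by (intro mult_right_mono) auto
      finally show ?thesis by simp
    qed
    then show ?thesis by (intro exI[of _ "t * C"]) auto
  qed
  show "0 \<le> v \<bullet> ((t *\<^sub>R H x) *v v)" for x v
    using 1 assms by (simp add: scaleR_matrix_vector_assoc[symmetric])
  show "\<forall>a\<in>(*\<^sub>R) t ` K. \<forall>b\<in>(*\<^sub>R) t ` K. (a - b) \<bullet> v = 0" if "v \<bullet> ((t *\<^sub>R H x) *v v) = 0" for x v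
  proof -
    have "t = 0 \<or> v \<bullet> (H x *v v) = 0"
      using that by (simp add: scaleR_matrix_vector_assoc[symmetric])
    then have "t = 0 \<or> (\<forall>a\<in>K. \<forall>b\<in>K. (a - b) \<bullet> v = 0)" using 1(7) by blast
    then show ?thesis by (auto simp: scaleR_diff_right[symmetric])
  qed
qed

lemma potential_zero: "potential ({0} :: (real ^ 'n) set) (\<lambda>x. 0) (\<lambda>x. 0) (\<lambda>x. 0)"
  unfolding potential_def
  by (auto intro!: derivative_eq_intros exI[of _ 0])

lemma potential_sum:
  fixes K :: "'i \<Rightarrow> (real ^ 'n) set"
  assumes "finite I" "\<And>i. i \<in> I \<Longrightarrow> potential (K i) (f i) (G i) (H i)"
  shows "potential (\<Sum>i\<in>I. K i) (\<lambda>x. \<Sum>i\<in>I. f i x) (\<lambda>x. \<Sum>i\<in>I. G i x) (\<lambda>x. \<Sum>i\<in>I. H i x)"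
  using assms
  by (induction I rule: finite_induct)
     (simp_all add: potential_add potential_zero set_zero)

lemma compact_set_sum:
  fixes K :: "'i \<Rightarrow> 'a::real_normed_vector set"
  assumes "finite I" "\<And>i. i \<in> I \<Longrightarrow> compact (K i)"
  shows "compact (\<Sum>i\<in>I. K i)"
proof -
  have "compact (A + B)" if "compact A" "compact B" for A B :: "'a set"
    using compact_sums[OF that] by (simp add: set_plus_def)
       (smt (verit, best) Collect_cong)
  show ?thesis
    using assms(1,2)
  proof (induction I rule: finite_induct)
    case (insert i I)
    then show ?case using \<open>\<And>A B. compact A \<Longrightarrow> compact B \<Longrightarrow> compact (A + B)\<close> by simp
  qed (simp add: set_zero)
qed

section \<open>Potentials of segments, balls and convex bodies\<close>

text \<open>A remainder bound that is quadratic in \<open>h\<close> and uniform in \<open>w\<close>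
  survives integration and gives differentiability at once, without a limit under the integral
  sign.\<close>

lemma has_derivative_expectation:
  fixes F :: "'w \<Rightarrow> 'a::euclidean_space \<Rightarrow> 'b::{banach, second_countable_topology}"
  assumes "prob_space N"
    and intF: "\<And>x. integrable N (\<lambda>w. F w x)"
    and intD: "\<And>h. integrable N (\<lambda>w. D w h)"
    and lin: "\<And>w. linear (D w)"
    and bound: "\<And>h. norm h \<le> 1 \<Longrightarrow> AE w in N. norm (F w (x + h) - F w x - D w h) \<le> C * (norm h)\<^sup>2"
  shows "((\<lambda>x. \<integral>w. F w x \<partial>N) has_derivative (\<lambda>h. \<integral>w. D w h \<partial>N)) (at x)"
proof -
  interpret prob_space N by fact
  have "linear (\<lambda>h. \<integral>w. D w h \<partial>N)"
    using lin intD by (intro linearI) (simp_all add: linear_add linear_scale)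
  then have bl: "bounded_linear (\<lambda>h. \<integral>w. D w h \<partial>N)"
    by (simp add: linear_conv_bounded_linear)
  have quad: "norm ((\<integral>w. F w (x + h) \<partial>N) - (\<integral>w. F w x \<partial>N) - (\<integral>w. D w h \<partial>N)) \<le> C * (norm h)\<^sup>2"
    if "norm h \<le> 1" for h
  proof -
    have "norm (\<integral>w. F w (x + h) - F w x - D w h \<partial>N) \<le> (\<integral>w. norm (F w (x + h) - F w x - D w h) \<partial>N)"
      by (rule integral_norm_bound)
    also have "\<dots> \<le> (\<integral>w. C * (norm h)\<^sup>2 \<partial>N)"
      using bound[OF that] intF intD by (intro integral_mono_AE) auto
    finally have "norm (\<integral>w. F w (x + h) - F w x - D w h \<partial>N) \<le> (\<integral>w. C * (norm h)\<^sup>2 \<partial>N)" .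
    then show ?thesis using intF intD by (simp add: prob_space)
  qed
  show ?thesis
    unfolding has_derivative_at
  proof (intro conjI bl)
    show "(\<lambda>h. norm ((\<integral>w. F w (x + h) \<partial>N) - (\<integral>w. F w x \<partial>N) - (\<integral>w. D w h \<partial>N)) / norm h) \<midarrow>0\<rightarrow> 0"
    proof (rule tendsto_sandwich[where f = "\<lambda>_. 0" and h = "\<lambda>h. C * norm h"])
      show "\<forall>\<^sub>F h in at 0. norm ((\<integral>w. F w (x + h) \<partial>N) - (\<integral>w. F w x \<partial>N) - (\<integral>w. D w h \<partial>N)) / norm h \<le> C * norm h"
        unfolding eventually_at
      proof (intro exI[of _ 1] conjI ballI impI)
        fix h :: 'a assume h: "h \<noteq> 0 \<and> dist h 0 < 1"
        then show "norm ((\<integral>w. F w (x + h) \<partial>N) - (\<integral>w. F w x \<partial>N) - (\<integral>w. D w h \<partial>N)) / norm h \<le> C * norm h"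
          using quad[of h] by (simp add: divide_le_eq power2_eq_square mult.assoc)
      qed auto
      show "((\<lambda>h. C * norm h) \<longlongrightarrow> 0) (at (0::'a))"
        by (rule tendsto_eq_intros refl)+ simp
    qed auto
  qed
qed

text \<open>The mean value bound is applied to \<open>\<phi>'\<close> and then to
  \<open>\<phi>\<close> minus its linear part, with \<open>M\<close> bounding
  \<open>\<phi>''\<close> on the interval reached. One \<open>M\<close> must serve for all
  \<open>s\<close> and \<open>\<delta>\<close> in range, since these will be the random numbers
  \<open>u w \<bullet> x\<close> and \<open>u w \<bullet> h\<close>.\<close>

lemma second_order_remainder_bound:
  fixes \<phi> \<phi>' \<phi>'' :: "real \<Rightarrow> real"
  assumes d1: "\<And>s. (\<phi> has_real_derivative \<phi>' s) (at s)"
    and d2: "\<And>s. (\<phi>' has_real_derivative \<phi>'' s) (at s)"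
    and cont: "continuous_on UNIV \<phi>''"
  obtains M where "0 \<le> M"
    "\<And>s \<delta>. \<bar>s\<bar> \<le> a \<Longrightarrow> \<bar>\<delta>\<bar> \<le> b \<Longrightarrow> \<bar>\<phi> (s + \<delta>) - \<phi> s - \<phi>' s * \<delta>\<bar> \<le> M * \<delta>\<^sup>2"
proof -
  define I where "I = {- (a + b)..a + b}"
  have "compact (\<phi>'' ` I)"
    unfolding I_def by (intro compact_continuous_image continuous_on_subset[OF cont]) auto
  then obtain M where M: "M > 0" "\<And>z. z \<in> I \<Longrightarrow> \<bar>\<phi>'' z\<bar> \<le> M"
    using compact_imp_bounded bounded_pos by (metis image_eqI real_norm_def)
  have "\<bar>\<phi> (s + \<delta>) - \<phi> s - \<phi>' s * \<delta>\<bar> \<le> M * \<delta>\<^sup>2" if "\<bar>s\<bar> \<le> a" "\<bar>\<delta>\<bar> \<le> b" for s \<delta>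
  proof -
    let ?J = "closed_segment s (s + \<delta>)"
    have J: "z \<in> I" "\<bar>z - s\<bar> \<le> \<bar>\<delta>\<bar>" if "z \<in> ?J" for z
      using that \<open>\<bar>s\<bar> \<le> a\<close> \<open>\<bar>\<delta>\<bar> \<le> b\<close> by (auto simp: I_def closed_segment_eq_real_ivl split: if_splits)
    have b1: "norm (\<phi>' z - \<phi>' s) \<le> M * \<bar>\<delta>\<bar>" if "z \<in> ?J" for z
    proof -
      have "norm (\<phi>' z - \<phi>' s) \<le> M * norm (z - s)"
        by (rule field_differentiable_bound[where S = ?J and f' = \<phi>''])
           (use that J M d2 in \<open>auto intro: has_field_derivative_at_within\<close>)
      also have "\<dots> \<le> M * \<bar>\<delta>\<bar>" using J(2)[OF that] M by (intro mult_left_mono) auto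
      finally show ?thesis .
    qed
    have "norm ((\<phi> (s + \<delta>) - \<phi>' s * (s + \<delta>)) - (\<phi> s - \<phi>' s * s)) \<le> (M * \<bar>\<delta>\<bar>) * norm (s + \<delta> - s)"
      by (rule field_differentiable_bound[where S = ?J and f' = "\<lambda>z. \<phi>' z - \<phi>' s"])
         (use b1 in \<open>auto intro!: derivative_eq_intros has_field_derivative_at_within[OF d1]\<close>)
    then show ?thesis by (simp add: algebra_simps power2_eq_square abs_mult_self_eq)
  qed
  then show thesis using that[of M] M by auto
qed

context
  fixes N :: "'w measure" and u :: "'w \<Rightarrow> 'a::euclidean_space"
    and g :: "'w \<Rightarrow> 'b::{banach, second_countable_topology}" and R R' :: real
  assumes N: "prob_space N"
    and u [measurable]: "u \<in> borel_measurable N" and g [measurable]: "g \<in> borel_measurable N"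
    and R: "AE w in N. norm (u w) \<le> R" and R': "AE w in N. norm (g w) \<le> R'"
begin

text \<open>Functions of this shape cover both applications: \<open>exp\<close> over a countable set
  of points and \<open>soft_abs\<close> over the ball, with weights 1, the vector itself and its
  outer square. The constant is chosen before \<open>x\<close>, so that it dominates along a
  convergent sequence.\<close>

lemma AE_ridge_bound:
  assumes "continuous_on UNIV \<phi>"
  shows "\<exists>C. \<forall>x. norm x \<le> B \<longrightarrow> (AE w in N. norm (\<phi> (u w \<bullet> x) *\<^sub>R g w) \<le> C)"
proof -
  have "compact (\<phi> ` {- (R * B)..R * B})"
    by (intro compact_continuous_image continuous_on_subset[OF assms]) auto
  then obtain M where M: "M > 0" "\<And>z. \<bar>z\<bar> \<le> R * B \<Longrightarrow> \<bar>\<phi> z :: real\<bar> \<le> M"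
    using compact_imp_bounded bounded_pos
    by (metis (no_types, opaque_lifting) abs_le_iff atLeastAtMost_iff image_eqI minus_le_iff real_norm_def)
  have "AE w in N. norm (\<phi> (u w \<bullet> x) *\<^sub>R g w) \<le> M * R'" if "norm x \<le> B" for x
    using R R'
  proof eventually_elim
    case (elim w)
    have "\<bar>u w \<bullet> x\<bar> \<le> norm (u w) * norm x" by (rule Cauchy_Schwarz_ineq2)
    also have "\<dots> \<le> R * B"
      using elim that by (intro mult_mono) (auto intro: order_trans[OF norm_ge_zero])
    finally show ?case
      using M elim by (auto intro!: mult_mono)
  qed
  then show ?thesis by blast
qed

lemma integrable_ridge:
  assumes "continuous_on UNIV \<phi>"
  shows "integrable N (\<lambda>w. \<phi> (u w \<bullet> x) *\<^sub>R g w)"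
proof -
  interpret prob_space N by (rule N)
  have [measurable]: "\<phi> \<in> borel_measurable borel"
    using assms by (rule borel_measurable_continuous_onI)
  obtain C where "AE w in N. norm (\<phi> (u w \<bullet> x) *\<^sub>R g w) \<le> C"
    using AE_ridge_bound[OF assms, of "norm x"] by blast
  then show ?thesis
    by (intro integrable_const_bound[where B = C]) auto
qed

lemma continuous_expectation_ridge:
  assumes "continuous_on UNIV \<phi>"
  shows "continuous_on UNIV (\<lambda>x. \<integral>w. \<phi> (u w \<bullet> x) *\<^sub>R g w \<partial>N)"
proof -
  interpret prob_space N by (rule N)
  have [measurable]: "\<phi> \<in> borel_measurable borel"
    using assms by (rule borel_measurable_continuous_onI)
  show ?thesis
  proof (rule continuous_at_imp_continuous_on, rule ballI, unfold continuous_at_sequentially, intro allI impI)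
    fix x :: 'a and X assume X: "X \<longlonglongrightarrow> x"
    then obtain B where "\<And>n. norm (X n) \<le> B"
      using convergent_imp_Bseq[of X] by (auto simp: convergent_def Bseq_def)
    then obtain C where "\<And>n. AE w in N. norm (\<phi> (u w \<bullet> X n) *\<^sub>R g w) \<le> C"
      using AE_ridge_bound[OF assms, of B] by blast
    moreover have "(\<lambda>n. \<phi> (u w \<bullet> X n) *\<^sub>R g w) \<longlonglongrightarrow> \<phi> (u w \<bullet> x) *\<^sub>R g w" for w
      using assms X
      by (intro tendsto_intros continuous_on_tendsto_compose[OF assms]) auto
    ultimately have "(\<lambda>n. \<integral>w. \<phi> (u w \<bullet> X n) *\<^sub>R g w \<partial>N) \<longlonglongrightarrow> (\<integral>w. \<phi> (u w \<bullet> x) *\<^sub>R g w \<partial>N)"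
      by (intro integral_dominated_convergence[where w = "\<lambda>_. C"]) auto
    then show "((\<lambda>x. \<integral>w. \<phi> (u w \<bullet> x) *\<^sub>R g w \<partial>N) \<circ> X) \<longlonglongrightarrow> (\<integral>w. \<phi> (u w \<bullet> x) *\<^sub>R g w \<partial>N)"
      by (simp add: o_def)
  qed
qed

lemma has_derivative_expectation_ridge:
  fixes \<phi> \<phi>' \<phi>'' :: "real \<Rightarrow> real"
  assumes d1: "\<And>s. (\<phi> has_real_derivative \<phi>' s) (at s)"
    and d2: "\<And>s. (\<phi>' has_real_derivative \<phi>'' s) (at s)"
    and cont: "continuous_on UNIV \<phi>''"
  shows "((\<lambda>x. \<integral>w. \<phi> (u w \<bullet> x) *\<^sub>R g w \<partial>N) has_derivative
          (\<lambda>h. \<integral>w. (\<phi>' (u w \<bullet> x) * (u w \<bullet> h)) *\<^sub>R g w \<partial>N)) (at x)"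
proof -
  interpret prob_space N by (rule N)
  have c1: "continuous_on UNIV \<phi>" and c2: "continuous_on UNIV \<phi>'"
    using d1 d2 by (meson DERIV_isCont continuous_at_imp_continuous_on)+
  obtain M where M: "0 \<le> M"
    "\<And>s \<delta>. \<bar>s\<bar> \<le> R * norm x \<Longrightarrow> \<bar>\<delta>\<bar> \<le> R \<Longrightarrow> \<bar>\<phi> (s + \<delta>) - \<phi> s - \<phi>' s * \<delta>\<bar> \<le> M * \<delta>\<^sup>2"
    by (rule second_order_remainder_bound[OF d1 d2 cont, of "R * norm x" R]) auto
  show ?thesis
  proof (rule has_derivative_expectation[OF N, where C = "M * R\<^sup>2 * R'"])
    show "integrable N (\<lambda>w. \<phi> (u w \<bullet> x) *\<^sub>R g w)" for x
      by (rule integrable_ridge[OF c1])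
    show "integrable N (\<lambda>w. (\<phi>' (u w \<bullet> x) * (u w \<bullet> h)) *\<^sub>R g w)" for h
    proof -
      have [measurable]: "\<phi>' \<in> borel_measurable borel"
        using c2 by (rule borel_measurable_continuous_onI)
      obtain C where "AE w in N. norm (\<phi>' (u w \<bullet> x) *\<^sub>R g w) \<le> C"
        using AE_ridge_bound[OF c2, of "norm x"] by blast
      with R have "AE w in N. norm ((\<phi>' (u w \<bullet> x) * (u w \<bullet> h)) *\<^sub>R g w) \<le> (R * norm h) * C"
      proof eventually_elim
        case (elim w)
        have "\<bar>u w \<bullet> h\<bar> \<le> R * norm h"
          by (rule order_trans[OF Cauchy_Schwarz_ineq2]) (use elim in \<open>auto intro!: mult_right_mono\<close>)
        then have "\<bar>u w \<bullet> h\<bar> * norm (\<phi>' (u w \<bullet> x) *\<^sub>R g w) \<le> (R * norm h) * C"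
          using elim by (intro mult_mono) (auto intro: order_trans[OF norm_ge_zero])
        then show ?case by (simp add: abs_mult mult_ac)
      qed
      then show ?thesis
        by (intro integrable_const_bound[where B = "(R * norm h) * C"]) auto
    qed
    show "linear (\<lambda>h. (\<phi>' (u w \<bullet> x) * (u w \<bullet> h)) *\<^sub>R g w)" for w
      by (intro linearI) (auto simp: inner_add_right algebra_simps)
    show "AE w in N. norm (\<phi> (u w \<bullet> (x + h)) *\<^sub>R g w - \<phi> (u w \<bullet> x) *\<^sub>R g w - (\<phi>' (u w \<bullet> x) * (u w \<bullet> h)) *\<^sub>R g w)
        \<le> M * R\<^sup>2 * R' * (norm h)\<^sup>2" if "norm h \<le> 1" for h
      using R R'
    proof eventually_elim
      case (elim w)
      have R0: "0 \<le> R" using elim(1) norm_ge_zero order_trans by blast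
      have a: "\<bar>u w \<bullet> h\<bar> \<le> R * norm h" for h
        by (rule order_trans[OF Cauchy_Schwarz_ineq2]) (use elim in \<open>auto intro!: mult_right_mono\<close>)
      have "\<bar>u w \<bullet> h\<bar> \<le> R"
        by (rule order_trans[OF a]) (use that R0 in \<open>auto intro: mult_left_le\<close>)
      then have "\<bar>\<phi> (u w \<bullet> x + u w \<bullet> h) - \<phi> (u w \<bullet> x) - \<phi>' (u w \<bullet> x) * (u w \<bullet> h)\<bar> \<le> M * (u w \<bullet> h)\<^sup>2"
        by (intro M a)
      also have "\<dots> \<le> M * (R * norm h)\<^sup>2"
        using a[of h] M(1) by (intro mult_left_mono) (auto simp: abs_le_square_iff[symmetric] R0)
      finally have "\<bar>\<phi> (u w \<bullet> x + u w \<bullet> h) - \<phi> (u w \<bullet> x) - \<phi>' (u w \<bullet> x) * (u w \<bullet> h)\<bar> * norm (g w)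
          \<le> M * (R * norm h)\<^sup>2 * R'"
        using elim M(1) by (intro mult_mono) auto
      then show ?case
        by (simp add: inner_add_right scaleR_diff_left[symmetric] power_mult_distrib mult_ac)
    qed
  qed
qed

end

definition outer :: "real ^ 'n \<Rightarrow> real ^ 'n ^ 'n" where
  "outer u = (\<chi> i j. u $ i * u $ j)"

lemma outer_mult_vec: "outer u *v h = (u \<bullet> h) *\<^sub>R u"
  by (simp add: outer_def vec_eq_iff matrix_vector_mult_def inner_vec_def sum_distrib_left mult_ac)

lemma continuous_on_outer [continuous_intros]: "continuous_on S f \<Longrightarrow> continuous_on S (\<lambda>x. outer (f x))"
  unfolding outer_def by (intro continuous_intros)

lemma borel_measurable_outer [measurable]: "outer \<in> borel_measurable borel"
  by (intro borel_measurable_continuous_onI continuous_intros)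

text \<open>A smooth majorant of the absolute value with positive second derivative, whose first
  derivative stays in (-1, 1): composed with \<open>u \<bullet> x\<close> it is a potential of the
  segment from \<open>- u\<close> to \<open>u\<close>.\<close>

definition soft_abs :: "real \<Rightarrow> real" where "soft_abs s = sqrt (1 + s\<^sup>2)"
definition soft_abs' :: "real \<Rightarrow> real" where "soft_abs' s = s / sqrt (1 + s\<^sup>2)"
definition soft_abs'' :: "real \<Rightarrow> real" where "soft_abs'' s = 1 / (sqrt (1 + s\<^sup>2) * (1 + s\<^sup>2))"

text \<open>The gradient of a mean of segment potentials is itself differentiated under the
  expectation, which takes a second order bound for \<open>soft_abs'\<close> and thus a third
  derivative.\<close>

definition soft_abs''' :: "real \<Rightarrow> real" where
  "soft_abs''' s = - (s / sqrt (1 + s\<^sup>2) * (1 + s\<^sup>2) + sqrt (1 + s\<^sup>2) * (2 * s)) / (sqrt (1 + s\<^sup>2) * (1 + s\<^sup>2))\<^sup>2"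

lemma soft_abs_derivs:
  "(soft_abs has_real_derivative soft_abs' s) (at s)"
  "(soft_abs' has_real_derivative soft_abs'' s) (at s)"
  "continuous_on UNIV soft_abs''"
  "continuous_on UNIV soft_abs'"
  "continuous_on UNIV soft_abs"
  "(soft_abs'' has_real_derivative soft_abs''' s) (at s)"
  "continuous_on UNIV soft_abs'''"
proof -
  have p: "0 < 1 + s\<^sup>2" for s :: real by (simp add: add_pos_nonneg)
  then have nz [simp]: "1 + s\<^sup>2 \<noteq> 0" for s :: real by (metis less_irrefl)
  show 1: "(soft_abs has_real_derivative soft_abs' s) (at s)" for s
    unfolding soft_abs_def soft_abs'_def using p[of s]
    by (auto intro!: derivative_eq_intros simp: field_simps)
  have sq: "sqrt (1 + s\<^sup>2) * sqrt (1 + s\<^sup>2) = 1 + s\<^sup>2" for s :: real using p[of s] by simp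
  show 2: "(soft_abs' has_real_derivative soft_abs'' s) (at s)" for s
  proof -
    let ?r = "sqrt (1 + s\<^sup>2)"
    have r: "?r > 0" using p by simp
    have "(soft_abs' has_real_derivative ((1 * ?r - s * (s / ?r)) / (?r * ?r))) (at s)"
      unfolding soft_abs'_def using p[of s] r
      by (auto intro!: derivative_eq_intros simp: field_simps)
    also have "(1 * ?r - s * (s / ?r)) / (?r * ?r) = soft_abs'' s"
    proof -
      have "1 * ?r - s * (s / ?r) = (?r * ?r - s\<^sup>2) / ?r" using r by (simp add: field_simps power2_eq_square)
      then show ?thesis unfolding soft_abs''_def sq using r by simp
    qed
    finally show ?thesis .
  qed
  show "(soft_abs'' has_real_derivative soft_abs''' s) (at s)" for s
  proof -
    have "((\<lambda>s. sqrt (1 + s\<^sup>2) * (1 + s\<^sup>2)) has_real_derivative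
        (s / sqrt (1 + s\<^sup>2) * (1 + s\<^sup>2) + sqrt (1 + s\<^sup>2) * (2 * s))) (at s)"
    proof -
      have "((\<lambda>s. sqrt (1 + s\<^sup>2)) has_real_derivative s / sqrt (1 + s\<^sup>2)) (at s)"
        using 1 unfolding soft_abs_def[abs_def] soft_abs'_def .
      moreover have "((\<lambda>s. 1 + s\<^sup>2) has_real_derivative 2 * s) (at s)"
        by (auto intro!: derivative_eq_intros)
      ultimately show ?thesis
        by (rule DERIV_cong[OF DERIV_mult]) (simp add: mult.commute)
    qed
    from DERIV_divide[OF DERIV_const[of 1] this] show ?thesis
      unfolding soft_abs''_def soft_abs'''_def
      using p[of s] by (simp add: power2_eq_square real_sqrt_eq_zero_cancel_iff)
  qed
  show "continuous_on UNIV soft_abs'''"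
    unfolding soft_abs'''_def by (auto intro!: continuous_intros simp: real_sqrt_eq_zero_cancel_iff)
  show "continuous_on UNIV soft_abs''" "continuous_on UNIV soft_abs'" "continuous_on UNIV soft_abs"
    unfolding soft_abs_def soft_abs'_def soft_abs''_def by (auto intro!: continuous_intros simp: real_sqrt_eq_zero_cancel_iff)
qed

lemma soft_abs_bounds: "\<bar>s\<bar> \<le> soft_abs s" "\<bar>soft_abs' s\<bar> \<le> 1" "0 < soft_abs'' s" "soft_abs'' s \<le> 1"
proof -
  have p: "0 < 1 + s\<^sup>2" by (simp add: add_pos_nonneg)
  show 1: "\<bar>s\<bar> \<le> soft_abs s"
    unfolding soft_abs_def by (rule real_le_rsqrt) simp
  then show "\<bar>soft_abs' s\<bar> \<le> 1"
    using p by (simp add: soft_abs'_def soft_abs_def abs_divide divide_le_eq)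
  show "0 < soft_abs'' s" using p by (simp add: soft_abs''_def)
  have "1 * 1 \<le> sqrt (1 + s\<^sup>2) * (1 + s\<^sup>2)"
    by (intro mult_mono) auto
  then show "soft_abs'' s \<le> 1"
    using p by (simp add: soft_abs''_def divide_le_eq)
qed

lemma mem_symmetric_segment: "a \<in> closed_segment (- u) u \<longleftrightarrow> (\<exists>s::real. \<bar>s\<bar> \<le> 1 \<and> a = s *\<^sub>R (u :: 'a::real_vector))"
proof
  assume "a \<in> closed_segment (- u) u"
  then obtain t where t: "0 \<le> t" "t \<le> 1" "a = (1 - t) *\<^sub>R (- u) + t *\<^sub>R u"
    by (auto simp: closed_segment_def)
  have "a = (2 * t - 1) *\<^sub>R u" unfolding t(3) by (simp add: algebra_simps scaleR_add_left[symmetric])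
  then show "\<exists>s. \<bar>s\<bar> \<le> 1 \<and> a = s *\<^sub>R u"
    using t by (intro exI[of _ "2 * t - 1"]) auto
next
  assume "\<exists>s. \<bar>s\<bar> \<le> 1 \<and> a = s *\<^sub>R u"
  then obtain s where s: "\<bar>s\<bar> \<le> 1" "a = s *\<^sub>R u" by blast
  have "(1 - t) *\<^sub>R (- u) + t *\<^sub>R u = (2 * t - 1) *\<^sub>R u" for t :: real
    by (simp add: algebra_simps scaleR_add_left[symmetric])
  from this[of "(1 + s) / 2"] have "(1 - (1 + s) / 2) *\<^sub>R (- u) + ((1 + s) / 2) *\<^sub>R u = s *\<^sub>R u"
    by (simp add: add_divide_distrib)
  then show "a \<in> closed_segment (- u) u"
    unfolding closed_segment_def using s by (intro CollectI exI[of _ "(1 + s) / 2"]) auto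
qed

lemma potential_segment:
  fixes u :: "real ^ 'n"
  shows "potential (closed_segment (- u) u) (\<lambda>x. soft_abs (u \<bullet> x))
    (\<lambda>x. soft_abs' (u \<bullet> x) *\<^sub>R u) (\<lambda>x. soft_abs'' (u \<bullet> x) *\<^sub>R outer u)"
  unfolding potential_def
proof (intro conjI allI impI)
  show "((\<lambda>x. soft_abs (u \<bullet> x)) has_derivative (\<lambda>h. (soft_abs' (u \<bullet> x) *\<^sub>R u) \<bullet> h)) (at x)" for x
    by (rule has_derivative_eq_rhs[OF has_derivative_compose[OF _ soft_abs_derivs(1)[unfolded has_field_derivative_def]]])
       (auto intro!: derivative_eq_intros)
  show "((\<lambda>x. soft_abs' (u \<bullet> x) *\<^sub>R u) has_derivative (*v) (soft_abs'' (u \<bullet> x) *\<^sub>R outer u)) (at x)" for x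
  proof -
    have "((\<lambda>x. soft_abs' (u \<bullet> x)) has_derivative (\<lambda>h. soft_abs'' (u \<bullet> x) * (u \<bullet> h))) (at x)"
      by (rule has_derivative_eq_rhs[OF has_derivative_compose[OF _ soft_abs_derivs(2)[unfolded has_field_derivative_def]]])
         (auto intro!: derivative_eq_intros)
    from has_derivative_scaleR_left[OF this, of u] show ?thesis
      by (rule has_derivative_eq_rhs)
         (simp add: fun_eq_iff scaleR_matrix_vector_assoc[symmetric] outer_mult_vec)
  qed
  show "continuous_on UNIV (\<lambda>x. soft_abs'' (u \<bullet> x) *\<^sub>R outer u)"
    by (intro continuous_intros continuous_on_compose2[OF soft_abs_derivs(3)]) auto
  show "range (\<lambda>x. soft_abs' (u \<bullet> x) *\<^sub>R u) \<subseteq> closed_segment (- u) u"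
    unfolding mem_symmetric_segment image_subset_iff using soft_abs_bounds(2) by blast
  show "\<exists>C. \<forall>x. \<forall>a\<in>closed_segment (- u) u. a \<bullet> x \<le> soft_abs (u \<bullet> x) + e * norm x + C" if "0 < e" for e
  proof (intro exI[of _ 0] allI ballI)
    fix x a assume "a \<in> closed_segment (- u) u"
    then obtain s where s: "\<bar>s\<bar> \<le> 1" "a = s *\<^sub>R u" by (auto simp: mem_symmetric_segment)
    have "a \<bullet> x \<le> \<bar>s\<bar> * \<bar>u \<bullet> x\<bar>" by (simp add: s abs_mult[symmetric])
    also have "\<dots> \<le> 1 * \<bar>u \<bullet> x\<bar>" using s by (intro mult_right_mono) auto
    finally show "a \<bullet> x \<le> soft_abs (u \<bullet> x) + e * norm x + 0"
      using soft_abs_bounds(1)[of "u \<bullet> x"] that by (simp add: add_increasing2)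
  qed
  show "0 \<le> v \<bullet> ((soft_abs'' (u \<bullet> x) *\<^sub>R outer u) *v v)" for x v
    using soft_abs_bounds(3)[of "u \<bullet> x"]
    by (simp add: scaleR_matrix_vector_assoc[symmetric] outer_mult_vec inner_commute mult.assoc)
  show "\<forall>a\<in>closed_segment (- u) u. \<forall>b\<in>closed_segment (- u) u. (a - b) \<bullet> v = 0"
    if "v \<bullet> ((soft_abs'' (u \<bullet> x) *\<^sub>R outer u) *v v) = 0" for x v
  proof -
    have "u \<bullet> v = 0"
      using that soft_abs_bounds(3)[of "u \<bullet> x"]
      by (simp add: scaleR_matrix_vector_assoc[symmetric] outer_mult_vec inner_commute)
    then show ?thesis by (auto simp: mem_symmetric_segment inner_diff_left)
  qed
qed

lemma expectation_matrix_vector_mult: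
  fixes A :: "'w \<Rightarrow> real ^ 'n ^ 'm"
  assumes "integrable N A"
  shows "(\<integral>w. A w \<partial>N) *v h = (\<integral>w. A w *v h \<partial>N)"
proof -
  have "linear (\<lambda>A. A *v h :: real ^ 'm)"
    by (intro linearI) (simp_all add: matrix_vector_mult_add_rdistrib scaleR_matrix_vector_assoc)
  then have "bounded_linear (\<lambda>A. A *v h :: real ^ 'm)"
    by (simp add: linear_conv_bounded_linear)
  from integral_bounded_linear[OF this assms] show ?thesis by simp
qed

text \<open>The potential is the logarithm of the moment generating function of a probability
  distribution that charges a countable dense subset of \<open>K\<close>.\<close>

lemma exists_potential:
  fixes K :: "(real ^ 'n) set"
  assumes K: "compact K" "convex K" "K \<noteq> {}"
  obtains f G H where "potential K f G H"
proof -
  obtain T where T: "countable T" "T \<subseteq> K" "K \<subseteq> closure T"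
    using separable[of K] by blast
  have "T \<noteq> {}" using T K by auto
  define a where "a = from_nat_into T"
  have aK: "a k \<in> K" for k
    using from_nat_into[OF \<open>T \<noteq> {}\<close>] T by (auto simp: a_def)
  have dense: "K \<subseteq> closure (range a)"
    using T \<open>T \<noteq> {}\<close> by (simp add: a_def range_from_nat_into)
  obtain R where R: "\<And>x. x \<in> K \<Longrightarrow> norm x \<le> R"
    using compact_imp_bounded[OF K(1)] by (auto simp: bounded_iff)
  \<comment> \<open>Any distribution that charges every index would do.\<close>
  define p where "p = (geometric_pmf (1/2) :: nat pmf)"
  have pos: "0 < pmf p k" for k by (simp add: p_def)
  let ?N = "measure_pmf p"
  have N: "prob_space ?N" by (rule measure_pmf.prob_space_axioms)
  have ma [measurable]: "a \<in> borel_measurable ?N" by simp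
  have aR: "AE k in ?N. norm (a k) \<le> R" using R aK by simp
  have one: "(\<lambda>_. 1 :: real) \<in> borel_measurable ?N" "AE k in ?N. norm (1::real) \<le> 1" by auto
  have "bounded (outer ` K)"
    by (intro compact_imp_bounded compact_continuous_image continuous_intros K)
  then obtain R' where R': "\<And>x. x \<in> K \<Longrightarrow> norm (outer x) \<le> R'"
    by (auto simp: bounded_iff)
  have oR: "AE k in ?N. norm (outer (a k)) \<le> R'" using R' aK by simp
  have mo: "(\<lambda>k. outer (a k)) \<in> borel_measurable ?N" by simp
  define Z where "Z x = (\<integral>k. exp (a k \<bullet> x) *\<^sub>R (1::real) \<partial>?N)" for x
  define Y where "Y x = (\<integral>k. exp (a k \<bullet> x) *\<^sub>R a k \<partial>?N)" for x
  define W where "W x = (\<integral>k. exp (a k \<bullet> x) *\<^sub>R outer (a k) \<partial>?N)" for x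
  have cexp: "continuous_on UNIV (exp :: real \<Rightarrow> real)" by (intro continuous_intros)
  note ridge1 = integrable_ridge[OF N ma one(1) aR one(2) cexp]
  note ridge2 = integrable_ridge[OF N ma ma aR aR cexp]
  note ridge3 = integrable_ridge[OF N ma mo aR oR cexp]
  have Zlow: "pmf p k * exp (a k \<bullet> x) \<le> Z x" for k x
  proof -
    have "pmf p k * exp (a k \<bullet> x) = (\<integral>j. exp (a k \<bullet> x) * indicator {k} j \<partial>?N)"
      by (simp add: measure_pmf_single)
    also have "\<dots> \<le> Z x"
      unfolding Z_def
    proof (rule integral_mono)
      show "integrable ?N (\<lambda>j. exp (a k \<bullet> x) * indicator {k} j)"
        by (intro measure_pmf.integrable_const_bound[where B = "exp (a k \<bullet> x)"]) (auto simp: indicator_def)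
    qed (use ridge1[of x] in \<open>auto simp: indicator_def\<close>)
    finally show ?thesis .
  qed
  have Zpos: "0 < Z x" for x
    using Zlow[of 0 x] pos[of 0] by (smt (verit) exp_gt_zero mult_pos_pos)
  have dZ: "(Z has_derivative (\<lambda>h. Y x \<bullet> h)) (at x)" for x
  proof -
    have "(Z has_derivative (\<lambda>h. \<integral>k. (exp (a k \<bullet> x) * (a k \<bullet> h)) *\<^sub>R 1 \<partial>?N)) (at x)"
      unfolding Z_def[abs_def]
      by (rule has_derivative_expectation_ridge[OF N ma one(1) aR one(2) DERIV_exp DERIV_exp cexp])
    moreover have "(\<integral>k. (exp (a k \<bullet> x) * (a k \<bullet> h)) *\<^sub>R 1 \<partial>?N) = Y x \<bullet> h" for h
      unfolding Y_def using integral_inner_left[OF ridge2[of x], of h] by simp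
    ultimately show ?thesis by simp
  qed
  have dY: "(Y has_derivative (*v) (W x)) (at x)" for x
  proof -
    have "(Y has_derivative (\<lambda>h. \<integral>k. (exp (a k \<bullet> x) * (a k \<bullet> h)) *\<^sub>R a k \<partial>?N)) (at x)"
      unfolding Y_def[abs_def]
      by (rule has_derivative_expectation_ridge[OF N ma ma aR aR DERIV_exp DERIV_exp cexp])
    moreover have "(\<integral>k. (exp (a k \<bullet> x) * (a k \<bullet> h)) *\<^sub>R a k \<partial>?N) = W x *v h" for h
      unfolding W_def expectation_matrix_vector_mult[OF ridge3]
      by (simp add: scaleR_matrix_vector_assoc[symmetric] outer_mult_vec)
    ultimately show ?thesis by simp
  qed
  have cW: "continuous_on UNIV W"
    unfolding W_def[abs_def] by (rule continuous_expectation_ridge[OF N ma mo aR oR cexp])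
  have cZ: "continuous_on UNIV Z" and cY: "continuous_on UNIV Y"
    using dZ dY by (meson continuous_at_imp_continuous_on has_derivative_continuous)+
  \<comment> \<open>Reweight the index \<open>k\<close> by
    \<open>exp (a k \<bullet> x) / Z x\<close>. Under this tilted distribution \<open>G x\<close> is
    the mean of the points \<open>a k\<close> and \<open>H x\<close> their covariance matrix, so the
    quadratic form of \<open>H x\<close> is a variance.\<close>
  define f where "f x = ln (Z x)" for x
  define G where "G x = (1 / Z x) *\<^sub>R Y x" for x
  define H where "H x = (1 / Z x) *\<^sub>R W x - (1 / (Z x)\<^sup>2) *\<^sub>R outer (Y x)" for x
  have sq_int: "integrable ?N (\<lambda>k. exp (a k \<bullet> x) * ((a k - G x) \<bullet> v)\<^sup>2)" for x v
  proof -
    have "bounded ((\<lambda>y. exp (y \<bullet> x) * ((y - G x) \<bullet> v)\<^sup>2) ` K)"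
      by (intro compact_imp_bounded compact_continuous_image continuous_intros K)
    then obtain B where "\<And>y. y \<in> K \<Longrightarrow> norm (exp (y \<bullet> x) * ((y - G x) \<bullet> v)\<^sup>2) \<le> B"
      by (auto simp: bounded_iff)
    then show ?thesis
      using aK by (intro measure_pmf.integrable_const_bound[where B = B]) auto
  qed
  have var: "v \<bullet> (H x *v v) = (\<integral>k. exp (a k \<bullet> x) * ((a k - G x) \<bullet> v)\<^sup>2 \<partial>?N) / Z x" for x v
  proof -
    have i1: "integrable ?N (\<lambda>k. exp (a k \<bullet> x) * (a k \<bullet> v)\<^sup>2)"
    proof -
      have "bounded ((\<lambda>y. exp (y \<bullet> x) * (y \<bullet> v)\<^sup>2) ` K)"
        by (intro compact_imp_bounded compact_continuous_image continuous_intros K)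
      then obtain B where "\<And>y. y \<in> K \<Longrightarrow> norm (exp (y \<bullet> x) * (y \<bullet> v)\<^sup>2) \<le> B"
        by (auto simp: bounded_iff)
      then show ?thesis
        using aK by (intro measure_pmf.integrable_const_bound[where B = B]) auto
    qed
    have i2: "integrable ?N (\<lambda>k. exp (a k \<bullet> x) * (a k \<bullet> v))"
      using integrable_inner_left[OF ridge2[of x], of v] by simp
    have i3: "integrable ?N (\<lambda>k. exp (a k \<bullet> x))"
      using ridge1[of x] by simp
    have W: "v \<bullet> (W x *v v) = (\<integral>k. exp (a k \<bullet> x) * (a k \<bullet> v)\<^sup>2 \<partial>?N)"
    proof -
      have j: "integrable ?N (\<lambda>k. (exp (a k \<bullet> x) * (a k \<bullet> v)) *\<^sub>R a k)"
      proof -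
        have "bounded ((\<lambda>y. (exp (y \<bullet> x) * (y \<bullet> v)) *\<^sub>R y) ` K)"
          by (intro compact_imp_bounded compact_continuous_image continuous_intros K)
        then obtain B where "\<And>y. y \<in> K \<Longrightarrow> norm ((exp (y \<bullet> x) * (y \<bullet> v)) *\<^sub>R y) \<le> B"
          by (auto simp: bounded_iff)
        then show ?thesis
          using aK by (intro measure_pmf.integrable_const_bound[where B = B]) auto
      qed
      have "W x *v v = (\<integral>k. (exp (a k \<bullet> x) * (a k \<bullet> v)) *\<^sub>R a k \<partial>?N)"
        unfolding W_def expectation_matrix_vector_mult[OF ridge3]
        by (simp add: scaleR_matrix_vector_assoc[symmetric] outer_mult_vec)
      then show ?thesis
        using integral_inner_right[OF j, of v] by (simp add: power2_eq_square mult.assoc inner_commute)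
    qed
    have Y: "Y x \<bullet> v = (\<integral>k. exp (a k \<bullet> x) * (a k \<bullet> v) \<partial>?N)"
      unfolding Y_def using integral_inner_left[OF ridge2[of x], of v] by simp
    have Gv: "G x \<bullet> v = (Y x \<bullet> v) / Z x" by (simp add: G_def)
    have "(\<integral>k. exp (a k \<bullet> x) * ((a k - G x) \<bullet> v)\<^sup>2 \<partial>?N)
      = (\<integral>k. exp (a k \<bullet> x) * (a k \<bullet> v)\<^sup>2 - 2 * (G x \<bullet> v) * (exp (a k \<bullet> x) * (a k \<bullet> v)) + (G x \<bullet> v)\<^sup>2 * exp (a k \<bullet> x) \<partial>?N)"
      by (rule Bochner_Integration.integral_cong) (auto simp: inner_diff_left power2_eq_square algebra_simps)
    also have "\<dots> = v \<bullet> (W x *v v) - 2 * (G x \<bullet> v) * (Y x \<bullet> v) + (G x \<bullet> v)\<^sup>2 * Z x"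
      using i1 i2 i3 by (simp add: W Y Z_def)
    also have "\<dots> = v \<bullet> (W x *v v) - (Y x \<bullet> v)\<^sup>2 / Z x"
      using Zpos[of x] by (simp add: Gv field_simps power2_eq_square)
    finally have "(\<integral>k. exp (a k \<bullet> x) * ((a k - G x) \<bullet> v)\<^sup>2 \<partial>?N) / Z x = (v \<bullet> (W x *v v)) / Z x - (Y x \<bullet> v)\<^sup>2 / (Z x)\<^sup>2"
      by (simp add: diff_divide_distrib power2_eq_square)
    then show ?thesis
      by (simp add: H_def matrix_vector_mult_diff_rdistrib scaleR_matrix_vector_assoc[symmetric] outer_mult_vec
          inner_diff_right power2_eq_square inner_commute)
  qed
  have "potential K f G H"
    unfolding potential_def
  proof (intro conjI allI impI)
    show "(f has_derivative (\<lambda>h. G x \<bullet> h)) (at x)" for x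
      unfolding f_def[abs_def] using dZ[of x] Zpos[of x]
      by (auto intro!: derivative_eq_intros simp: G_def field_simps)
    show "(G has_derivative (*v) (H x)) (at x)" for x
      unfolding G_def[abs_def] using Zpos[of x]
      by (auto intro!: derivative_eq_intros dZ dY
          simp: fun_eq_iff H_def matrix_vector_mult_diff_rdistrib scaleR_matrix_vector_assoc[symmetric] outer_mult_vec
            power2_eq_square divide_inverse)
    show "continuous_on UNIV H"
      unfolding H_def[abs_def] using Zpos
      by (intro continuous_intros cW cY cZ) (auto simp: less_imp_neq[symmetric])
    \<comment> \<open>A mean of points of \<open>K\<close> cannot be separated from \<open>K\<close>
      by a hyperplane.\<close>
    show "range G \<subseteq> K"
    proof (rule image_subsetI, rule ccontr)
      fix x assume "G x \<notin> K"
      then obtain v b where vb: "v \<bullet> G x < b" "\<And>y. y \<in> K \<Longrightarrow> b < v \<bullet> y"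
        using separating_hyperplane_closed_point[OF K(2) compact_imp_closed[OF K(1)]] by blast
      have "b * Z x \<le> (\<integral>k. (exp (a k \<bullet> x) *\<^sub>R a k) \<bullet> v \<partial>?N)"
      proof -
        have "b * Z x = (\<integral>k. b * (exp (a k \<bullet> x) *\<^sub>R (1::real)) \<partial>?N)" by (simp add: Z_def)
        also have "\<dots> \<le> (\<integral>k. (exp (a k \<bullet> x) *\<^sub>R a k) \<bullet> v \<partial>?N)"
          using ridge1[of x] integrable_inner_left[OF ridge2[of x], of v] vb(2)[OF aK]
          by (intro integral_mono) (auto simp: inner_commute less_imp_le)
        finally show ?thesis .
      qed
      also have "\<dots> = Y x \<bullet> v" unfolding Y_def using integral_inner_left[OF ridge2[of x], of v] by simp
      finally have "b \<le> v \<bullet> G x"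
        using Zpos[of x] by (simp add: G_def field_simps inner_commute)
      with vb(1) show False by simp
    qed
    show "\<exists>C. \<forall>x. \<forall>y\<in>K. y \<bullet> x \<le> f x + e * norm x + C" if "0 < e" for e
    proof -
      \<comment> \<open>Every point of \<open>K\<close> is within \<open>e\<close> of one of
        finitely many \<open>a k\<close>, and each of these satisfies
        \<open>a k \<bullet> x \<le> f x - ln (pmf p k)\<close> because its own term bounds
        \<open>Z x\<close> from below. The constant collects the logarithms.\<close>
      have "K \<subseteq> (\<Union>k. ball (a k) e)"
      proof
        fix y assume "y \<in> K"
        then have "y \<in> closure (range a)" using dense by blast
        with that obtain k where "dist (a k) y < e" by (auto simp: closure_approachable)
        then show "y \<in> (\<Union>k. ball (a k) e)" by auto
      qed
      then obtain I where I: "finite I" "K \<subseteq> (\<Union>k\<in>I. ball (a k) e)"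
        using compactE_image[OF K(1), of UNIV "\<lambda>k. ball (a k) e"] by auto
      show ?thesis
      proof (intro exI[of _ "\<Sum>k\<in>I. \<bar>ln (pmf p k)\<bar>"] allI ballI)
        fix x y assume "y \<in> K"
        then obtain k where k: "k \<in> I" "dist (a k) y < e" using I by auto
        have "(y - a k) \<bullet> x \<le> norm (y - a k) * norm x" by (rule norm_cauchy_schwarz)
        also have "\<dots> \<le> e * norm x"
          using k by (intro mult_right_mono) (auto simp: dist_norm norm_minus_commute)
        finally have "(y - a k) \<bullet> x \<le> e * norm x" .
        moreover have "a k \<bullet> x = ln (pmf p k * exp (a k \<bullet> x)) - ln (pmf p k)"
          using pos[of k] by (simp add: ln_mult)
        moreover have "ln (pmf p k * exp (a k \<bullet> x)) \<le> f x"
          unfolding f_def using Zlow[of k x] Zpos[of x] pos[of k] by (intro ln_mono) auto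
        moreover have "- ln (pmf p k) \<le> (\<Sum>k\<in>I. \<bar>ln (pmf p k)\<bar>)"
          using member_le_sum[of k I "\<lambda>k. \<bar>ln (pmf p k)\<bar>"] I k by auto
        ultimately show "y \<bullet> x \<le> f x + e * norm x + (\<Sum>k\<in>I. \<bar>ln (pmf p k)\<bar>)"
          by (simp add: inner_diff_left)
      qed
    qed
    show "0 \<le> v \<bullet> (H x *v v)" for x v
      unfolding var using Zpos[of x] by (intro divide_nonneg_pos integral_nonneg_AE) auto
    show "\<forall>y\<in>K. \<forall>z\<in>K. (y - z) \<bullet> v = 0" if "v \<bullet> (H x *v v) = 0" for x v
    proof -
      \<comment> \<open>A vanishing variance forces all \<open>a k\<close> to have the same inner
        product with \<open>v\<close>, as every index has positive weight; density extends this to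
        \<open>K\<close>.\<close>
      have "(\<integral>k. exp (a k \<bullet> x) * ((a k - G x) \<bullet> v)\<^sup>2 \<partial>?N) = 0"
        using that Zpos[of x] unfolding var by auto
      then have "AE k in ?N. exp (a k \<bullet> x) * ((a k - G x) \<bullet> v)\<^sup>2 = 0"
        by (subst (asm) integral_nonneg_eq_0_iff_AE[OF sq_int]) auto
      then have "(a k - G x) \<bullet> v = 0" for k
        using pos[of k] by (auto simp: AE_measure_pmf_iff set_pmf_iff)
      then have "range a \<subseteq> {y. v \<bullet> y = v \<bullet> G x}"
        by (auto simp: inner_diff_left inner_diff_right inner_commute)
      then have "closure (range a) \<subseteq> {y. v \<bullet> y = v \<bullet> G x}"
        by (intro closure_minimal closed_hyperplane)
      then have K': "v \<bullet> y = v \<bullet> G x" if "y \<in> K" for y using dense that by blast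
      show ?thesis
      proof (intro ballI)
        fix y z assume "y \<in> K" "z \<in> K"
        then have "v \<bullet> (y - z) = 0" by (simp add: inner_diff_right K')
        then show "(y - z) \<bullet> v = 0" by (simp add: inner_commute)
      qed
    qed
  qed
  then show thesis by (rule that)
qed

text \<open>The solid ball rather than the sphere: this law is rotation invariant and has a density,
  so proper subspaces are null sets.\<close>

definition ball_measure :: "'a::euclidean_space measure" where
  "ball_measure = uniform_measure lborel (cball 0 1)"

lemma emeasure_unit_cball:
  "emeasure lborel (cball (0::'a::euclidean_space) 1) \<noteq> 0" "emeasure lborel (cball (0::'a) 1) \<noteq> \<infinity>"
  by (auto simp: emeasure_cball unit_ball_vol_pos ennreal_eq_0_iff not_le)

lemma prob_space_ball_measure: "prob_space ball_measure"
  unfolding ball_measure_def using emeasure_unit_cball by (intro prob_space_uniform_measure) auto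

lemma sets_ball_measure [simp, measurable_cong]: "sets ball_measure = sets borel"
  by (simp add: ball_measure_def)

lemma space_ball_measure [simp]: "space ball_measure = UNIV"
  by (simp add: ball_measure_def)

lemma AE_ball_measure_norm: "AE u in ball_measure. norm u \<le> 1"
  unfolding ball_measure_def by (rule AE_uniform_measureI) auto

lemma AE_ball_measureI:
  assumes "AE u in lborel. P u"
  shows "AE u in ball_measure. P u"
  unfolding ball_measure_def by (rule AE_uniform_measureI) (use assms in auto)

lemma distr_ball_measure_orthogonal:
  fixes f :: "'a::euclidean_space \<Rightarrow> 'a"
  assumes "orthogonal_transformation f"
  shows "distr ball_measure borel f = ball_measure"
proof -
  have lin: "linear f" and norm: "\<And>x. norm (f x) = norm x" and surj: "surj f"
    using assms by (auto simp: orthogonal_transformation_norm orthogonal_transformation_linear orthogonal_transformation_surj)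
  have [measurable]: "f \<in> borel_measurable borel" using lin by (rule borel_measurable_linear)
  have lb: "distr lborel borel f = lborel" by (rule lborel_distr_isometry[OF lin norm surj])
  show ?thesis
  proof (rule measure_eqI)
    fix C assume "C \<in> sets (distr ball_measure borel f)"
    then have C: "C \<in> sets borel" by simp
    have pre: "f -` C \<in> sets borel" using measurable_sets[OF \<open>f \<in> borel_measurable borel\<close> C] by simp
    have "f -` (cball 0 1 \<inter> C) = cball 0 1 \<inter> f -` C" by (auto simp: norm)
    then have "emeasure lborel (cball 0 1 \<inter> f -` C) = emeasure (distr lborel borel f) (cball 0 1 \<inter> C)"
      using C by (simp add: emeasure_distr)
    then show "emeasure (distr ball_measure borel f) C = emeasure ball_measure C"
      using C pre by (simp add: emeasure_distr ball_measure_def lb)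
  qed simp
qed

text \<open>The support function, at a unit vector, of the mean of the segments from
  \<open>- u\<close> to \<open>u\<close>; by rotation invariance the axis is immaterial and that
  mean is the ball of this radius. The value cancels in the comparison with the unit ball; what
  counts is that it is positive.\<close>

definition ball_mean :: "'n::finite itself \<Rightarrow> real" where
  "ball_mean _ = (\<integral>u. \<bar>u \<bullet> axis (SOME i. True) 1\<bar> \<partial>(ball_measure :: (real ^ 'n) measure))"

lemma integral_abs_inner_ball_measure:
  fixes w :: "real ^ 'n"
  shows "(\<integral>u. \<bar>u \<bullet> w\<bar> \<partial>ball_measure) = ball_mean TYPE('n) * norm w"
proof (cases "w = 0")
  case False
  define e :: "real ^ 'n" where "e = axis (SOME i. True) 1"
  have "norm e = norm (w /\<^sub>R norm w)" using False by (simp add: e_def)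
  then obtain f where f: "orthogonal_transformation f" "f e = w /\<^sub>R norm w"
    using orthogonal_transformation_exists by blast
  have [measurable]: "f \<in> borel_measurable borel"
    using f by (intro borel_measurable_linear orthogonal_transformation_linear)
  have "(\<integral>u. \<bar>u \<bullet> (w /\<^sub>R norm w)\<bar> \<partial>ball_measure) = (\<integral>u. \<bar>u \<bullet> f e\<bar> \<partial>distr ball_measure borel f)"
    by (simp add: distr_ball_measure_orthogonal[OF f(1)] f(2))
  also have "\<dots> = (\<integral>u. \<bar>f u \<bullet> f e\<bar> \<partial>ball_measure)"
    by (rule integral_distr) auto
  also have "\<dots> = ball_mean TYPE('n)"
    using f(1) by (simp add: orthogonal_transformation_def ball_mean_def e_def)
  finally have "(\<integral>u. \<bar>u \<bullet> (w /\<^sub>R norm w)\<bar> \<partial>ball_measure) = ball_mean TYPE('n)" .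
  moreover have "(\<integral>u. \<bar>u \<bullet> w\<bar> \<partial>ball_measure) = norm w * (\<integral>u. \<bar>u \<bullet> (w /\<^sub>R norm w)\<bar> \<partial>ball_measure)"
    using False by (simp add: abs_mult divide_inverse mult.commute)
  ultimately show ?thesis by simp
qed simp

lemma AE_ball_measure_inner_nonzero:
  fixes v :: "'a::euclidean_space"
  assumes "v \<noteq> 0"
  shows "AE u in ball_measure. u \<bullet> v \<noteq> 0"
proof (rule AE_ball_measureI)
  have "negligible {u. v \<bullet> u = 0}" using assms by (intro negligible_hyperplane) auto
  moreover have "{u. v \<bullet> u = 0} \<in> sets lborel" by simp
  ultimately have "{u. v \<bullet> u = 0} \<in> null_sets lborel"
    by (simp add: negligible_iff_null_sets null_sets_completion_iff)
  then show "AE u in lborel. u \<bullet> v \<noteq> 0"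
    by (rule AE_I') (auto simp: inner_commute)
qed

lemma integrable_abs_inner_ball_measure:
  fixes w :: "real ^ 'n"
  shows "integrable (ball_measure :: (real ^ 'n) measure) (\<lambda>u. \<bar>u \<bullet> w\<bar>)"
proof -
  interpret prob_space "ball_measure :: (real ^ 'n) measure" by (rule prob_space_ball_measure)
  have "AE u in ball_measure. norm \<bar>u \<bullet> w\<bar> \<le> norm w"
    using AE_ball_measure_norm
  proof eventually_elim
    case (elim u)
    have "\<bar>u \<bullet> w\<bar> \<le> norm u * norm w" by (rule Cauchy_Schwarz_ineq2)
    also have "\<dots> \<le> norm w" using elim by (simp add: mult_left_le_one_le)
    finally show ?case by simp
  qed
  then show ?thesis by (intro integrable_const_bound[where B = "norm w"]) auto
qed

lemma ball_mean_pos: "0 < ball_mean TYPE('n::finite)"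
proof -
  interpret prob_space "ball_measure :: (real ^ 'n) measure" by (rule prob_space_ball_measure)
  define e :: "real ^ 'n" where "e = axis (SOME i. True) 1"
  have e: "norm e = 1" "e \<noteq> 0" by (auto simp: e_def axis_eq_0_iff)
  have "0 \<le> (\<integral>u. \<bar>u \<bullet> e\<bar> \<partial>ball_measure)" by (intro integral_nonneg_AE) auto
  moreover have "(\<integral>u. \<bar>u \<bullet> e\<bar> \<partial>ball_measure) \<noteq> 0"
  proof
    assume "(\<integral>u. \<bar>u \<bullet> e\<bar> \<partial>ball_measure) = 0"
    then have "AE u in ball_measure. \<bar>u \<bullet> e\<bar> = 0"
      by (subst (asm) integral_nonneg_eq_0_iff_AE[OF integrable_abs_inner_ball_measure]) auto
    with AE_ball_measure_inner_nonzero[OF e(2)] have "AE u in (ball_measure :: (real ^ 'n) measure). False"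
      by eventually_elim auto
    then show False by simp
  qed
  ultimately show ?thesis by (simp add: integral_abs_inner_ball_measure e)
qed

lemma AE_ball_measure_norm_outer:
  obtains R where "AE u in ball_measure. norm (outer (u :: real ^ 'n)) \<le> R"
proof -
  have "bounded (outer ` cball (0::real^'n) 1)"
    by (intro compact_imp_bounded compact_continuous_image continuous_intros) auto
  then obtain R where "\<forall>y\<in>outer ` cball (0::real^'n) 1. norm y \<le> R"
    unfolding bounded_iff by blast
  then have R: "\<And>x :: real ^ 'n. norm x \<le> 1 \<Longrightarrow> norm (outer x) \<le> R"
    by simp
  have "AE u in ball_measure. norm (outer (u :: real ^ 'n)) \<le> R"
    using AE_ball_measure_norm by eventually_elim (rule R)
  then show thesis by (rule that)
qed

lemma integrable_soft_abs_outer: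
  fixes x :: "real ^ 'n"
  shows "integrable ball_measure (\<lambda>u. soft_abs'' (u \<bullet> x) *\<^sub>R outer u)"
proof -
  obtain R' where oR: "AE u in ball_measure. norm (outer (u :: real ^ 'n)) \<le> R'"
    by (rule AE_ball_measure_norm_outer)
  show ?thesis
  proof (rule integrable_ridge[OF prob_space_ball_measure _ _ AE_ball_measure_norm oR soft_abs_derivs(3)])
    show "(\<lambda>u. u) \<in> borel_measurable ball_measure" "outer \<in> borel_measurable ball_measure" by measurable
  qed
qed

definition zonoid_hessian :: "real ^ 'n \<Rightarrow> real ^ 'n ^ 'n" where
  "zonoid_hessian x = (\<integral>u. soft_abs'' (u \<bullet> x) *\<^sub>R outer u \<partial>ball_measure)"

text \<open>The ball is a mean of segments, and its potential is the mean of the potentials of the segments.\<close>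

lemma potential_ball:
  "potential (cball (0 :: real ^ 'n) (ball_mean TYPE('n)))
     (\<lambda>x. \<integral>u. soft_abs (u \<bullet> x) \<partial>ball_measure)
     (\<lambda>x. \<integral>u. soft_abs' (u \<bullet> x) *\<^sub>R u \<partial>ball_measure) zonoid_hessian"
proof -
  let ?N = "ball_measure :: (real ^ 'n) measure"
  have N: "prob_space ?N" by (rule prob_space_ball_measure)
  interpret prob_space ?N by (rule N)
  have mu: "(\<lambda>u. u) \<in> borel_measurable ?N" by simp
  have mo: "outer \<in> borel_measurable ?N" by measurable
  have one: "(\<lambda>_. 1 :: real) \<in> borel_measurable ?N" "AE k in ?N. norm (1::real) \<le> 1" by auto
  obtain R' where oR: "AE u in ?N. norm (outer u) \<le> R'"
    by (rule AE_ball_measure_norm_outer)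
  note aR = AE_ball_measure_norm
  note c = soft_abs_derivs(3,4,5)
  note int1 = integrable_ridge[OF N mu one(1) aR one(2) c(3)]
  note int2 = integrable_ridge[OF N mu mu aR aR c(2)]
  note int3 = integrable_soft_abs_outer
  have hv: "zonoid_hessian x *v h = (\<integral>u. (soft_abs'' (u \<bullet> x) * (u \<bullet> h)) *\<^sub>R u \<partial>?N)" for x h :: "real ^ 'n"
    unfolding zonoid_hessian_def expectation_matrix_vector_mult[OF int3]
    by (simp add: scaleR_matrix_vector_assoc[symmetric] outer_mult_vec)
  have bnd: "AE u in ?N. norm (soft_abs'' (u \<bullet> x) * (u \<bullet> v)\<^sup>2) \<le> (norm v)\<^sup>2" for x v
    using aR
  proof eventually_elim
    case (elim u)
    have "\<bar>u \<bullet> v\<bar> \<le> norm u * norm v" by (rule Cauchy_Schwarz_ineq2)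
    also have "\<dots> \<le> norm v" using elim by (simp add: mult_left_le_one_le)
    finally have "\<bar>u \<bullet> v\<bar>\<^sup>2 \<le> (norm v)\<^sup>2" by (intro power_mono) auto
    then have "soft_abs'' (u \<bullet> x) * (u \<bullet> v)\<^sup>2 \<le> 1 * (norm v)\<^sup>2"
      using soft_abs_bounds(4)[of "u \<bullet> x"] soft_abs_bounds(3)[of "u \<bullet> x"] by (intro mult_mono) auto
    then show ?case using soft_abs_bounds(3)[of "u \<bullet> x"] by (simp add: abs_mult)
  qed
  have [measurable]: "soft_abs'' \<in> borel_measurable borel" "soft_abs' \<in> borel_measurable borel"
    using c by (auto intro: borel_measurable_continuous_onI)
  have intsq: "integrable ?N (\<lambda>u. soft_abs'' (u \<bullet> x) * (u \<bullet> v)\<^sup>2)" for x v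
    using bnd by (intro integrable_const_bound) auto
  have quad: "v \<bullet> (zonoid_hessian x *v v) = (\<integral>u. soft_abs'' (u \<bullet> x) * (u \<bullet> v)\<^sup>2 \<partial>?N)" for x v :: "real ^ 'n"
  proof -
    have "AE u in ?N. norm ((soft_abs'' (u \<bullet> x) * (u \<bullet> v)) *\<^sub>R u) \<le> norm v"
      using aR
    proof eventually_elim
      case (elim u)
      have "\<bar>u \<bullet> v\<bar> \<le> norm u * norm v" by (rule Cauchy_Schwarz_ineq2)
      also have "\<dots> \<le> norm v" using elim by (simp add: mult_left_le_one_le)
      finally have "soft_abs'' (u \<bullet> x) * \<bar>u \<bullet> v\<bar> \<le> 1 * norm v"
        using soft_abs_bounds(4)[of "u \<bullet> x"] soft_abs_bounds(3)[of "u \<bullet> x"] by (intro mult_mono) auto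
      then have "(soft_abs'' (u \<bullet> x) * \<bar>u \<bullet> v\<bar>) * norm u \<le> norm v * 1"
        using elim soft_abs_bounds(3)[of "u \<bullet> x"] by (intro mult_mono) auto
      then show ?case using soft_abs_bounds(3)[of "u \<bullet> x"] by (simp add: abs_mult)
    qed
    then have "integrable ?N (\<lambda>u. (soft_abs'' (u \<bullet> x) * (u \<bullet> v)) *\<^sub>R u)"
      by (intro integrable_const_bound) auto
    from integral_inner_right[OF this, of v] show ?thesis
      by (simp add: hv power2_eq_square mult.assoc inner_commute)
  qed
  show ?thesis
    unfolding potential_def
  proof (intro conjI allI impI)
    show "((\<lambda>x. \<integral>u. soft_abs (u \<bullet> x) \<partial>?N) has_derivative (\<lambda>h. (\<integral>u. soft_abs' (u \<bullet> x) *\<^sub>R u \<partial>?N) \<bullet> h)) (at x)" for x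
      using has_derivative_expectation_ridge[OF N mu one(1) aR one(2) soft_abs_derivs(1-3), of x]
        integral_inner_left[OF int2[of x]] by simp
    show "((\<lambda>x. \<integral>u. soft_abs' (u \<bullet> x) *\<^sub>R u \<partial>?N) has_derivative (*v) (zonoid_hessian x)) (at x)" for x
    proof -
      have "(*v) (zonoid_hessian x) = (\<lambda>h. \<integral>u. (soft_abs'' (u \<bullet> x) * (u \<bullet> h)) *\<^sub>R u \<partial>?N)"
        by (rule ext) (rule hv)
      then show ?thesis
        using has_derivative_expectation_ridge[OF N mu mu aR aR soft_abs_derivs(2,6,7), of x] by simp
    qed
    show "continuous_on UNIV (zonoid_hessian :: real ^ 'n \<Rightarrow> real ^ 'n ^ 'n)"
      unfolding zonoid_hessian_def[abs_def] by (rule continuous_expectation_ridge[OF N mu mo aR oR c(1)])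
    show "range (\<lambda>x. \<integral>u. soft_abs' (u \<bullet> x) *\<^sub>R u \<partial>?N) \<subseteq> cball 0 (ball_mean TYPE('n))"
    proof (rule image_subsetI)
      fix x :: "real ^ 'n"
      let ?G = "\<integral>u. soft_abs' (u \<bullet> x) *\<^sub>R u \<partial>?N"
      \<comment> \<open>Testing the gradient against itself reduces the norm bound to the mean of
        \<open>\<bar>u \<bullet> ?G\<bar>\<close>, which is \<open>ball_mean\<close> times
        \<open>norm ?G\<close>.\<close>
      have "?G \<bullet> ?G = (\<integral>u. (soft_abs' (u \<bullet> x) *\<^sub>R u) \<bullet> ?G \<partial>?N)"
        using integral_inner_left[OF int2[of x], of ?G] by simp
      also have "\<dots> \<le> (\<integral>u. \<bar>u \<bullet> ?G\<bar> \<partial>?N)"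
      proof (rule integral_mono)
        show "integrable ?N (\<lambda>u. (soft_abs' (u \<bullet> x) *\<^sub>R u) \<bullet> ?G)"
          using int2[of x] by (rule integrable_inner_left)
        show "(soft_abs' (u \<bullet> x) *\<^sub>R u) \<bullet> ?G \<le> \<bar>u \<bullet> ?G\<bar>" for u
          using soft_abs_bounds(2)[of "u \<bullet> x"] mult_left_le_one_le[of "\<bar>u \<bullet> ?G\<bar>" "\<bar>soft_abs' (u \<bullet> x)\<bar>"]
          by (simp add: abs_mult[symmetric])
      qed (rule integrable_abs_inner_ball_measure)
      also have "\<dots> = ball_mean TYPE('n) * norm ?G" by (rule integral_abs_inner_ball_measure)
      finally have "norm ?G * norm ?G \<le> ball_mean TYPE('n) * norm ?G"
        by (simp add: dot_square_norm power2_eq_square)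
      then have "norm ?G \<le> ball_mean TYPE('n)"
        using ball_mean_pos[where 'n='n] by (cases "norm ?G = 0") (auto simp: mult_le_cancel_right less_imp_le)
      then show "?G \<in> cball 0 (ball_mean TYPE('n))" by simp
    qed
    show "\<exists>C. \<forall>x. \<forall>a\<in>cball 0 (ball_mean TYPE('n)). a \<bullet> x \<le> (\<integral>u. soft_abs (u \<bullet> x) \<partial>?N) + e * norm x + C"
      if "0 < e" for e
    proof (intro exI[of _ 0] allI ballI)
      fix a x :: "real ^ 'n" assume a: "a \<in> cball 0 (ball_mean TYPE('n))"
      have "a \<bullet> x \<le> norm a * norm x" by (rule norm_cauchy_schwarz)
      also have "\<dots> \<le> ball_mean TYPE('n) * norm x" using a by (intro mult_right_mono) auto
      also have "\<dots> = (\<integral>u. \<bar>u \<bullet> x\<bar> \<partial>?N)" by (rule integral_abs_inner_ball_measure[symmetric])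
      also have "\<dots> \<le> (\<integral>u. soft_abs (u \<bullet> x) \<partial>?N)"
        using int1[of x] soft_abs_bounds(1) by (intro integral_mono integrable_abs_inner_ball_measure) auto
      finally show "a \<bullet> x \<le> (\<integral>u. soft_abs (u \<bullet> x) \<partial>?N) + e * norm x + 0" using that by (simp add: add_increasing2)
    qed
    show "0 \<le> v \<bullet> (zonoid_hessian x *v v)" for x v :: "real ^ 'n"
      unfolding quad using soft_abs_bounds(3) by (intro integral_nonneg_AE) (auto simp: less_imp_le)
    show "\<forall>a\<in>cball 0 (ball_mean TYPE('n)). \<forall>b\<in>cball 0 (ball_mean TYPE('n)). (a - b) \<bullet> v = 0"
      if "v \<bullet> (zonoid_hessian x *v v) = 0" for x v :: "real ^ 'n"
    proof -
      \<comment> \<open>The ball is not flat, so the Hessian has to be definite: for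
        \<open>v \<noteq> 0\<close> the number \<open>u \<bullet> v\<close> is almost surely
        nonzero, and its weight \<open>soft_abs''\<close> is positive.\<close>
      have "v = 0"
      proof (rule ccontr)
        assume "v \<noteq> 0"
        have "AE u in ?N. soft_abs'' (u \<bullet> x) * (u \<bullet> v)\<^sup>2 = 0"
          using that soft_abs_bounds(3) unfolding quad
          by (subst (asm) integral_nonneg_eq_0_iff_AE[OF intsq]) (auto simp: less_imp_le)
        with AE_ball_measure_inner_nonzero[OF \<open>v \<noteq> 0\<close>] have "AE u in ?N. False"
        proof eventually_elim
          case (elim u)
          then show False using soft_abs_bounds(3)[of "u \<bullet> x"] by simp
        qed
        then show False by simp
      qed
      then show ?thesis by simp
    qed
  qed
qed

section \<open>Determinants of random sums of rank one matrices\<close>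

text \<open>Adding a small positive multiple of the identity makes the form definite, and the
  determinant is continuous.\<close>

lemma det_nonneg_of_positive_semidefinite:
  fixes A :: "real ^ 'n ^ 'n"
  assumes psd: "\<And>v. 0 \<le> v \<bullet> (A *v v)"
  shows "0 \<le> det A"
proof (rule tendsto_lowerbound)
  have "continuous_on UNIV (\<lambda>s. det (\<chi> i j. A $ i $ j + s * mat 1 $ i $ j))"
    unfolding det_def by (auto intro!: continuous_intros)
  then have "((\<lambda>s. det (\<chi> i j. A $ i $ j + s * mat 1 $ i $ j)) \<longlongrightarrow> det (\<chi> i j. A $ i $ j + 0 * mat 1 $ i $ j)) (at 0)"
    unfolding continuous_on_def by blast
  then have "((\<lambda>s. det (\<chi> i j. A $ i $ j + s * mat 1 $ i $ j)) \<longlongrightarrow> det (\<chi> i j. A $ i $ j + 0 * mat 1 $ i $ j)) (at_right 0)"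
    by (rule tendsto_within_subset) simp
  then show "((\<lambda>s. det (\<chi> i j. A $ i $ j + s * mat 1 $ i $ j)) \<longlongrightarrow> det A) (at_right 0)"
    by simp
  have "0 < det (\<chi> i j. A $ i $ j + s * mat 1 $ i $ j)" if "s > 0" for s
  proof (rule det_pos_of_positive_definite)
    fix v :: "real ^ 'n" assume "v \<noteq> 0"
    have "(\<chi> i j. A $ i $ j + s * mat 1 $ i $ j) = A + s *\<^sub>R mat 1"
      by (simp add: vec_eq_iff)
    then have "v \<bullet> ((\<chi> i j. A $ i $ j + s * mat 1 $ i $ j) *v v) = v \<bullet> (A *v v) + s * (v \<bullet> v)"
      by (simp add: matrix_vector_mult_add_rdistrib scaleR_matrix_vector_assoc[symmetric] inner_add_right)
    then show "0 < v \<bullet> ((\<chi> i j. A $ i $ j + s * mat 1 $ i $ j) *v v)"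
      using psd[of v] that \<open>v \<noteq> 0\<close> by (auto intro!: add_nonneg_pos)
  qed
  then show "\<forall>\<^sub>F s in at_right 0. 0 \<le> det (\<chi> i j. A $ i $ j + s * mat 1 $ i $ j)"
    by (auto simp: eventually_at_right_less eventually_at_filter intro!: always_eventually less_imp_le)
qed auto

lemma borel_measurable_det [measurable]: "(det :: real ^ 'n ^ 'n \<Rightarrow> real) \<in> borel_measurable borel"
  by (intro borel_measurable_continuous_onI) (unfold det_def, intro continuous_intros)

text \<open>The differential of the determinant at \<open>A\<close> in direction \<open>B\<close>,
  that is the trace of adj(A) B, written by replacing rows so that linearity in \<open>B\<close>
  comes from multilinearity in the rows.\<close>

definition det_deriv :: "real ^ 'n ^ 'n \<Rightarrow> real ^ 'n ^ 'n \<Rightarrow> real" where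
  "det_deriv A B = (\<Sum>i\<in>UNIV. det (\<chi> k. if k = i then B $ k else A $ k))"

lemma linear_det_deriv:
  fixes A :: "real ^ 'n ^ 'n"
  shows "linear (det_deriv A)"
proof (rule linearI)
  fix B C :: "real ^ 'n ^ 'n" and c :: real
  show "det_deriv A (B + C) = det_deriv A B + det_deriv A C"
    using det_row_add[of _ "($) B" "($) C" "($) A"] by (simp add: det_deriv_def sum.distrib cong: if_cong)
  show "det_deriv A (c *\<^sub>R B) = c *\<^sub>R det_deriv A B"
    using det_row_mul[of _ c "($) B" "($) A"]
    by (simp add: det_deriv_def sum_distrib_left scalar_mult_eq_scaleR cong: if_cong)
qed

text \<open>In the expansion by rows every term that takes two rows from \<open>w\<close> vanishes,
  so at most one perturbed row contributes at a time.\<close>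

lemma det_rank_one_rows:
  fixes A :: "real ^ 'n ^ 'n" and w :: "real ^ 'n"
  assumes "finite T"
  shows "det (\<chi> k. if k \<in> T then A $ k + c k *\<^sub>R w else A $ k) =
    det A + (\<Sum>i\<in>T. c i * det (\<chi> k. if k = i then w else A $ k))"
  using assms
proof (induction T arbitrary: A)
  case empty
  then show ?case by (simp add: vec_nth_inverse)
next
  case (insert j T)
  let ?R = "\<lambda>k. if k \<in> T then A $ k + c k *\<^sub>R w else A $ k"
  let ?A' = "\<chi> k. if k = j then w else A $ k"
  have split: "(\<chi> k. if k \<in> insert j T then A $ k + c k *\<^sub>R w else A $ k) =
      (\<chi> k. if k = j then A $ k + c k *s w else ?R k)"
    using insert.hyps by (auto simp: vec_eq_iff)
  have 1: "(\<chi> k. if k = j then A $ k else ?R k) = (\<chi> k. ?R k)"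
    using insert.hyps by (auto simp: vec_eq_iff)
  have 2: "(\<chi> k. if k = j then w else ?R k) = (\<chi> k. if k \<in> T then ?A' $ k + c k *\<^sub>R w else ?A' $ k)"
    using insert.hyps by (auto simp: vec_eq_iff)
  have 3: "det (\<chi> k. if k = i then w else ?A' $ k) = 0" if "i \<in> T" for i
  proof (rule det_identical_rows)
    show "i \<noteq> j" using that insert.hyps by auto
    then show "row i (\<chi> k. if k = i then w else ?A' $ k) = row j (\<chi> k. if k = i then w else ?A' $ k)"
      by (simp add: row_def)
  qed
  have "det (\<chi> k. if k \<in> insert j T then A $ k + c k *\<^sub>R w else A $ k) =
      det (\<chi> k. if k = j then A $ k else ?R k) + det (\<chi> k. if k = j then c k *s w else ?R k)"
    unfolding split by (rule det_row_add)
  also have "det (\<chi> k. if k = j then c k *s w else ?R k) = det (\<chi> k. if k = j then c j *s w else ?R k)"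
    by (rule arg_cong[of _ _ det]) (auto simp: vec_eq_iff)
  also have "\<dots> = c j * det (\<chi> k. if k = j then w else ?R k)"
    by (rule det_row_mul)
  also have "det (\<chi> k. if k = j then w else ?R k) = det ?A'"
    unfolding 2 by (subst insert.IH) (simp add: 3)
  also have "det (\<chi> k. if k = j then A $ k else ?R k) = det A + (\<Sum>i\<in>T. c i * det (\<chi> k. if k = i then w else A $ k))"
    unfolding 1 by (rule insert.IH)
  finally show ?case using insert.hyps by simp
qed

text \<open>For a rank one matrix all terms of order two and higher vanish and the first order
  expansion is exact. Hence the mean of the determinant sees a random rank one matrix only through
  its mean.\<close>

lemma det_add_outer:
  fixes A :: "real ^ 'n ^ 'n"
  shows "det (A + c *\<^sub>R outer v) = det A + det_deriv A (c *\<^sub>R outer v)"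
proof -
  have "A + c *\<^sub>R outer v = (\<chi> k. if k \<in> UNIV then A $ k + (c * v $ k) *\<^sub>R v else A $ k)"
    by (simp add: vec_eq_iff outer_def mult_ac)
  then have "det (A + c *\<^sub>R outer v) = det A + (\<Sum>i\<in>UNIV. (c * v $ i) * det (\<chi> k. if k = i then v else A $ k))"
    by (simp only: det_rank_one_rows[OF finite])
  also have "(\<Sum>i\<in>UNIV. (c * v $ i) * det (\<chi> k. if k = i then v else A $ k)) = det_deriv A (c *\<^sub>R outer v)"
    unfolding det_deriv_def
  proof (rule sum.cong)
    fix i :: 'n
    have "(\<chi> k. if k = i then (c *\<^sub>R outer v) $ k else A $ k) = (\<chi> k. if k = i then (c * v $ i) *s v else A $ k)"
      by (auto simp: vec_eq_iff outer_def)
    then show "(c * v $ i) * det (\<chi> k. if k = i then v else A $ k) = det (\<chi> k. if k = i then (c *\<^sub>R outer v) $ k else A $ k)"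
      by (simp add: det_row_mul)
  qed simp
  finally show ?thesis .
qed

text \<open>Built inside the type of polynomials, so that the coefficients of
  \<open>det (A + s *\<^sub>R B)\<close> in \<open>s\<close> can be named and integrated.\<close>

definition det_poly :: "real ^ 'n ^ 'n \<Rightarrow> real ^ 'n ^ 'n \<Rightarrow> real poly" where
  "det_poly A B = (\<Sum>p | p permutes UNIV. smult (of_int (sign p)) (\<Prod>i\<in>UNIV. [:A $ i $ p i, B $ i $ p i:]))"

lemma poly_det_poly: "poly (det_poly A B) s = det (A + s *\<^sub>R B)"
  by (simp add: det_poly_def det_def poly_sum poly_prod)

lemma degree_det_poly: "degree (det_poly A (B :: real ^ 'n ^ 'n)) \<le> CARD('n)"
  unfolding det_poly_def
proof (intro degree_sum_le order_trans[OF degree_smult_le] order_trans[OF degree_prod_sum_le])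
  fix p :: "'n \<Rightarrow> 'n"
  have "(\<Sum>i\<in>UNIV. degree [:A $ i $ p i, B $ i $ p i:]) \<le> (\<Sum>i\<in>(UNIV::'n set). 1)"
    by (intro sum_mono) simp
  then show "(\<Sum>i\<in>UNIV. (degree \<circ> (\<lambda>i. [:A $ i $ p i, B $ i $ p i:])) i) \<le> CARD('n)" by simp
qed (auto simp: finite_permutations)

lemma poly_pderiv_det_poly:
  fixes A B :: "real ^ 'n ^ 'n"
  shows "poly (pderiv (det_poly A B)) s = det_deriv (A + s *\<^sub>R B) B"
proof -
  let ?a = "\<lambda>s p i. A $ i $ p i + s * B $ i $ p i"
  have d: "((\<lambda>s. \<Sum>p | p permutes UNIV. of_int (sign p) * (\<Prod>i\<in>UNIV. ?a s p i)) has_real_derivative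
     (\<Sum>p | p permutes UNIV. of_int (sign p) * (\<Sum>i\<in>UNIV. B $ i $ p i * (\<Prod>j\<in>UNIV - {i}. ?a s p j)))) (at s)"
    by (intro DERIV_sum DERIV_cmult has_field_derivative_prod) (auto intro!: derivative_eq_intros)
  have eq: "(\<lambda>s. \<Sum>p | p permutes UNIV. of_int (sign p) * (\<Prod>i\<in>UNIV. ?a s p i)) = poly (det_poly A B)"
    by (simp add: fun_eq_iff poly_det_poly det_def)
  have "poly (pderiv (det_poly A B)) s =
      (\<Sum>p | p permutes UNIV. of_int (sign p) * (\<Sum>i\<in>UNIV. B $ i $ p i * (\<Prod>j\<in>UNIV - {i}. ?a s p j)))"
    by (rule DERIV_unique[OF poly_DERIV d[unfolded eq]])
  also have "\<dots> = (\<Sum>i\<in>UNIV. \<Sum>p | p permutes UNIV. of_int (sign p) * (B $ i $ p i * (\<Prod>j\<in>UNIV - {i}. ?a s p j)))"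
    by (simp add: sum_distrib_left) (rule sum.swap)
  also have "\<dots> = det_deriv (A + s *\<^sub>R B) B"
    unfolding det_deriv_def det_def
  proof (intro sum.cong refl)
    fix i :: 'n and p :: "'n \<Rightarrow> 'n"
    have "(\<Prod>k\<in>UNIV. (\<chi> k. if k = i then B $ k else (A + s *\<^sub>R B) $ k) $ k $ p k) =
        B $ i $ p i * (\<Prod>k\<in>UNIV - {i}. (\<chi> k. if k = i then B $ k else (A + s *\<^sub>R B) $ k) $ k $ p k)"
      by (subst prod.remove[of _ i]) auto
    also have "(\<Prod>k\<in>UNIV - {i}. (\<chi> k. if k = i then B $ k else (A + s *\<^sub>R B) $ k) $ k $ p k) = (\<Prod>j\<in>UNIV - {i}. ?a s p j)"
      by (intro prod.cong) auto
    finally show "of_int (sign p) * (B $ i $ p i * (\<Prod>j\<in>UNIV - {i}. ?a s p j)) =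
        of_int (sign p) * (\<Prod>k\<in>UNIV. (\<chi> k. if k = i then B $ k else (A + s *\<^sub>R B) $ k) $ k $ p k)"
      by simp
  qed
  finally show ?thesis .
qed

section \<open>Lagrange interpolation at the nodes 0, ..., n\<close>

definition lagrange :: "nat \<Rightarrow> nat \<Rightarrow> real poly" where
  "lagrange n k = (\<Prod>j\<in>{..n} - {k}. smult (1 / (real k - real j)) [:- real j, 1:])"

lemma poly_lagrange: "k \<le> n \<Longrightarrow> i \<le> n \<Longrightarrow> poly (lagrange n k) (real i) = (if i = k then 1 else 0)"
proof -
  assume "k \<le> n" "i \<le> n"
  show ?thesis
  proof (cases "i = k")
    case True
    then have "poly (lagrange n k) (real i) = (\<Prod>j\<in>{..n} - {k}. 1)"
      unfolding lagrange_def poly_prod by (intro prod.cong) (auto simp: diff_divide_distrib[symmetric])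
    then show ?thesis using True by simp
  next
    case False
    with \<open>i \<le> n\<close> have "\<exists>j\<in>{..n} - {k}. poly (smult (1 / (real k - real j)) [:- real j, 1:]) (real i) = 0"
      by (intro bexI[of _ i]) auto
    then show ?thesis
      using False unfolding lagrange_def poly_prod by (simp only: prod_zero finite_Diff finite_atMost if_False)
  qed
qed

lemma degree_lagrange: "k \<le> n \<Longrightarrow> degree (lagrange n k) \<le> n"
proof -
  assume "k \<le> n"
  have "degree (lagrange n k) \<le> (\<Sum>j\<in>{..n} - {k}. (degree \<circ> (\<lambda>j. smult (1 / (real k - real j)) [:- real j, 1:])) j)"
    unfolding lagrange_def by (rule degree_prod_sum_le) simp
  also have "\<dots> \<le> (\<Sum>j\<in>{..n} - {k}. 1)"
    by (intro sum_mono) (auto intro: order_trans[OF degree_smult_le])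
  also have "\<dots> = n" using \<open>k \<le> n\<close> by simp
  finally show ?thesis .
qed

lemma lagrange_interpolation:
  assumes "degree P \<le> n"
  shows "P = (\<Sum>k\<le>n. smult (poly P (real k)) (lagrange n k))"
proof (rule poly_eqI_degree[of "real ` {..n}"])
  show "poly P x = poly (\<Sum>k\<le>n. smult (poly P (real k)) (lagrange n k)) x" if x: "x \<in> real ` {..n}" for x
  proof -
    obtain i where i: "i \<le> n" "x = real i" using x by auto
    have "poly (\<Sum>k\<le>n. smult (poly P (real k)) (lagrange n k)) x = (\<Sum>k\<le>n. if k = i then poly P (real k) else 0)"
      unfolding poly_sum by (intro sum.cong) (use i in \<open>auto simp: poly_lagrange\<close>)
    then show ?thesis using i by simp
  qed
  have c: "card (real ` {..n}) = Suc n" by (simp add: card_image)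
  show "degree P < card (real ` {..n})" using assms c by simp
  have "degree (\<Sum>k\<le>n. smult (poly P (real k)) (lagrange n k)) \<le> n"
    by (intro degree_sum_le order_trans[OF degree_smult_le] degree_lagrange) auto
  then show "degree (\<Sum>k\<le>n. smult (poly P (real k)) (lagrange n k)) < card (real ` {..n})" using c by simp
qed

text \<open>A coefficient becomes a fixed combination of finitely many values, so integrability and
  integrals pass from values to coefficients.\<close>

lemma coeff_lagrange:
  assumes "degree P \<le> n"
  shows "coeff P m = (\<Sum>k\<le>n. poly P (real k) * coeff (lagrange n k) m)"
  by (subst lagrange_interpolation[OF assms]) (simp add: coeff_sum)

text \<open>\<open>rising N P\<close> is \<open>((1 + D)\<^sup>N P)(0)\<close> for the derivation \<open>D\<close>.\<close>

definition rising :: "nat \<Rightarrow> real poly \<Rightarrow> real" where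
  "rising N P = (\<Sum>k\<le>N. real (N choose k) * fact k * coeff P k)"

text \<open>Pascal's rule: \<open>fact k * coeff P k\<close> is the k-th derivative of
  \<open>P\<close> at 0, and passing to \<open>P + pderiv P\<close> applies 1 + D once more.\<close>

lemma rising_Suc: "rising (Suc N) P = rising N (P + pderiv P)"
proof -
  have "rising N (P + pderiv P) = rising N P + (\<Sum>k\<le>N. real (N choose k) * fact (Suc k) * coeff P (Suc k))"
    by (simp add: rising_def coeff_pderiv algebra_simps sum.distrib)
  also have "(\<Sum>k\<le>N. real (N choose k) * fact (Suc k) * coeff P (Suc k)) =
      (\<Sum>k\<in>{1..Suc N}. real (N choose (k - 1)) * fact k * coeff P k)"
    by (rule sum.reindex_bij_witness[of _ "\<lambda>k. k - 1" Suc]) auto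
  also have "rising N P = coeff P 0 + (\<Sum>k\<in>{1..Suc N}. real (N choose k) * fact k * coeff P k)"
  proof -
    have "rising N P = (\<Sum>k\<le>Suc N. real (N choose k) * fact k * coeff P k)"
      by (simp add: rising_def)
    also have "{..Suc N} = insert 0 {1..Suc N}" by auto
    finally show ?thesis by simp
  qed
  also have "coeff P 0 + (\<Sum>k\<in>{1..Suc N}. real (N choose k) * fact k * coeff P k) +
      (\<Sum>k\<in>{1..Suc N}. real (N choose (k - 1)) * fact k * coeff P k) =
      coeff P 0 + (\<Sum>k\<in>{1..Suc N}. real (Suc N choose k) * fact k * coeff P k)"
    unfolding add.assoc sum.distrib[symmetric]
  proof (intro arg_cong2[of _ _ _ _ "(+)"] refl sum.cong)
    fix k assume "k \<in> {1..Suc N}"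
    then obtain m where "k = Suc m" by (cases k) auto
    then show "real (N choose k) * fact k * coeff P k + real (N choose (k - 1)) * fact k * coeff P k =
        real (Suc N choose k) * fact k * coeff P k"
      by (simp add: algebra_simps)
  qed
  also have "\<dots> = rising (Suc N) P"
  proof -
    have "{..Suc N} = insert 0 {1..Suc N}" by auto
    then show ?thesis by (simp add: rising_def del: sum.atMost_Suc)
  qed
  finally show ?thesis by simp
qed

text \<open>Put P(s) = det(H + s E) with E the mean of \<open>W\<close>. Averaging over one summand
  turns P into P + P', because the determinant is affine in that summand; this is the operator that
  \<open>rising\<close> iterates. Nonnegativity is carried along because \<open>ennreal\<close>
  truncates negative values.\<close>

lemma expectation_det_sum_rank_one:
  fixes W :: "'w \<Rightarrow> real ^ 'n ^ 'n"
  assumes "prob_space M" and intW: "integrable M W"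
    and rank: "\<And>w. \<exists>c v. 0 \<le> c \<and> W w = c *\<^sub>R outer v"
    and psd: "\<And>v. 0 \<le> v \<bullet> (H *v v)"
  shows "(\<integral>\<^sup>+\<omega>. ennreal (det (H + (\<Sum>j<N. W (\<omega> j)))) \<partial>(Pi\<^sub>M {..<N} (\<lambda>_. M))) =
      ennreal (rising N (det_poly H (\<integral>w. W w \<partial>M)))
    \<and> 0 \<le> rising N (det_poly H (\<integral>w. W w \<partial>M))"
  using psd
proof (induction N arbitrary: H)
  case 0
  have "rising 0 (det_poly H (\<integral>w. W w \<partial>M)) = poly (det_poly H (\<integral>w. W w \<partial>M)) 0"
    by (simp add: rising_def poly_0_coeff_0)
  also have "\<dots> = det H" by (simp add: poly_det_poly)
  finally have "rising 0 (det_poly H (\<integral>w. W w \<partial>M)) = det H" .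
  then show ?case
    using det_nonneg_of_positive_semidefinite[of H] 0 by (simp add: PiM_empty nn_integral_count_space_finite)
next
  case (Suc N)
  interpret prob_space M by fact
  interpret product_sigma_finite "\<lambda>_::nat. M" by standard
  let ?E = "\<integral>w. W w \<partial>M"
  have [measurable]: "W \<in> borel_measurable M" using intW by auto
  have psdW: "0 \<le> v \<bullet> ((H + W w) *v v)" for v w
  proof -
    obtain c u where "0 \<le> c" "W w = c *\<^sub>R outer u" using rank by blast
    then show ?thesis
      using Suc.prems[of v]
      by (simp add: matrix_vector_mult_add_rdistrib inner_add_right scaleR_matrix_vector_assoc[symmetric] outer_mult_vec
          inner_commute mult.assoc)
  qed
  have affine: "poly (det_poly (H + W w) ?E) s = det (H + s *\<^sub>R ?E) + det_deriv (H + s *\<^sub>R ?E) (W w)" for w s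
  proof -
    obtain c v where W: "W w = c *\<^sub>R outer v" using rank by blast
    have "poly (det_poly (H + W w) ?E) s = det ((H + s *\<^sub>R ?E) + W w)"
      by (simp add: poly_det_poly add_ac)
    then show ?thesis by (simp add: W det_add_outer)
  qed
  have bl: "bounded_linear (det_deriv A)" for A :: "real ^ 'n ^ 'n"
    using linear_det_deriv by (simp add: linear_conv_bounded_linear)
  have int_poly: "integrable M (\<lambda>w. poly (det_poly (H + W w) ?E) s)" for s
    unfolding affine by (intro Bochner_Integration.integrable_add integrable_const integrable_bounded_linear[OF bl] intW)
  have E_poly: "(\<integral>w. poly (det_poly (H + W w) ?E) s \<partial>M) = poly (det_poly H ?E + pderiv (det_poly H ?E)) s" for s
  proof -
    have "(\<integral>w. poly (det_poly (H + W w) ?E) s \<partial>M) = det (H + s *\<^sub>R ?E) + det_deriv (H + s *\<^sub>R ?E) ?E"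
      unfolding affine using integrable_bounded_linear[OF bl intW] integral_bounded_linear[OF bl intW]
      by (simp add: prob_space)
    then show ?thesis by (simp add: poly_det_poly poly_pderiv_det_poly)
  qed
  let ?n = "CARD('n)"
  have cf: "coeff (det_poly (H + W w) ?E) k = (\<Sum>i\<le>?n. poly (det_poly (H + W w) ?E) (real i) * coeff (lagrange ?n i) k)" for w k
    by (rule coeff_lagrange[OF degree_det_poly])
  have int_coeff: "integrable M (\<lambda>w. coeff (det_poly (H + W w) ?E) k)" for k
    unfolding cf using int_poly by auto
  have "degree (det_poly H ?E + pderiv (det_poly H ?E)) \<le> ?n"
    by (intro degree_add_le degree_det_poly) (simp add: degree_pderiv order_trans[OF diff_le_self degree_det_poly])
  then have E_coeff: "(\<integral>w. coeff (det_poly (H + W w) ?E) k \<partial>M) = coeff (det_poly H ?E + pderiv (det_poly H ?E)) k" for k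
    unfolding cf using int_poly by (subst coeff_lagrange) (simp_all add: E_poly)
  have int_r: "integrable M (\<lambda>w. rising N (det_poly (H + W w) ?E))"
    unfolding rising_def using int_coeff by auto
  have E_r: "(\<integral>w. rising N (det_poly (H + W w) ?E) \<partial>M) = rising (Suc N) (det_poly H ?E)"
    unfolding rising_Suc unfolding rising_def using int_coeff by (simp add: E_coeff del: coeff_add)
  \<comment> \<open>The induction hypothesis is used with \<open>H + W y\<close> in place of
    \<open>H\<close>, the last matrix being integrated outermost.\<close>
  note IH = Suc.IH[OF psdW]
  have meas: "(\<lambda>\<omega>. ennreal (det (H + (\<Sum>j<Suc N. W (\<omega> j))))) \<in> borel_measurable (Pi\<^sub>M {..<Suc N} (\<lambda>_. M))"
    by measurable
  have "(\<integral>\<^sup>+\<omega>. ennreal (det (H + (\<Sum>j<Suc N. W (\<omega> j)))) \<partial>(Pi\<^sub>M {..<Suc N} (\<lambda>_. M))) =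
      (\<integral>\<^sup>+y. (\<integral>\<^sup>+\<omega>. ennreal (det (H + (\<Sum>j<Suc N. W ((fun_upd \<omega> N y) j)))) \<partial>(Pi\<^sub>M {..<N} (\<lambda>_. M))) \<partial>M)"
    using meas unfolding lessThan_Suc[of N] by (intro product_nn_integral_insert_rev) auto
  also have "\<dots> = (\<integral>\<^sup>+y. (\<integral>\<^sup>+\<omega>. ennreal (det ((H + W y) + (\<Sum>j<N. W (\<omega> j)))) \<partial>(Pi\<^sub>M {..<N} (\<lambda>_. M))) \<partial>M)"
    by (simp add: add_ac)
  also have "\<dots> = (\<integral>\<^sup>+y. ennreal (rising N (det_poly (H + W y) ?E)) \<partial>M)"
    using IH by simp
  also have "\<dots> = ennreal (\<integral>y. rising N (det_poly (H + W y) ?E) \<partial>M)"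
    using IH int_r by (intro nn_integral_eq_integral) auto
  finally show ?case
    unfolding E_r[symmetric] using IH by (auto intro!: integral_nonneg_AE)
qed

section \<open>Polynomial volumes\<close>

lemma sum_PiE_insert:
  assumes "finite I" "i \<notin> I"
  shows "(\<Sum>\<kappa>\<in>PiE (insert i I) F. g \<kappa>) = (\<Sum>\<kappa>\<in>PiE I F. \<Sum>y\<in>F i. g (\<kappa>(i := y)))"
proof -
  have "(\<Sum>\<kappa>\<in>PiE (insert i I) F. g \<kappa>) = (\<Sum>z\<in>F i \<times> PiE I F. g ((\<lambda>(y, \<kappa>). \<kappa>(i := y)) z))"
    unfolding PiE_insert_eq by (rule sum.reindex[OF inj_combinator[OF assms(2)], unfolded o_def])
  also have "\<dots> = (\<Sum>y\<in>F i. \<Sum>\<kappa>\<in>PiE I F. g (\<kappa>(i := y)))"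
    by (simp add: sum.cartesian_product split_beta)
  finally show ?thesis by (simp only: sum.swap[of _ "F i"])
qed

text \<open>One variable is interpolated at a time, so a degree bound in each variable separately
  suffices. Variables outside \<open>I\<close> stay as they are, which later leaves those of the
  balls free.\<close>

lemma multivariate_lagrange_interpolation:
  fixes f :: "(nat \<Rightarrow> real) \<Rightarrow> real"
  assumes "finite I"
    and pol: "\<And>t i. i \<in> I \<Longrightarrow> \<exists>P. degree P \<le> n \<and> (\<forall>s. f (t(i := s)) = poly P s)"
  shows "f t = (\<Sum>\<kappa>\<in>PiE I (\<lambda>_. {..n}). f (\<lambda>i. if i \<in> I then real (\<kappa> i) else t i) * (\<Prod>i\<in>I. poly (lagrange n (\<kappa> i)) (t i)))"
  using assms
proof (induction I rule: finite_induct)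
  case empty
  then show ?case by simp
next
  case (insert j I)
  let ?m = "\<lambda>I \<kappa> i. if i \<in> I then real (\<kappa> i) else t i"
  have one: "f (?m I \<kappa>) = (\<Sum>y\<le>n. f ((?m I \<kappa>)(j := real y)) * poly (lagrange n y) (t j))" for \<kappa>
  proof -
    obtain P where P: "degree P \<le> n" "\<And>s. f ((?m I \<kappa>)(j := s)) = poly P s"
      using insert.prems[of j "?m I \<kappa>"] by blast
    have "(?m I \<kappa>)(j := t j) = ?m I \<kappa>" using insert.hyps by auto
    then have "f (?m I \<kappa>) = poly P (t j)" using P(2)[of "t j"] by simp
    also have "\<dots> = poly (\<Sum>y\<le>n. smult (poly P (real y)) (lagrange n y)) (t j)"
      using lagrange_interpolation[OF P(1)] by simp
    finally show ?thesis by (simp add: poly_sum P(2))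
  qed
  have mix: "(?m I \<kappa>)(j := real y) = ?m (insert j I) (\<kappa>(j := y))" for \<kappa> y
    using insert.hyps by auto
  have "f t = (\<Sum>\<kappa>\<in>PiE I (\<lambda>_. {..n}). f (?m I \<kappa>) * (\<Prod>i\<in>I. poly (lagrange n (\<kappa> i)) (t i)))"
    using insert.IH insert.prems by blast
  also have "\<dots> = (\<Sum>\<kappa>\<in>PiE I (\<lambda>_. {..n}). \<Sum>y\<le>n. f (?m (insert j I) (\<kappa>(j := y))) *
      (\<Prod>i\<in>insert j I. poly (lagrange n ((\<kappa>(j := y)) i)) (t i)))"
  proof (rule sum.cong)
    fix \<kappa> assume "\<kappa> \<in> PiE I (\<lambda>_. {..n})"
    have "(\<Prod>i\<in>insert j I. poly (lagrange n ((\<kappa>(j := y)) i)) (t i)) =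
        poly (lagrange n y) (t j) * (\<Prod>i\<in>I. poly (lagrange n (\<kappa> i)) (t i))" for y
      using insert.hyps by (simp, intro disjI2 prod.cong) auto
    then show "f (?m I \<kappa>) * (\<Prod>i\<in>I. poly (lagrange n (\<kappa> i)) (t i)) =
       (\<Sum>y\<le>n. f (?m (insert j I) (\<kappa>(j := y))) * (\<Prod>i\<in>insert j I. poly (lagrange n ((\<kappa>(j := y)) i)) (t i)))"
      by (subst one, unfold mix) (simp add: sum_distrib_right mult.assoc)
  qed simp
  also have "\<dots> = (\<Sum>\<kappa>\<in>PiE (insert j I) (\<lambda>_. {..n}). f (?m (insert j I) \<kappa>) * (\<Prod>i\<in>insert j I. poly (lagrange n (\<kappa> i)) (t i)))"
    by (rule sum_PiE_insert[symmetric]) (use insert.hyps in auto)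
  finally show ?case .
qed

section \<open>Convex bodies and their Steiner polynomials\<close>

lemma convex_set_sum:
  fixes K :: "'i \<Rightarrow> 'a::real_vector set"
  assumes "\<And>i. i \<in> I \<Longrightarrow> convex (K i)"
  shows "convex (\<Sum>i\<in>I. K i)"
  using assms
  by (induction I rule: infinite_finite_induct) (auto simp: set_zero intro: convex_set_plus)

lemma set_sum_nonempty:
  fixes K :: "'i \<Rightarrow> 'a::comm_monoid_add set"
  assumes "\<And>i. i \<in> I \<Longrightarrow> K i \<noteq> {}"
  shows "(\<Sum>i\<in>I. K i) \<noteq> {}"
  using assms
  by (induction I rule: infinite_finite_induct) (auto simp: set_zero set_plus_def)

definition convex_body :: "'a::euclidean_space set \<Rightarrow> bool" where
  "convex_body K \<longleftrightarrow> compact K \<and> convex K \<and> K \<noteq> {}"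

lemma convex_body_scale: "convex_body K \<Longrightarrow> convex_body ((*\<^sub>R) t ` K)"
  by (auto simp: convex_body_def compact_scaling convex_scaling)

lemma convex_body_sum:
  "finite I \<Longrightarrow> (\<And>i. i \<in> I \<Longrightarrow> convex_body (K i)) \<Longrightarrow> convex_body (\<Sum>i\<in>I. K i)"
  by (simp add: convex_body_def compact_set_sum convex_set_sum set_sum_nonempty)

lemma convex_body_add: "convex_body K \<Longrightarrow> convex_body L \<Longrightarrow> convex_body (K + L)"
  using convex_body_sum[of "{True, False}" "\<lambda>b. if b then K else L"] by (simp add: add.commute)

lemma convex_body_cball: "0 \<le> r \<Longrightarrow> convex_body (cball a r)"
  by (simp add: convex_body_def)

lemma convex_body_sets: "convex_body K \<Longrightarrow> K \<in> sets borel"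
  by (simp add: convex_body_def borel_compact)

lemma convex_body_measure_lebesgue: "convex_body K \<Longrightarrow> measure lebesgue K = measure lborel K"
  by (simp add: convex_body_sets measure_completion)

lemma convex_body_emeasure_finite: "convex_body K \<Longrightarrow> emeasure lborel K < \<infinity>"
  using emeasure_compact_finite[of K] by (simp add: convex_body_def)

lemma convex_body_emeasure: "convex_body K \<Longrightarrow> emeasure lborel K = ennreal (measure lborel K)"
  using convex_body_emeasure_finite[of K] by (simp add: emeasure_eq_ennreal_measure less_top)

lemma potential_volume:
  fixes K :: "(real ^ 'n) set"
  assumes pot: "potential K f G H" and K: "convex_body K"
  shows "integrable lborel (\<lambda>x. det (H x))" "measure lborel K = (\<integral>x. det (H x) \<partial>lborel)"
proof -
  have nn: "(\<integral>\<^sup>+x. ennreal (det (H x)) \<partial>lborel) = ennreal (measure lborel K)"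
    using potential_emeasure[OF pot] K convex_body_emeasure[OF K] by (simp add: convex_body_def)
  have pos: "0 \<le> det (H x)" for x
    using potential_det_nonneg[OF pot] K by (simp add: convex_body_def)
  have [measurable]: "H \<in> borel_measurable borel"
    using potentialD(3)[OF pot] by (rule borel_measurable_continuous_onI)
  show int: "integrable lborel (\<lambda>x. det (H x))"
    using nn pos by (intro integrableI_nonneg) auto
  show "measure lborel K = (\<integral>x. det (H x) \<partial>lborel)"
    using nn nn_integral_eq_integral[OF int] pos
    by (simp add: integral_nonneg_AE)
qed

text \<open>The Hessians are chosen once, for all \<open>t\<close>. At each \<open>x\<close> the
  integrand is a determinant, of degree at most \<open>CARD('n)\<close> in each \<open>t i\<close>,
  and its values at the nodes are again integrands of Minkowski sums, as the nodes are nonnegative.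
  Integrating the interpolation identity over \<open>x\<close> turns it into one between
  volumes.\<close>

lemma volume_interpolation:
  fixes K :: "nat \<Rightarrow> (real ^ 'n) set"
  assumes K: "\<And>i. i < m \<Longrightarrow> convex_body (K i)" and I: "I \<subseteq> {..<m}" and t: "\<And>i. 0 \<le> t i" and N: "CARD('n) \<le> N"
  shows "measure lborel (\<Sum>i<m. (*\<^sub>R) (t i) ` K i) =
    (\<Sum>\<kappa>\<in>PiE I (\<lambda>_. {..N}). measure lborel (\<Sum>i<m. (*\<^sub>R) (if i \<in> I then real (\<kappa> i) else t i) ` K i) *
      (\<Prod>i\<in>I. poly (lagrange N (\<kappa> i)) (t i)))"
proof -
  have "\<exists>H. \<exists>f G. potential (K i) f G H" if "i < m" for i
    using K[OF that] exists_potential[of "K i"] by (auto simp: convex_body_def)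
  then obtain H where H: "\<And>i. i < m \<Longrightarrow> \<exists>f G. potential (K i) f G (H i)" by metis
  then obtain f G where pot: "\<And>i. i < m \<Longrightarrow> potential (K i) (f i) (G i) (H i)" by metis
  let ?p = "\<lambda>x t. det (\<Sum>i<m. t i *\<^sub>R H i x)"
  have vol: "integrable lborel (\<lambda>x. ?p x t)" "measure lborel (\<Sum>i<m. (*\<^sub>R) (t i) ` K i) = (\<integral>x. ?p x t \<partial>lborel)"
    if "\<And>i. 0 \<le> t i" for t
  proof -
    have "potential (\<Sum>i<m. (*\<^sub>R) (t i) ` K i) (\<lambda>x. \<Sum>i<m. t i * f i x) (\<lambda>x. \<Sum>i<m. t i *\<^sub>R G i x) (\<lambda>x. \<Sum>i<m. t i *\<^sub>R H i x)"
      using pot that by (intro potential_sum potential_scale) auto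
    from potential_volume[OF this] show "integrable lborel (\<lambda>x. ?p x t)" "measure lborel (\<Sum>i<m. (*\<^sub>R) (t i) ` K i) = (\<integral>x. ?p x t \<partial>lborel)"
      using K by (auto intro!: convex_body_sum convex_body_scale)
  qed
  have "finite I" using I finite_subset by blast
  have interp: "?p x t = (\<Sum>\<kappa>\<in>PiE I (\<lambda>_. {..N}). ?p x (\<lambda>i. if i \<in> I then real (\<kappa> i) else t i) *
      (\<Prod>i\<in>I. poly (lagrange N (\<kappa> i)) (t i)))" for x
  proof (rule multivariate_lagrange_interpolation[OF \<open>finite I\<close>])
    fix t i assume "i \<in> I"
    let ?A = "\<Sum>j\<in>{..<m} - {i}. t j *\<^sub>R H j x"
    have "?p x (t(i := s)) = poly (det_poly ?A (H i x)) s" for s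
    proof -
      have "(\<Sum>j<m. (t(i := s)) j *\<^sub>R H j x) = s *\<^sub>R H i x + ?A"
        using \<open>i \<in> I\<close> I by (subst sum.remove[of _ i]) (auto intro!: sum.cong)
      then show ?thesis by (simp add: poly_det_poly add.commute)
    qed
    then show "\<exists>P. degree P \<le> N \<and> (\<forall>s. ?p x (t(i := s)) = poly P s)"
      using order_trans[OF degree_det_poly N] by blast
  qed
  have int: "integrable lborel (\<lambda>x. ?p x (\<lambda>i. if i \<in> I then real (\<kappa> i) else t i))" for \<kappa>
    by (rule vol(1)) (use t in simp)
  have val: "measure lborel (\<Sum>i<m. (*\<^sub>R) (if i \<in> I then real (\<kappa> i) else t i) ` K i) =
      (\<integral>x. ?p x (\<lambda>i. if i \<in> I then real (\<kappa> i) else t i) \<partial>lborel)" for \<kappa>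
    by (rule vol(2)) (use t in simp)
  have "measure lborel (\<Sum>i<m. (*\<^sub>R) (t i) ` K i) = (\<integral>x. ?p x t \<partial>lborel)"
    by (rule vol(2)[OF t])
  also have "\<dots> = (\<Sum>\<kappa>\<in>PiE I (\<lambda>_. {..N}). (\<integral>x. ?p x (\<lambda>i. if i \<in> I then real (\<kappa> i) else t i) \<partial>lborel) *
      (\<Prod>i\<in>I. poly (lagrange N (\<kappa> i)) (t i)))"
    unfolding interp by (subst Bochner_Integration.integral_sum) (use int in auto)
  finally show ?thesis by (simp only: val)
qed

text \<open>Defined by its values at s = 0, ..., n, which makes sense before the volume of K + s B
  is known to be a polynomial in s.\<close>

definition steiner_poly :: "(real ^ 'n) set \<Rightarrow> real poly" where
  "steiner_poly K = (\<Sum>j\<le>CARD('n). smult (measure lborel (K + (*\<^sub>R) (real j) ` cball 0 1)) (lagrange CARD('n) j))"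

lemma potential_scaled_ball:
  fixes K :: "(real ^ 'n) set"
  assumes pot: "potential K f G H" and K: "convex_body K" and "0 \<le> s"
  shows "integrable lborel (\<lambda>x. poly (det_poly (H x) (zonoid_hessian x)) s)"
    "(\<integral>x. poly (det_poly (H x) (zonoid_hessian x)) s \<partial>lborel) =
      measure lborel (K + (*\<^sub>R) (s * ball_mean TYPE('n)) ` cball 0 1)"
proof -
  have b: "cball (0::real^'n) (ball_mean TYPE('n)) = (*\<^sub>R) (ball_mean TYPE('n)) ` cball 0 1"
    using ball_mean_pos[where 'n='n] by (simp add: cball_scale[of "ball_mean TYPE('n)" 0 1, simplified])
  have "potential (K + (*\<^sub>R) s ` cball 0 (ball_mean TYPE('n))) (\<lambda>x. f x + s * (\<integral>u. soft_abs (u \<bullet> x) \<partial>ball_measure))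
      (\<lambda>x. G x + s *\<^sub>R (\<integral>u. soft_abs' (u \<bullet> x) *\<^sub>R u \<partial>ball_measure)) (\<lambda>x. H x + s *\<^sub>R zonoid_hessian x)"
    by (intro potential_add pot potential_scale potential_ball \<open>0 \<le> s\<close>)
  then have pot': "potential (K + (*\<^sub>R) (s * ball_mean TYPE('n)) ` cball 0 1) (\<lambda>x. f x + s * (\<integral>u. soft_abs (u \<bullet> x) \<partial>ball_measure))
      (\<lambda>x. G x + s *\<^sub>R (\<integral>u. soft_abs' (u \<bullet> x) *\<^sub>R u \<partial>ball_measure)) (\<lambda>x. H x + s *\<^sub>R zonoid_hessian x)"
    by (simp add: b image_image)
  have cb: "convex_body (K + (*\<^sub>R) (s * ball_mean TYPE('n)) ` cball (0::real^'n) 1)"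
    by (intro convex_body_add convex_body_scale convex_body_cball K) simp
  show "integrable lborel (\<lambda>x. poly (det_poly (H x) (zonoid_hessian x)) s)"
    "(\<integral>x. poly (det_poly (H x) (zonoid_hessian x)) s \<partial>lborel) =
      measure lborel (K + (*\<^sub>R) (s * ball_mean TYPE('n)) ` cball 0 1)"
    using potential_volume[OF pot' cb] by (simp_all add: poly_det_poly)
qed

lemma degree_steiner_poly: "degree (steiner_poly (K :: (real ^ 'n) set)) \<le> CARD('n)"
  unfolding steiner_poly_def
  by (intro degree_sum_le order_trans[OF degree_smult_le] degree_lagrange) auto

lemma poly_steiner_poly:
  fixes K :: "(real ^ 'n) set"
  assumes K: "convex_body K" and "0 \<le> s"
  shows "poly (steiner_poly K) s = measure lborel (K + (*\<^sub>R) s ` cball 0 1)"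
proof -
  obtain f G H where pot: "potential K f G H"
    using exists_potential[of K] K by (auto simp: convex_body_def)
  let ?c = "ball_mean TYPE('n)"
  have c: "0 < ?c" by (rule ball_mean_pos)
  let ?P = "\<lambda>x. det_poly (H x) (zonoid_hessian x)"
  \<comment> \<open>\<open>zonoid_hessian\<close> belongs to the ball of radius \<open>?c\<close>,
    hence the substitution of s / c.\<close>
  let ?Q = "\<lambda>x. pcompose (?P x) [:0, 1 / ?c:]"
  have deg: "degree (?Q x) \<le> CARD('n)" for x
    using degree_det_poly[of "H x" "zonoid_hessian x"] c by (simp add: degree_pcompose)
  have vol: "integrable lborel (\<lambda>x. poly (?Q x) r)"
    "(\<integral>x. poly (?Q x) r \<partial>lborel) = measure lborel (K + (*\<^sub>R) r ` cball 0 1)" if "0 \<le> r" for r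
    using potential_scaled_ball[OF pot K, of "r / ?c"] that c by (auto simp: poly_pcompose mult.commute)
  have "measure lborel (K + (*\<^sub>R) s ` cball 0 1) = (\<integral>x. poly (?Q x) s \<partial>lborel)"
    using vol(2)[OF \<open>0 \<le> s\<close>] by simp
  also have "\<dots> = (\<integral>x. (\<Sum>j\<le>CARD('n). poly (?Q x) (real j) * poly (lagrange CARD('n) j) s) \<partial>lborel)"
    by (subst lagrange_interpolation[OF deg]) (simp add: poly_sum)
  also have "\<dots> = (\<Sum>j\<le>CARD('n). (\<integral>x. poly (?Q x) (real j) \<partial>lborel) * poly (lagrange CARD('n) j) s)"
    by (subst Bochner_Integration.integral_sum) (use vol in auto)
  also have "\<dots> = poly (steiner_poly K) s"
    by (simp add: steiner_poly_def poly_sum vol(2))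
  finally show ?thesis by simp
qed

text \<open>The power of \<open>ball_mean\<close> undoes the same rescaling:
  \<open>zonoid_hessian\<close> does not belong to the unit ball but to the ball of radius
  \<open>ball_mean TYPE('n)\<close>.\<close>

lemma coeff_steiner_poly:
  fixes K :: "(real ^ 'n) set"
  assumes pot: "potential K f G H" and K: "convex_body K"
  shows "integrable lborel (\<lambda>x. coeff (det_poly (H x) (zonoid_hessian x)) k)"
    "(\<integral>x. coeff (det_poly (H x) (zonoid_hessian x)) k \<partial>lborel) =
      ball_mean TYPE('n) ^ k * coeff (steiner_poly K) k"
proof -
  let ?n = "CARD('n)" and ?c = "ball_mean TYPE('n)"
  let ?P = "\<lambda>x. det_poly (H x) (zonoid_hessian x)"
  let ?S = "pcompose (steiner_poly K) [:0, ?c:]"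
  have c: "0 < ?c" by (rule ball_mean_pos)
  have cf: "coeff (?P x) k = (\<Sum>j\<le>?n. poly (?P x) (real j) * coeff (lagrange ?n j) k)" for x
    by (rule coeff_lagrange[OF degree_det_poly])
  have vol: "integrable lborel (\<lambda>x. poly (?P x) (real j))"
    "(\<integral>x. poly (?P x) (real j) \<partial>lborel) = poly ?S (real j)" for j
    using potential_scaled_ball[OF pot K, of "real j"] c
    by (auto simp: poly_pcompose poly_steiner_poly[OF K] less_imp_le)
  show "integrable lborel (\<lambda>x. coeff (?P x) k)"
    unfolding cf using vol(1) by auto
  have "degree ?S \<le> ?n" using degree_steiner_poly[of K] c by (simp add: degree_pcompose)
  then have "coeff ?S k = (\<Sum>j\<le>?n. poly ?S (real j) * coeff (lagrange ?n j) k)"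
    by (rule coeff_lagrange)
  also have "\<dots> = (\<integral>x. coeff (?P x) k \<partial>lborel)"
    unfolding cf using vol by (subst Bochner_Integration.integral_sum) auto
  finally show "(\<integral>x. coeff (?P x) k \<partial>lborel) = ?c ^ k * coeff (steiner_poly K) k"
    by (simp add: coeff_pcompose_linear)
qed

text \<open>Downward induction on \<open>j\<close>, since the head of the list
  \<open>[j..<n]\<close> is differentiated last. A variable below \<open>d\<close> acts on its own
  factor; one from \<open>d\<close> on occurs only in the common sum, so each of them differentiates
  \<open>Q\<close> once, which makes \<open>n - max d j\<close> times. The formula is assumed and
  kept on the orthant alone, so derivatives at \<open>t j = 0\<close> are one-sided.\<close>

lemma orthant_partials_separated:
  fixes p :: "'k \<Rightarrow> nat \<Rightarrow> real poly" and Q :: "'k \<Rightarrow> real poly"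
  assumes f: "\<And>t. (\<And>i. 0 \<le> t i) \<Longrightarrow>
      f t = (\<Sum>\<kappa>\<in>X. (\<Prod>i<d. poly (p \<kappa> i) (t i)) * poly (Q \<kappa>) (\<Sum>i\<in>{d..<n}. t i))"
    and "d \<le> n" "j \<le> n" and t: "\<And>i. 0 \<le> t i"
  shows "orthant_partials [j..<n] f t =
    (\<Sum>\<kappa>\<in>X. (\<Prod>i<d. poly (if j \<le> i then pderiv (p \<kappa> i) else p \<kappa> i) (t i)) *
       poly ((pderiv ^^ (n - max d j)) (Q \<kappa>)) (\<Sum>i\<in>{d..<n}. t i))"
  using \<open>j \<le> n\<close> t
proof (induction j arbitrary: t rule: inc_induct)
  case base
  then show ?case using f[of t] \<open>d \<le> n\<close> by (auto intro!: sum.cong prod.cong)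
next
  case (step j)
  define F where "F = (\<lambda>s. \<Sum>\<kappa>\<in>X. (\<Prod>i<d. poly (if Suc j \<le> i then pderiv (p \<kappa> i) else p \<kappa> i) ((t(j := s)) i)) *
       poly ((pderiv ^^ (n - max d (Suc j))) (Q \<kappa>)) (\<Sum>i\<in>{d..<n}. (t(j := s)) i))"
  define D where "D = (\<Sum>\<kappa>\<in>X. (\<Prod>i<d. poly (if j \<le> i then pderiv (p \<kappa> i) else p \<kappa> i) (t i)) *
       poly ((pderiv ^^ (n - max d j)) (Q \<kappa>)) (\<Sum>i\<in>{d..<n}. t i))"
  have eq: "orthant_partials [Suc j..<n] f (t(j := s)) = F s" if "s \<in> {0..}" for s
    unfolding F_def by (rule step.IH) (use that step.prems in auto)
  have "(F has_real_derivative D) (at (t j) within {0..})"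
    unfolding F_def D_def
  proof (rule DERIV_sum)
    fix \<kappa>
    show "((\<lambda>s. (\<Prod>i<d. poly (if Suc j \<le> i then pderiv (p \<kappa> i) else p \<kappa> i) ((t(j := s)) i)) *
         poly ((pderiv ^^ (n - max d (Suc j))) (Q \<kappa>)) (\<Sum>i\<in>{d..<n}. (t(j := s)) i)) has_real_derivative
        (\<Prod>i<d. poly (if j \<le> i then pderiv (p \<kappa> i) else p \<kappa> i) (t i)) *
         poly ((pderiv ^^ (n - max d j)) (Q \<kappa>)) (\<Sum>i\<in>{d..<n}. t i)) (at (t j) within {0..})"
    proof (cases "j < d")
      case True
      have 1: "(\<Prod>i<d. poly (if Suc j \<le> i then pderiv (p \<kappa> i) else p \<kappa> i) ((t(j := s)) i)) =
          poly (p \<kappa> j) s * (\<Prod>i\<in>{..<d} - {j}. poly (if j \<le> i then pderiv (p \<kappa> i) else p \<kappa> i) (t i))" for s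
      proof -
        have "(\<Prod>i<d. poly (if Suc j \<le> i then pderiv (p \<kappa> i) else p \<kappa> i) ((t(j := s)) i)) =
          poly (p \<kappa> j) s * (\<Prod>i\<in>{..<d} - {j}. poly (if Suc j \<le> i then pderiv (p \<kappa> i) else p \<kappa> i) ((t(j := s)) i))"
          using True by (subst prod.remove[of _ j]) auto
        also have "(\<Prod>i\<in>{..<d} - {j}. poly (if Suc j \<le> i then pderiv (p \<kappa> i) else p \<kappa> i) ((t(j := s)) i)) =
          (\<Prod>i\<in>{..<d} - {j}. poly (if j \<le> i then pderiv (p \<kappa> i) else p \<kappa> i) (t i))"
          by (intro prod.cong) (auto simp: not_le less_Suc_eq_le Suc_le_eq)
        finally show ?thesis .
      qed
      have 2: "(\<Prod>i<d. poly (if j \<le> i then pderiv (p \<kappa> i) else p \<kappa> i) (t i)) =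
          poly (pderiv (p \<kappa> j)) (t j) * (\<Prod>i\<in>{..<d} - {j}. poly (if j \<le> i then pderiv (p \<kappa> i) else p \<kappa> i) (t i))"
        using True by (subst prod.remove[of _ j]) auto
      have 3: "(\<Sum>i\<in>{d..<n}. (t(j := s)) i) = (\<Sum>i\<in>{d..<n}. t i)" for s
        using True by (intro sum.cong) auto
      have 4: "n - max d (Suc j) = n - max d j" using True by simp
      show ?thesis
        unfolding 1 2 3 4
        by (intro DERIV_cmult_right has_field_derivative_at_within[OF poly_DERIV])
    next
      case False
      with step.hyps have j: "j \<in> {d..<n}" by auto
      have 1: "(\<Prod>i<d. poly (if Suc j \<le> i then pderiv (p \<kappa> i) else p \<kappa> i) ((t(j := s)) i)) =
          (\<Prod>i<d. poly (if j \<le> i then pderiv (p \<kappa> i) else p \<kappa> i) (t i))" for s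
        using False by (intro prod.cong) auto
      have 2: "(\<Sum>i\<in>{d..<n}. (t(j := s)) i) = s + (\<Sum>i\<in>{d..<n} - {j}. t i)" for s
        using j by (subst sum.remove[of _ j]) (auto intro!: sum.cong)
      have 3: "(\<Sum>i\<in>{d..<n}. t i) = t j + (\<Sum>i\<in>{d..<n} - {j}. t i)"
        using j by (subst sum.remove[of _ j]) auto
      have 4: "(pderiv ^^ (n - max d j)) (Q \<kappa>) = pderiv ((pderiv ^^ (n - max d (Suc j))) (Q \<kappa>))"
      proof -
        have "n - max d j = Suc (n - max d (Suc j))" using j False by auto
        then show ?thesis by (simp only: funpow.simps o_apply)
      qed
      let ?R = "(pderiv ^^ (n - max d (Suc j))) (Q \<kappa>)" and ?c = "\<Sum>i\<in>{d..<n} - {j}. t i"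
      have "((\<lambda>s. s + ?c) has_real_derivative 1) (at (t j))"
        by (auto intro!: derivative_eq_intros)
      from DERIV_chain2[OF poly_DERIV this] have "((\<lambda>s. poly ?R (s + ?c)) has_real_derivative poly (pderiv ?R) (t j + ?c)) (at (t j) within {0..})"
        by (simp add: has_field_derivative_at_within)
      then show ?thesis unfolding 1 2 3 4 by (rule DERIV_cmult)
    qed
  qed
  then have "(F has_vector_derivative D) (at (t j) within {0..})"
    by (simp add: has_real_derivative_iff_has_vector_derivative)
  then have "((\<lambda>s. orthant_partials [Suc j..<n] f (t(j := s))) has_vector_derivative D) (at (t j) within {0..})"
    by (rule has_vector_derivative_transform[rotated 2]) (use eq step.prems in auto)
  \<comment> \<open>\<open>vector_derivative\<close> is determined only at a limit point of the
    half-line, and the boundary point \<open>t j = 0\<close> is one.\<close>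
  moreover have "at (t j) within {0..} \<noteq> bot"
  proof -
    have "at (t j) within {0..} \<ge> at_right (t j)"
      using step.prems[of j] by (intro at_le) auto
    then show ?thesis by (metis bot.extremum_uniqueI trivial_limit_at_right_real)
  qed
  ultimately have "vector_derivative (\<lambda>s. orthant_partials [Suc j..<n] f (t(j := s))) (at (t j) within {0..}) = D"
    by (intro vector_derivative_within)
  then show ?case
    using step.hyps by (simp add: upt_conv_Cons D_def)
qed

lemma poly_funpow_pderiv_0: "poly ((pderiv ^^ k) P) 0 = fact k * coeff (P :: real poly) k"
proof (induction k arbitrary: P)
  case (Suc k)
  then show ?case by (simp add: funpow_Suc_right coeff_pderiv algebra_simps del: funpow.simps)
qed (simp add: poly_0_coeff_0)

lemma orthant_partials_separated_0:
  fixes p :: "'k \<Rightarrow> nat \<Rightarrow> real poly" and Q :: "'k \<Rightarrow> real poly"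
  assumes f: "\<And>t. (\<And>i. 0 \<le> t i) \<Longrightarrow>
      f t = (\<Sum>\<kappa>\<in>X. (\<Prod>i<d. poly (p \<kappa> i) (t i)) * poly (Q \<kappa>) (\<Sum>i\<in>{d..<n}. t i))"
    and "d \<le> n"
  shows "orthant_partials [0..<n] f (\<lambda>_. 0) =
    (\<Sum>\<kappa>\<in>X. (\<Prod>i<d. coeff (p \<kappa> i) 1) * (fact (n - d) * coeff (Q \<kappa>) (n - d)))"
  using orthant_partials_separated[OF f \<open>d \<le> n\<close>, of 0 "\<lambda>_. 0"]
  by (simp add: poly_funpow_pderiv_0) (simp add: poly_0_coeff_0 coeff_pderiv)

section \<open>Cylinders and zonotopes\<close>

lemma
  fixes S :: "'a::euclidean_space set"
  assumes S: "subspace S"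
  shows orthogonal_projection_in: "orthogonal_projection S x \<in> S"
    and orthogonal_projection_orthogonal: "z \<in> S \<Longrightarrow> (x - orthogonal_projection S x) \<bullet> z = 0"
    and orthogonal_projection_unique: "y \<in> S \<Longrightarrow> (\<And>z. z \<in> S \<Longrightarrow> (x - y) \<bullet> z = 0) \<Longrightarrow> orthogonal_projection S x = y"
proof -
  have uniq: "y = y'" if "y \<in> S" "y' \<in> S" "\<And>z. z \<in> S \<Longrightarrow> (x - y) \<bullet> z = 0" "\<And>z. z \<in> S \<Longrightarrow> (x - y') \<bullet> z = 0" for y y'
  proof -
    have "y - y' \<in> S" using that S by (simp add: subspace_diff)
    then have "(x - y') \<bullet> (y - y') - (x - y) \<bullet> (y - y') = 0" using that by simp
    then have "(y - y') \<bullet> (y - y') = 0" by (simp add: inner_diff_left)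
    then show ?thesis by simp
  qed
  obtain y0 z0 where yz: "y0 \<in> span S" "\<And>w. w \<in> span S \<Longrightarrow> orthogonal z0 w" "x = y0 + z0"
    using orthogonal_subspace_decomp_exists[of S x] by blast
  have "\<exists>!y. y \<in> S \<and> (\<forall>z\<in>S. orthogonal (x - y) z)"
  proof (rule ex1I[of _ y0])
    show "y0 \<in> S \<and> (\<forall>z\<in>S. orthogonal (x - y0) z)"
      using yz S by (simp add: span_eq_iff[THEN iffD2])
    then show "y' = y0" if "y' \<in> S \<and> (\<forall>z\<in>S. orthogonal (x - y') z)" for y'
      using that by (intro uniq) (auto simp: orthogonal_def)
  qed
  from theI'[OF this] have P: "orthogonal_projection S x \<in> S" "\<And>z. z \<in> S \<Longrightarrow> (x - orthogonal_projection S x) \<bullet> z = 0"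
    by (simp_all add: orthogonal_projection_def orthogonal_def)
  show "orthogonal_projection S x \<in> S" by (rule P)
  show "z \<in> S \<Longrightarrow> (x - orthogonal_projection S x) \<bullet> z = 0" by (rule P)
  show "y \<in> S \<Longrightarrow> (\<And>z. z \<in> S \<Longrightarrow> (x - y) \<bullet> z = 0) \<Longrightarrow> orthogonal_projection S x = y"
    using P by (intro uniq) auto
qed

lemma linear_orthogonal_projection:
  fixes S :: "'a::euclidean_space set"
  assumes S: "subspace S"
  shows "linear (orthogonal_projection S)"
proof (rule linearI)
  note P = orthogonal_projection_in[OF S] orthogonal_projection_orthogonal[OF S]
  show "orthogonal_projection S (x + y) = orthogonal_projection S x + orthogonal_projection S y" for x y
  proof (rule orthogonal_projection_unique[OF S])
    show "(x + y - (orthogonal_projection S x + orthogonal_projection S y)) \<bullet> z = 0" if "z \<in> S" for z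
      using P(2)[OF that, of x] P(2)[OF that, of y] by (simp add: inner_diff_left inner_add_left)
  qed (use P S in \<open>auto intro: subspace_add\<close>)
  show "orthogonal_projection S (c *\<^sub>R x) = c *\<^sub>R orthogonal_projection S x" for c x
  proof (rule orthogonal_projection_unique[OF S])
    show "(c *\<^sub>R x - c *\<^sub>R orthogonal_projection S x) \<bullet> z = 0" if "z \<in> S" for z
      using P(2)[OF that, of x] by (simp add: inner_diff_left scaleR_diff_right[symmetric])
  qed (use P S in \<open>auto intro: subspace_scale\<close>)
qed

lemma orthogonal_projection_ident: "subspace S \<Longrightarrow> x \<in> S \<Longrightarrow> orthogonal_projection S x = (x :: 'a::euclidean_space)"
  by (rule orthogonal_projection_unique) auto

lemma orthogonal_projection_zero:
  "subspace S \<Longrightarrow> (\<And>z. z \<in> S \<Longrightarrow> x \<bullet> z = 0) \<Longrightarrow> orthogonal_projection S x = (0 :: 'a::euclidean_space)"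
  by (rule orthogonal_projection_unique) (auto simp: subspace_0)

lemma orthogonal_projection_pythagoras:
  fixes S :: "'a::euclidean_space set"
  assumes S: "subspace S"
  shows "(norm x)\<^sup>2 = (norm (orthogonal_projection S x))\<^sup>2 + (norm (x - orthogonal_projection S x))\<^sup>2"
proof -
  let ?P = "orthogonal_projection S x"
  have "(x - ?P) \<bullet> ?P = 0"
    by (rule orthogonal_projection_orthogonal[OF S orthogonal_projection_in[OF S]])
  then have "orthogonal ?P (x - ?P)" by (simp add: orthogonal_def inner_commute)
  from norm_add_Pythagorean[OF this] show ?thesis by simp
qed

lemma norm_orthogonal_projection_le:
  fixes S :: "'a::euclidean_space set"
  assumes S: "subspace S"
  shows "norm (orthogonal_projection S x) \<le> norm x" "norm (x - orthogonal_projection S x) \<le> norm x"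
proof -
  have "(norm (orthogonal_projection S x))\<^sup>2 \<le> (norm x)\<^sup>2" "(norm (x - orthogonal_projection S x))\<^sup>2 \<le> (norm x)\<^sup>2"
    using orthogonal_projection_pythagoras[OF S, of x] by auto
  then show "norm (orthogonal_projection S x) \<le> norm x" "norm (x - orthogonal_projection S x) \<le> norm x"
    by (auto dest: power2_le_imp_le)
qed

text \<open>Both factors are sets of the ambient space, of which only the parts in \<open>S\<close>
  and in its orthogonal complement count. A full ball can thus serve as base or as cross section,
  and neither subspace needs coordinates.\<close>

definition cylinder :: "'a::euclidean_space set \<Rightarrow> 'a set \<Rightarrow> 'a set \<Rightarrow> 'a set" where
  "cylinder S C Z = {x. orthogonal_projection S x \<in> C \<and> x - orthogonal_projection S x \<in> Z}"

lemma measure_scaleR_image: "measure lborel ((*\<^sub>R) r ` A) = \<bar>r\<bar> ^ DIM('a) * measure lborel (A :: 'a::euclidean_space set)"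
  if "A \<in> sets borel" "(*\<^sub>R) r ` A \<in> sets borel"
  using measure_lebesgue_affine[of r 0 A] that by (simp add: measure_completion)

lemma closed_cylinder:
  fixes S :: "'a::euclidean_space set"
  assumes S: "subspace S" and "closed C" "closed Z"
  shows "closed (cylinder S C Z)"
proof -
  have c: "continuous_on UNIV (orthogonal_projection S)"
    using linear_orthogonal_projection[OF S] by (intro linear_continuous_on) (simp add: linear_linear)
  have "closed (orthogonal_projection S -` C)" "closed ((\<lambda>x. x - orthogonal_projection S x) -` Z)"
    using assms c by (auto intro!: continuous_closed_vimage simp: continuous_on_eq_continuous_at continuous_intros
        intro: continuous_intros)
  then have "closed (orthogonal_projection S -` C \<inter> (\<lambda>x. x - orthogonal_projection S x) -` Z)"
    by (rule closed_Int)
  also have "orthogonal_projection S -` C \<inter> (\<lambda>x. x - orthogonal_projection S x) -` Z = cylinder S C Z"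
    by (auto simp: cylinder_def)
  finally show ?thesis .
qed

lemma bounded_cylinder:
  fixes S :: "'a::euclidean_space set"
  assumes "bounded C" "bounded Z"
  shows "bounded (cylinder S C Z)"
proof -
  from assms obtain r s where "\<And>x. x \<in> C \<Longrightarrow> norm x \<le> r" "\<And>x. x \<in> Z \<Longrightarrow> norm x \<le> s"
    by (auto simp: bounded_iff)
  then have "norm x \<le> r + s" if "x \<in> cylinder S C Z" for x
    using that norm_triangle_le[of "orthogonal_projection S x" "x - orthogonal_projection S x" "r + s"]
    by (auto simp: cylinder_def intro: add_mono)
  then show ?thesis by (auto simp: bounded_iff)
qed

text \<open>Translation invariance in the direction of \<open>S\<close> makes the volume of a cylinder a multiple
  of the volume of its base.\<close>

lemma measure_cylinder:
  fixes S :: "'a::euclidean_space set" and f :: "'a \<Rightarrow> 'b::euclidean_space"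
  assumes S: "subspace S" and f: "linear f" "\<And>x. x \<in> S \<Longrightarrow> norm (f x) = norm x" "f ` S = UNIV"
    and C: "compact C" "C \<subseteq> S" and Z: "compact Z"
  shows "measure lborel (cylinder S C Z) * measure lborel (cball (0::'b) 1) =
    measure lborel (cylinder S (cball 0 1) Z) * measure lborel (f ` C)"
proof -
  let ?P = "orthogonal_projection S"
  have [measurable]: "?P \<in> borel_measurable borel" "f \<in> borel_measurable borel"
    using linear_orthogonal_projection[OF S] f by (auto intro: borel_measurable_linear)
  have inj: "x = y" if "x \<in> S" "y \<in> S" "f x = f y" for x y
    using f(2)[of "x - y"] that S by (simp add: linear_diff[OF f(1)] subspace_diff)
  define W where "W = {x. x - ?P x \<in> Z}"
  have W [measurable]: "W \<in> sets borel"
    using Z unfolding W_def by (intro measurable_sets_borel[of "\<lambda>x. x - ?P x" borel Z, unfolded vimage_def]) (auto intro: borel_compact)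
  \<comment> \<open>\<open>W\<close> is invariant under translations along \<open>S\<close>, so
    Lebesgue measure on \<open>W\<close>, pushed to the coordinates of \<open>S\<close>, is
    translation invariant; the unit ball serves as the reference set.\<close>
  define \<nu> where "\<nu> = distr (density lborel (indicator W)) borel (\<lambda>x. f (?P x))"
  have \<nu>: "emeasure \<nu> D = emeasure lborel (W \<inter> {x. f (?P x) \<in> D})" if [measurable]: "D \<in> sets borel" for D
    unfolding \<nu>_def by (simp add: emeasure_distr emeasure_restricted vimage_def)
  have cyl: "W \<inter> {x. f (?P x) \<in> f ` D} = cylinder S D Z" if "D \<subseteq> S" for D
    using that inj orthogonal_projection_in[OF S] by (auto simp: W_def cylinder_def)
  have Wball: "W \<inter> {x. f (?P x) \<in> cball 0 r} = cylinder S (cball 0 r) Z" for r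
    using f(2)[OF orthogonal_projection_in[OF S]] by (auto simp: W_def cylinder_def)
  have fin: "emeasure lborel (cylinder S D Z) < \<infinity>" if "bounded D" for D
    using emeasure_bounded_finite[OF bounded_cylinder[OF that compact_imp_bounded[OF Z], of S]] by simp
  have "emeasure \<nu> (f ` C) * emeasure lborel (cball (0::'b) 1) = emeasure \<nu> (cball 0 1) * emeasure lborel (f ` C)"
  proof (rule translation_invariant_measure_unique)
    show "sets \<nu> = sets borel" by (simp add: \<nu>_def)
    show "emeasure \<nu> (cball 0 r) < \<infinity>" for r
      by (subst \<nu>, simp, subst Wball, rule fin) simp
    show "f ` C \<in> sets borel"
      using C f(1) by (intro borel_compact compact_continuous_image linear_continuous_on) (auto simp: linear_linear)
    show "distr \<nu> borel ((+) c) = \<nu>" for c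
    proof (rule measure_eqI)
      obtain s where s: "s \<in> S" "f s = c" using f(3) by (metis UNIV_I imageE)
      fix D assume "D \<in> sets (distr \<nu> borel ((+) c))"
      then have [measurable]: "D \<in> sets borel" by simp
      have Ps: "?P (s + x) = s + ?P x" for x
        using s by (simp add: linear_add[OF linear_orthogonal_projection[OF S]] orthogonal_projection_ident[OF S])
      have "emeasure (distr \<nu> borel ((+) c)) D = emeasure \<nu> ((+) c -` D)"
        by (subst emeasure_distr) (auto simp: \<nu>_def)
      also have "\<dots> = emeasure lborel (W \<inter> {x. f (?P x) \<in> (+) c -` D})"
        by (rule \<nu>) (rule measurable_sets_borel[OF _ \<open>D \<in> sets borel\<close>], simp)
      also have "W \<inter> {x. f (?P x) \<in> (+) c -` D} = (+) s -` (W \<inter> {x. f (?P x) \<in> D})"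
        using s by (auto simp: W_def Ps linear_add[OF f(1)])
      also have "emeasure lborel \<dots> = emeasure (distr lborel borel ((+) s)) (W \<inter> {x. f (?P x) \<in> D})"
        by (subst emeasure_distr) auto
      also have "\<dots> = emeasure \<nu> D" by (simp add: lborel_distr_plus \<nu>)
      finally show "emeasure (distr \<nu> borel ((+) c)) D = emeasure \<nu> D" .
    qed (simp add: \<nu>_def)
  qed simp
  moreover have "f ` C \<in> sets borel"
    using C f(1) by (intro borel_compact compact_continuous_image linear_continuous_on) (auto simp: linear_linear)
  ultimately have "emeasure lborel (cylinder S C Z) * emeasure lborel (cball (0::'b) 1) =
      emeasure lborel (cylinder S (cball 0 1) Z) * emeasure lborel (f ` C)"
    using cyl[OF C(2)] Wball[of 1] by (simp add: \<nu>)
  then show ?thesis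
    by (simp add: measure_def enn2real_mult[symmetric])
qed

text \<open>By Fubini this is the volume of the part of \<open>Z\<close> orthogonal to
  \<open>S\<close>, times the volume of the unit ball of \<open>S\<close>. Keeping the second factor
  avoids coordinates on the complement.\<close>

definition relative_volume :: "'a::euclidean_space set \<Rightarrow> 'a set \<Rightarrow> real" where
  "relative_volume S Z = measure lborel (cylinder S (cball 0 1) Z)"

context
  fixes S :: "'a::euclidean_space set" and f :: "'a \<Rightarrow> 'b::euclidean_space"
  assumes S: "subspace S" and f: "linear f" "\<And>x. x \<in> S \<Longrightarrow> norm (f x) = norm x" "f ` S = UNIV"
begin

lemma DIM_le: "DIM('b) \<le> DIM('a)"
proof -
  have "DIM('b) = dim (f ` S)" by (simp add: f(3))
  also have "\<dots> \<le> dim S" by (rule dim_image_le[OF f(1)])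
  also have "\<dots> \<le> DIM('a)" by (rule dim_subset_UNIV)
  finally show ?thesis .
qed

lemma isometry_image_ball: "f ` (S \<inter> cball 0 r) = cball 0 r"
proof -
  have "y \<in> f ` (S \<inter> cball 0 r)" if "norm y \<le> r" for y
  proof -
    obtain x where "x \<in> S" "y = f x" using f(3) by (metis UNIV_I imageE)
    then show ?thesis using that f(2) by auto
  qed
  then show ?thesis using f(2) by auto
qed

text \<open>The cylinder with cross section r Z over the unit ball is r times the one with cross
  section Z over the ball of radius 1 / r: the dilation contributes \<open>r ^ DIM('a)\<close>, and
  the smaller base costs \<open>r ^ DIM('b)\<close>.\<close>

lemma relative_volume_scale:
  assumes Z: "compact Z" and r: "0 < r"
  shows "relative_volume S ((*\<^sub>R) r ` Z) = r ^ (DIM('a) - DIM('b)) * relative_volume S Z"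
proof -
  let ?P = "orthogonal_projection S"
  have lin: "linear ?P" by (rule linear_orthogonal_projection[OF S])
  have Pr: "?P (r *\<^sub>R x) = r *\<^sub>R ?P x" for r x using linear_scale[OF lin] .
  have ball: "cylinder S (cball 0 (1 / r)) Z = cylinder S (S \<inter> cball 0 (1 / r)) Z"
    using orthogonal_projection_in[OF S] by (auto simp: cylinder_def)
  have eq: "cylinder S (cball 0 1) ((*\<^sub>R) r ` Z) = (*\<^sub>R) r ` cylinder S (cball 0 (1 / r)) Z"
  proof (intro equalityI subsetI)
    fix x assume x: "x \<in> cylinder S (cball 0 1) ((*\<^sub>R) r ` Z)"
    then obtain z where z: "z \<in> Z" "x - ?P x = r *\<^sub>R z" by (auto simp: cylinder_def)
    have "(1 / r) *\<^sub>R x \<in> cylinder S (cball 0 (1 / r)) Z"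
    proof -
      have "(1 / r) *\<^sub>R x - ?P ((1 / r) *\<^sub>R x) = (1 / r) *\<^sub>R (x - ?P x)" by (simp only: Pr scaleR_diff_right)
      moreover have "norm (?P x) \<le> 1" using x by (simp add: cylinder_def)
      ultimately show ?thesis using r z by (simp add: cylinder_def Pr divide_right_mono)
    qed
    moreover have "x = r *\<^sub>R ((1 / r) *\<^sub>R x)" using r by simp
    ultimately show "x \<in> (*\<^sub>R) r ` cylinder S (cball 0 (1 / r)) Z" by blast
  next
    fix x assume "x \<in> (*\<^sub>R) r ` cylinder S (cball 0 (1 / r)) Z"
    then obtain y where y: "y \<in> cylinder S (cball 0 (1 / r)) Z" "x = r *\<^sub>R y" by blast
    have "x - ?P x = r *\<^sub>R (y - ?P y)" by (simp only: y(2) Pr scaleR_diff_right)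
    moreover have "norm (?P x) \<le> 1" using y r by (simp add: cylinder_def Pr field_simps)
    moreover have "r *\<^sub>R (y - ?P y) \<in> (*\<^sub>R) r ` Z" using y by (intro imageI) (simp add: cylinder_def)
    ultimately show "x \<in> cylinder S (cball 0 1) ((*\<^sub>R) r ` Z)"
      by (simp add: cylinder_def)
  qed
  have clo: "closed (cylinder S (cball 0 (1 / r)) Z)"
    by (intro closed_cylinder S closed_cball compact_imp_closed Z)
  have "relative_volume S ((*\<^sub>R) r ` Z) = r ^ DIM('a) * measure lborel (cylinder S (cball 0 (1 / r)) Z)"
    unfolding relative_volume_def eq using r clo closed_scaling[OF clo, of r]
    by (subst measure_scaleR_image) auto
  moreover have "measure lborel (cylinder S (cball 0 (1 / r)) Z) * measure lborel (cball (0::'b) 1) =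
      relative_volume S Z * measure lborel (f ` (S \<inter> cball 0 (1 / r)))"
    unfolding ball relative_volume_def
    by (rule measure_cylinder[OF S f _ _ Z]) (use closed_subspace[OF S] in auto)
  moreover have "measure lborel (f ` (S \<inter> cball 0 (1 / r))) = measure lborel (cball (0::'b) 1) / r ^ DIM('b)"
    unfolding isometry_image_ball using r by (simp add: content_cball power_divide)
  moreover have "measure lborel (cball (0::'b) 1) \<noteq> 0" using content_cball_pos[of 1 "0::'b"] by simp
  ultimately have "relative_volume S ((*\<^sub>R) r ` Z) = r ^ DIM('a) * (relative_volume S Z / r ^ DIM('b))"
    using r by (simp add: field_simps)
  also have "r ^ DIM('a) = r ^ (DIM('a) - DIM('b)) * r ^ DIM('b)"
    using DIM_le by (simp add: power_add[symmetric])
  finally show ?thesis using r by simp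
qed

lemma measure_cylinder_scaled:
  assumes C: "compact C" "C \<subseteq> S" and Z: "compact Z" and r: "0 < r"
  shows "measure lborel (cylinder S C ((*\<^sub>R) r ` Z)) * measure lborel (cball (0::'b) 1) =
    r ^ (DIM('a) - DIM('b)) * relative_volume S Z * measure lborel (f ` C)"
  using measure_cylinder[OF S f C compact_scaling[OF Z, of r]] relative_volume_scale[OF Z r]
  by (simp add: relative_volume_def)

text \<open>The body \<open>K + r Z\<close> is squeezed between the cylinders over the projection of \<open>K\<close> with
  cross sections \<open>(r - \<rho>) Z\<close> and \<open>(r + \<rho>) Z\<close>.\<close>

lemma volume_add_large_scaled:
  assumes K: "compact K" and Z: "compact Z" "convex Z" "\<And>z s. z \<in> Z \<Longrightarrow> s \<in> S \<Longrightarrow> z \<bullet> s = 0"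
    and \<rho>: "0 < \<rho>" "\<And>a. a \<in> K \<Longrightarrow> a - orthogonal_projection S a \<in> (*\<^sub>R) \<rho> ` Z"
      "\<And>a. a \<in> K \<Longrightarrow> - (a - orthogonal_projection S a) \<in> (*\<^sub>R) \<rho> ` Z"
  shows "((\<lambda>r. measure lborel (K + (*\<^sub>R) r ` Z) / r ^ (DIM('a) - DIM('b))) \<longlongrightarrow>
    relative_volume S Z * measure lborel (f ` orthogonal_projection S ` K) / measure lborel (cball (0::'b) 1)) at_top"
proof -
  let ?P = "orthogonal_projection S" and ?k = "DIM('a) - DIM('b)" and ?\<kappa> = "measure lborel (cball (0::'b) 1)"
  define L where "L = relative_volume S Z * measure lborel (f ` ?P ` K) / ?\<kappa>"
  have \<kappa>: "?\<kappa> > 0" by (simp add: content_cball_pos)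
  have lin: "linear ?P" by (rule linear_orthogonal_projection[OF S])
  have PK: "compact (?P ` K)" "?P ` K \<subseteq> S"
    using K orthogonal_projection_in[OF S] lin
    by (auto intro!: compact_continuous_image linear_continuous_on simp: linear_linear)
  have cyl: "measure lborel (cylinder S (?P ` K) ((*\<^sub>R) r ` Z)) = r ^ ?k * L" if "r > 0" for r
    using measure_cylinder_scaled[OF PK Z(1) that] \<kappa> by (simp add: L_def field_simps)
  have conv: "s *\<^sub>R y + t *\<^sub>R z \<in> (*\<^sub>R) (s + t) ` Z" if "0 < s" "0 < t" "y \<in> Z" "z \<in> Z" for s t y z
  proof -
    have "(s / (s + t)) *\<^sub>R y + (t / (s + t)) *\<^sub>R z \<in> Z"
      using that by (intro convexD[OF Z(2)]) (auto simp: add_divide_distrib[symmetric])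
    moreover have "s *\<^sub>R y + t *\<^sub>R z = (s + t) *\<^sub>R ((s / (s + t)) *\<^sub>R y + (t / (s + t)) *\<^sub>R z)"
      using that by (simp add: scaleR_add_right)
    ultimately show ?thesis by blast
  qed
  have comp: "compact (K + (*\<^sub>R) r ` Z)" for r
    using compact_set_sum[of "{True, False}" "\<lambda>b. if b then K else (*\<^sub>R) r ` Z"] K compact_scaling[OF Z(1)]
    by (simp add: add.commute)
  have mcyl: "cylinder S (?P ` K) ((*\<^sub>R) r ` Z) \<in> sets borel" "bounded (cylinder S (?P ` K) ((*\<^sub>R) r ` Z))" for r
    using closed_cylinder[OF S compact_imp_closed[OF PK(1)] compact_imp_closed[OF compact_scaling[OF Z(1)]]]
      bounded_cylinder[OF compact_imp_bounded[OF PK(1)] compact_imp_bounded[OF compact_scaling[OF Z(1)]]] by auto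
  have mono: "measure lborel A \<le> measure lborel B"
    if "A \<subseteq> B" "A \<in> sets borel" "B \<in> sets borel" "bounded B" for A B :: "'a set"
    using that emeasure_bounded_finite[OF that(4)] by (intro measure_mono_fmeasurable) (auto simp: fmeasurable_def)
  \<comment> \<open>A point of the thinner cylinder has the form a + (r - \<rho>) z - (a - P a),
    where P is the projection; the last term is absorbed by \<rho> Z, and \<open>conv\<close> puts
    the sum into r Z.\<close>
  have lower: "cylinder S (?P ` K) ((*\<^sub>R) (r - \<rho>) ` Z) \<subseteq> K + (*\<^sub>R) r ` Z" if "r > \<rho>" for r
  proof
    fix x assume "x \<in> cylinder S (?P ` K) ((*\<^sub>R) (r - \<rho>) ` Z)"
    then obtain a z where az: "a \<in> K" "?P x = ?P a" "z \<in> Z" "x - ?P x = (r - \<rho>) *\<^sub>R z"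
      by (auto simp: cylinder_def)
    obtain y where y: "y \<in> Z" "- (a - ?P a) = \<rho> *\<^sub>R y" using \<rho>(3)[OF az(1)] by auto
    have "x = a + ((r - \<rho>) *\<^sub>R z + \<rho> *\<^sub>R y)"
      using az(2) az(4)[symmetric] y(2)[symmetric] by simp
    moreover have "(r - \<rho>) *\<^sub>R z + \<rho> *\<^sub>R y \<in> (*\<^sub>R) (r - \<rho> + \<rho>) ` Z"
      using that \<rho>(1) by (intro conv az y) auto
    ultimately show "x \<in> K + (*\<^sub>R) r ` Z" using az(1) by (auto intro: set_plus_intro)
  qed
  \<comment> \<open>Adding a point of r Z does not move the projection, and the deviation of
    \<open>a\<close> from its projection costs another \<rho> Z.\<close>
  have upper: "K + (*\<^sub>R) r ` Z \<subseteq> cylinder S (?P ` K) ((*\<^sub>R) (r + \<rho>) ` Z)" if "r > 0" for r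
  proof
    fix x assume "x \<in> K + (*\<^sub>R) r ` Z"
    then obtain a z where az: "a \<in> K" "z \<in> Z" "x = a + r *\<^sub>R z" by (auto elim!: set_plus_elim)
    have "?P z = 0" using Z(3)[OF az(2)] by (intro orthogonal_projection_zero[OF S])
    moreover have "?P x = ?P a + r *\<^sub>R ?P z"
      unfolding az(3) linear_add[OF lin] linear_scale[OF lin] ..
    ultimately have Px: "?P x = ?P a" by simp
    obtain y where y: "y \<in> Z" "a - ?P a = \<rho> *\<^sub>R y" using \<rho>(2)[OF az(1)] by auto
    have "x - ?P x = r *\<^sub>R z + \<rho> *\<^sub>R y"
      unfolding Px y(2)[symmetric] unfolding az(3) by simp
    then have "x - ?P x \<in> (*\<^sub>R) (r + \<rho>) ` Z" using conv[OF that \<rho>(1) az(2) y(1)] by simp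
    then show "x \<in> cylinder S (?P ` K) ((*\<^sub>R) (r + \<rho>) ` Z)" using az(1) by (simp add: cylinder_def Px)
  qed
  have "((\<lambda>r. measure lborel (K + (*\<^sub>R) r ` Z) / r ^ ?k) \<longlongrightarrow> L) at_top"
  proof (rule tendsto_sandwich)
    show "\<forall>\<^sub>F r in at_top. (1 - \<rho> / r) ^ ?k * L \<le> measure lborel (K + (*\<^sub>R) r ` Z) / r ^ ?k"
      using eventually_gt_at_top[of \<rho>]
    proof eventually_elim
      case (elim r)
      have "(r - \<rho>) ^ ?k * L = measure lborel (cylinder S (?P ` K) ((*\<^sub>R) (r - \<rho>) ` Z))"
        using cyl[of "r - \<rho>"] elim by simp
      also have "\<dots> \<le> measure lborel (K + (*\<^sub>R) r ` Z)"
        using lower[OF elim] mcyl comp by (intro mono) (auto intro: borel_compact compact_imp_bounded)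
      finally have "(r - \<rho>) ^ ?k * L / r ^ ?k \<le> measure lborel (K + (*\<^sub>R) r ` Z) / r ^ ?k"
        using elim \<rho> by (intro divide_right_mono) auto
      moreover have "1 - \<rho> / r = (r - \<rho>) / r" using elim \<rho> by (simp add: diff_divide_distrib)
      ultimately show ?case by (simp add: power_divide)
    qed
    show "\<forall>\<^sub>F r in at_top. measure lborel (K + (*\<^sub>R) r ` Z) / r ^ ?k \<le> (1 + \<rho> / r) ^ ?k * L"
      using eventually_gt_at_top[of 0]
    proof eventually_elim
      case (elim r)
      have "measure lborel (K + (*\<^sub>R) r ` Z) \<le> measure lborel (cylinder S (?P ` K) ((*\<^sub>R) (r + \<rho>) ` Z))"
        using upper[OF elim] mcyl comp by (intro mono) (auto intro: borel_compact)
      also have "\<dots> = (r + \<rho>) ^ ?k * L"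
        using cyl[of "r + \<rho>"] elim \<rho> by simp
      finally have "measure lborel (K + (*\<^sub>R) r ` Z) / r ^ ?k \<le> (r + \<rho>) ^ ?k * L / r ^ ?k"
        using elim by (intro divide_right_mono) auto
      moreover have "1 + \<rho> / r = (r + \<rho>) / r" using elim by (simp add: add_divide_distrib)
      ultimately show ?case by (simp add: power_divide)
    qed
    have "((\<lambda>r. \<rho> / r) \<longlongrightarrow> 0) at_top"
      by (intro tendsto_divide_0[OF tendsto_const] filterlim_at_top_imp_at_infinity filterlim_ident)
    then have "((\<lambda>r. 1 - \<rho> / r) \<longlongrightarrow> 1 - 0) at_top" "((\<lambda>r. 1 + \<rho> / r) \<longlongrightarrow> 1 + 0) at_top"
      by (intro tendsto_intros; assumption)+
    note lim = this
    have "((\<lambda>r. (1 - \<rho> / r) ^ ?k * L) \<longlongrightarrow> (1 - 0) ^ ?k * L) at_top"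
      by (intro tendsto_mult tendsto_power tendsto_const lim(1))
    moreover have "((\<lambda>r. (1 + \<rho> / r) ^ ?k * L) \<longlongrightarrow> (1 + 0) ^ ?k * L) at_top"
      by (intro tendsto_mult tendsto_power tendsto_const lim(2))
    ultimately show "((\<lambda>r. (1 - \<rho> / r) ^ ?k * L) \<longlongrightarrow> L) at_top" "((\<lambda>r. (1 + \<rho> / r) ^ ?k * L) \<longlongrightarrow> L) at_top"
      by simp_all
  qed
  then show ?thesis by (simp add: L_def)
qed

end

section \<open>Zonotopes of independent vectors\<close>

definition independent_family :: "nat \<Rightarrow> (nat \<Rightarrow> 'a::euclidean_space) \<Rightarrow> bool" where
  "independent_family k u \<longleftrightarrow> (\<forall>j<k. u j \<notin> span (u ` {..<j}))"

lemma independent_family: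
  assumes "independent_family k u"
  shows "inj_on u {..<k}" "independent (u ` {..<k})"
proof -
  have "inj_on u {..<k} \<and> independent (u ` {..<k})"
    using assms
  proof (induction k)
    case (Suc k)
    then have "independent_family k u" "u k \<notin> span (u ` {..<k})" by (auto simp: independent_family_def)
    moreover from this(2) have "u k \<notin> u ` {..<k}" by (meson span_base)
    ultimately show ?case
      using Suc.IH by (simp add: lessThan_Suc independent_insert)
  qed (simp add: independent_empty)
  then show "inj_on u {..<k}" "independent (u ` {..<k})" by auto
qed

definition zonotope :: "nat \<Rightarrow> (nat \<Rightarrow> 'a::euclidean_space) \<Rightarrow> 'a set" where
  "zonotope k u = (\<Sum>j<k. closed_segment (- u j) (u j))"

lemma mem_zonotope: "a \<in> zonotope k u \<longleftrightarrow> (\<exists>s. (\<forall>j<k. \<bar>s j\<bar> \<le> 1) \<and> a = (\<Sum>j<k. s j *\<^sub>R u j))"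
proof
  assume "a \<in> zonotope k u"
  then obtain z where z: "\<And>j. j < k \<Longrightarrow> z j \<in> closed_segment (- u j) (u j)" "a = sum z {..<k}"
    by (auto simp: zonotope_def set_sum_alt)
  then obtain s where s: "\<And>j. j < k \<Longrightarrow> \<bar>s j\<bar> \<le> 1 \<and> z j = s j *\<^sub>R u j"
    unfolding mem_symmetric_segment by metis
  then have "a = (\<Sum>j<k. s j *\<^sub>R u j)" unfolding z(2) by (intro sum.cong) auto
  then show "\<exists>s. (\<forall>j<k. \<bar>s j\<bar> \<le> 1) \<and> a = (\<Sum>j<k. s j *\<^sub>R u j)" using s by blast
next
  assume "\<exists>s. (\<forall>j<k. \<bar>s j\<bar> \<le> 1) \<and> a = (\<Sum>j<k. s j *\<^sub>R u j)"
  then obtain s where s: "\<And>j. j < k \<Longrightarrow> \<bar>s j\<bar> \<le> 1" "a = (\<Sum>j<k. s j *\<^sub>R u j)" by blast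
  then show "a \<in> zonotope k u"
    unfolding zonotope_def set_sum_alt[OF finite_lessThan]
    by (intro CollectI exI[of _ "\<lambda>j. s j *\<^sub>R u j"]) (auto simp: mem_symmetric_segment)
qed

lemma convex_body_zonotope: "convex_body (zonotope k u)"
  unfolding zonotope_def by (intro convex_body_sum) (auto simp: convex_body_def)

lemma set_sum_linear_image:
  assumes "linear f" "finite I"
  shows "f ` (\<Sum>i\<in>I. K i) = (\<Sum>i\<in>I. f ` K i)"
  using assms(2)
proof (induction I rule: finite_induct)
  case empty
  then show ?case by (simp add: set_zero linear_0[OF assms(1)])
next
  case (insert i I)
  have "f ` (A + B) = f ` A + f ` B" for A B
    unfolding set_plus_image image_image by (force simp: linear_add[OF assms(1)] image_iff)
  then show ?case using insert by simp
qed

lemma scaled_zonotope: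
  "(*\<^sub>R) r ` zonotope k u = (\<Sum>j<k. (*\<^sub>R) r ` closed_segment (- u j) (u j))"
  unfolding zonotope_def by (intro set_sum_linear_image linear_scaleR finite_lessThan)

text \<open>Coordinates with respect to an independent family are linear functionals, hence bounded
  on bounded sets; dividing by a common bound brings all of them into [-1, 1].\<close>

lemma zonotope_absorbs:
  fixes u :: "nat \<Rightarrow> 'a::euclidean_space"
  assumes "independent_family k u"
  obtains \<rho> where "0 < \<rho>" "\<And>y. y \<in> span (u ` {..<k}) \<Longrightarrow> norm y \<le> R \<Longrightarrow> y \<in> (*\<^sub>R) \<rho> ` zonotope k u"
proof -
  note ind = independent_family[OF assms]
  have "\<forall>j. \<exists>g. linear g \<and> (\<forall>x\<in>u ` {..<k}. g x = (if x = u j then 1 else 0 :: real))"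
  proof
    fix j
    show "\<exists>g. linear g \<and> (\<forall>x\<in>u ` {..<k}. g x = (if x = u j then 1 else 0 :: real))"
      by (rule linear_independent_extend[OF ind(2)])
  qed
  from choice[OF this] obtain g where
    g': "\<forall>j. linear (g j) \<and> (\<forall>x\<in>u ` {..<k}. g j x = (if x = u j then 1 else 0 :: real))" ..
  have g: "\<And>j. linear (g j)" "\<And>i j. i < k \<Longrightarrow> g j (u i) = (if u i = u j then 1 else 0 :: real)"
    using g' by auto
  have "\<forall>j. \<exists>b>0. \<forall>x. norm (g j x) \<le> b * norm x"
  proof
    fix j
    obtain b where "b > 0" "\<And>x. norm (g j x) \<le> b * norm x" 
      by (rule linear_bounded_pos[OF g(1)[of j]]) (rule that)
    then show "\<exists>b>0. \<forall>x. norm (g j x) \<le> b * norm x" by blast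
  qed
  from choice[OF this] obtain B where B': "\<forall>j. 0 < B j \<and> (\<forall>x. norm (g j x) \<le> B j * norm x)" ..
  have B: "\<And>j x. norm (g j x) \<le> B j * norm x" "\<And>j. 0 < B j" using B' by auto
  \<comment> \<open>The sum dominates each coordinate bound; the summand 1 keeps
    \<open>\<rho>\<close> positive when \<open>k = 0\<close>, and \<open>\<bar>R\<bar>\<close>
    allows for any sign of \<open>R\<close>.\<close>
  define \<rho> where "\<rho> = 1 + (\<Sum>j<k. B j * \<bar>R\<bar>)"
  have pos: "0 < \<rho>" unfolding \<rho>_def using B(2) by (intro add_pos_nonneg sum_nonneg) (auto simp: less_imp_le)
  have "y \<in> (*\<^sub>R) \<rho> ` zonotope k u" if y: "y \<in> span (u ` {..<k})" "norm y \<le> R" for y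
  proof -
    have "y = (\<Sum>j<k. g j y *\<^sub>R u j)"
    proof (rule linear_eq_on[OF linear_id _ y(1), unfolded id_def])
      show "linear (\<lambda>y. \<Sum>j<k. g j y *\<^sub>R u j)"
        by (intro linearI)
           (simp_all add: linear_add[OF g(1)] linear_scale[OF g(1)] scaleR_add_left sum.distrib scaleR_sum_right)
      fix b assume "b \<in> u ` {..<k}"
      then obtain i where i: "i < k" "b = u i" by auto
      have "(\<Sum>j<k. g j b *\<^sub>R u j) = (\<Sum>j<k. if j = i then u j else 0)"
        using i g(2) ind(1) by (intro sum.cong) (auto simp: inj_on_def)
      then show "b = (\<Sum>j<k. g j b *\<^sub>R u j)" using i by simp
    qed
    also have "\<dots> = \<rho> *\<^sub>R (\<Sum>j<k. (g j y / \<rho>) *\<^sub>R u j)"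
      using pos by (simp add: scaleR_sum_right)
    also have "\<dots> \<in> (*\<^sub>R) \<rho> ` zonotope k u"
    proof (intro imageI)
      have "\<bar>g j y\<bar> \<le> \<rho>" if "j < k" for j
      proof -
        have "\<bar>g j y\<bar> \<le> B j * norm y" using B(1)[of j y] by simp
        also have "\<dots> \<le> B j * \<bar>R\<bar>" using y(2) B(2)[of j] by (intro mult_left_mono) auto
        also have "\<dots> \<le> (\<Sum>j<k. B j * \<bar>R\<bar>)"
          using that B(2) by (intro member_le_sum) (auto simp: less_imp_le)
        finally show ?thesis by (simp add: \<rho>_def)
      qed
      then show "(\<Sum>j<k. (g j y / \<rho>) *\<^sub>R u j) \<in> zonotope k u"
        unfolding mem_zonotope using pos by (intro exI[of _ "\<lambda>j. g j y / \<rho>"]) (auto simp: divide_le_eq)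
    qed
    finally show ?thesis .
  qed
  then show thesis using that pos by blast
qed

section \<open>Random orthonormal frames\<close>

text \<open>\<open>sgn\<close> normalises and sends a vanishing residual to 0, so the recursion
  makes sense, and is measurable, on all families; \<open>gs_regular\<close> singles out those on
  which no residual vanishes.\<close>

fun gram_schmidt :: "(nat \<Rightarrow> 'a::euclidean_space) \<Rightarrow> nat \<Rightarrow> 'a" where
  "gram_schmidt u j = sgn (u j - (\<Sum>i<j. (u j \<bullet> gram_schmidt u i) *\<^sub>R gram_schmidt u i))"

declare gram_schmidt.simps [simp del]

definition gs_residual :: "(nat \<Rightarrow> 'a::euclidean_space) \<Rightarrow> nat \<Rightarrow> 'a" where
  "gs_residual u j = u j - (\<Sum>i<j. (u j \<bullet> gram_schmidt u i) *\<^sub>R gram_schmidt u i)"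

lemma gram_schmidt_eq: "gram_schmidt u j = sgn (gs_residual u j)"
  by (subst gram_schmidt.simps) (simp add: gs_residual_def)

definition gs_regular :: "nat \<Rightarrow> (nat \<Rightarrow> 'a::euclidean_space) \<Rightarrow> bool" where
  "gs_regular k u \<longleftrightarrow> (\<forall>j<k. gs_residual u j \<noteq> 0)"

lemma gram_schmidt_cong: "(\<And>i. i \<le> j \<Longrightarrow> u i = v i) \<Longrightarrow> gram_schmidt u j = gram_schmidt v j"
proof (induction j rule: less_induct)
  case (less j)
  have "(\<Sum>i<j. (u j \<bullet> gram_schmidt u i) *\<^sub>R gram_schmidt u i) = (\<Sum>i<j. (v j \<bullet> gram_schmidt v i) *\<^sub>R gram_schmidt v i)"
  proof (rule sum.cong)
    fix i assume "i \<in> {..<j}"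
    then have "gram_schmidt u i = gram_schmidt v i" using less.prems by (intro less.IH) auto
    then show "(u j \<bullet> gram_schmidt u i) *\<^sub>R gram_schmidt u i = (v j \<bullet> gram_schmidt v i) *\<^sub>R gram_schmidt v i"
      using less.prems[of j] by simp
  qed simp
  then show ?case
    unfolding gram_schmidt_eq[of _ j] gs_residual_def[of _ j] using less.prems[of j] by simp
qed

lemma gs_residual_cong:
  assumes "\<And>i. i \<le> j \<Longrightarrow> u i = v i"
  shows "gs_residual u j = gs_residual v j"
proof -
  have "gram_schmidt u i = gram_schmidt v i" if "i < j" for i
    using assms that by (intro gram_schmidt_cong) auto
  then show ?thesis unfolding gs_residual_def using assms[of j] by simp
qed

text \<open>The recursion uses only inner products and linear combinations of the given vectors.
  This equivariance is the source of the rotation invariance of the random frames.\<close>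

lemma gram_schmidt_orthogonal_transformation:
  assumes h: "orthogonal_transformation h"
  shows "gram_schmidt (\<lambda>j. h (u j)) j = h (gram_schmidt u j)"
proof (induction j rule: less_induct)
  case (less j)
  have lin: "linear h" using h by (rule orthogonal_transformation_linear)
  have "h (u j) - (\<Sum>i<j. (h (u j) \<bullet> gram_schmidt (\<lambda>j. h (u j)) i) *\<^sub>R gram_schmidt (\<lambda>j. h (u j)) i) =
      h (gs_residual u j)"
    using less h
    by (simp add: gs_residual_def linear_diff[OF lin] linear_sum[OF lin] linear_scale[OF lin] orthogonal_transformation_def)
  then show ?case
    unfolding gram_schmidt_eq[of _ j] gs_residual_def[of "\<lambda>j. h (u j)"]
    using h by (simp add: sgn_div_norm linear_scale[OF lin] orthogonal_transformation_norm)
qed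

lemma gram_schmidt_orthonormal:
  assumes "gs_regular k u" "i < k" "j < k"
  shows "gram_schmidt u i \<bullet> gram_schmidt u j = (if i = j then 1 else 0)"
proof -
  have norm: "gram_schmidt u i \<bullet> gram_schmidt u i = 1" if "i < k" for i
    using that assms(1) by (simp add: gram_schmidt_eq dot_square_norm norm_sgn gs_regular_def)
  have orth: "\<forall>i<j. gram_schmidt u j \<bullet> gram_schmidt u i = 0" if "j < k" for j
    using that
  proof (induction j rule: less_induct)
    case (less j)
    note IH = less.IH
    have "gs_residual u j \<bullet> gram_schmidt u i = 0" if "i < j" for i
    proof -
      have "(\<Sum>l<j. (u j \<bullet> gram_schmidt u l) * (gram_schmidt u l \<bullet> gram_schmidt u i)) =
          (\<Sum>l<j. if l = i then u j \<bullet> gram_schmidt u i else 0)"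
      proof (rule sum.cong)
        fix l assume l: "l \<in> {..<j}"
        have "gram_schmidt u l \<bullet> gram_schmidt u i = 0" if "l < i"
          using IH[of i] \<open>i < j\<close> \<open>j < k\<close> that inner_commute[of "gram_schmidt u l"] by auto
        moreover have "gram_schmidt u l \<bullet> gram_schmidt u i = 0" if "i < l"
          using IH[of l] l \<open>j < k\<close> that by auto
        moreover have "gram_schmidt u i \<bullet> gram_schmidt u i = 1"
          using norm[of i] that \<open>j < k\<close> by simp
        ultimately show "(u j \<bullet> gram_schmidt u l) * (gram_schmidt u l \<bullet> gram_schmidt u i) = (if l = i then u j \<bullet> gram_schmidt u i else 0)"
          by (cases l i rule: linorder_cases) auto
      qed simp
      also have "\<dots> = u j \<bullet> gram_schmidt u i" using that by simp
      finally show ?thesis by (simp add: gs_residual_def inner_diff_left inner_sum_left)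
    qed
    then show ?case by (simp add: gram_schmidt_eq[of u j] sgn_div_norm)
  qed
  show ?thesis
  proof (cases i j rule: linorder_cases)
    case less
    then show ?thesis using orth[of j] assms by (simp add: inner_commute)
  next
    case equal
    then show ?thesis using norm assms by simp
  next
    case greater
    then show ?thesis using orth[of i] assms by simp
  qed
qed

lemma span_gram_schmidt:
  assumes "gs_regular k u"
  shows "span (gram_schmidt u ` {..<k}) = span (u ` {..<k})"
proof (rule span_eq[THEN iffD2, OF conjI])
  have gs: "gram_schmidt u j \<in> span (u ` {..j})" for j
  proof (induction j rule: less_induct)
    case (less j)
    have "gram_schmidt u i \<in> span (u ` {..j})" if "i < j" for i
      using less[OF that] span_mono[of "u ` {..i}" "u ` {..j}"] that by fastforce
    then have "gs_residual u j \<in> span (u ` {..j})"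
      unfolding gs_residual_def by (intro span_diff span_sum span_scale) (auto intro: span_base)
    then show ?case by (simp add: gram_schmidt_eq sgn_div_norm span_scale)
  qed
  show "gram_schmidt u ` {..<k} \<subseteq> span (u ` {..<k})"
  proof (rule image_subsetI)
    fix j assume "j \<in> {..<k}"
    then have "span (u ` {..j}) \<subseteq> span (u ` {..<k})" by (intro span_mono image_mono) auto
    then show "gram_schmidt u j \<in> span (u ` {..<k})" using gs by blast
  qed
  show "u ` {..<k} \<subseteq> span (gram_schmidt u ` {..<k})"
  proof (rule image_subsetI)
    fix j assume j: "j \<in> {..<k}"
    have "u j = norm (gs_residual u j) *\<^sub>R gram_schmidt u j + (\<Sum>i<j. (u j \<bullet> gram_schmidt u i) *\<^sub>R gram_schmidt u i)"
      using assms j by (simp add: gram_schmidt_eq[of u j] sgn_div_norm gs_regular_def) (simp add: gs_residual_def)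
    also have "\<dots> \<in> span (gram_schmidt u ` {..<k})"
      using j by (intro span_add span_scale span_sum span_base) auto
    finally show "u j \<in> span (gram_schmidt u ` {..<k})" .
  qed
qed

lemma span_gram_schmidt_expansion:
  assumes "gs_regular k u" "x \<in> span (gram_schmidt u ` {..<k})"
  shows "x = (\<Sum>i<k. (x \<bullet> gram_schmidt u i) *\<^sub>R gram_schmidt u i)"
proof (rule linear_eq_on[OF linear_id _ assms(2), unfolded id_def])
  show "linear (\<lambda>x. \<Sum>i<k. (x \<bullet> gram_schmidt u i) *\<^sub>R gram_schmidt u i)"
    by (intro linearI) (simp_all add: inner_add_left scaleR_add_left sum.distrib scaleR_sum_right)
  fix b assume "b \<in> gram_schmidt u ` {..<k}"
  then obtain j where j: "j < k" "b = gram_schmidt u j" by auto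
  have "(\<Sum>i<k. (b \<bullet> gram_schmidt u i) *\<^sub>R gram_schmidt u i) = (\<Sum>i<k. if i = j then gram_schmidt u i else 0)"
    using j gram_schmidt_orthonormal[OF assms(1)] by (intro sum.cong) auto
  then show "b = (\<Sum>i<k. (b \<bullet> gram_schmidt u i) *\<^sub>R gram_schmidt u i)" using j by simp
qed

lemma gs_regular_independent:
  assumes "gs_regular k u"
  shows "independent_family k u"
  unfolding independent_family_def
proof (intro allI impI notI)
  fix j assume j: "j < k" "u j \<in> span (u ` {..<j})"
  have reg: "gs_regular j u" using assms j by (simp add: gs_regular_def)
  have "u j = (\<Sum>i<j. (u j \<bullet> gram_schmidt u i) *\<^sub>R gram_schmidt u i)"
    using j(2) unfolding span_gram_schmidt[OF reg, symmetric] by (rule span_gram_schmidt_expansion[OF reg])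
  then have "gs_residual u j = 0" by (simp add: gs_residual_def)
  then show False using assms j by (simp add: gs_regular_def)
qed

section \<open>Independent points of the ball\<close>

abbreviation ball_family :: "nat \<Rightarrow> (nat \<Rightarrow> 'a::euclidean_space) measure" where
  "ball_family k \<equiv> Pi\<^sub>M {..<k} (\<lambda>_. ball_measure)"

lemma prob_space_ball_family: "prob_space (ball_family k)"
  by (intro prob_space_PiM prob_space_ball_measure)

lemma measurable_ball_family_component:
  "j < k \<Longrightarrow> (\<lambda>u. u j) \<in> borel_measurable (ball_family k)"
  using measurable_component_singleton[of j "{..<k}" "\<lambda>_. ball_measure"]
  by (simp add: measurable_cong_sets[OF refl sets_ball_measure])

lemma measurable_gram_schmidt:
  "j < k \<Longrightarrow> (\<lambda>u. gram_schmidt u j) \<in> borel_measurable (ball_family k :: (nat \<Rightarrow> 'a::euclidean_space) measure)"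
proof (induction j rule: less_induct)
  case (less j)
  have 1: "(\<lambda>u. gram_schmidt u i) \<in> borel_measurable (ball_family k :: (nat \<Rightarrow> 'a) measure)" if "i < j" for i
    using less that by simp
  have 2: "(\<lambda>u. u j) \<in> borel_measurable (ball_family k :: (nat \<Rightarrow> 'a) measure)"
    using less.prems by (rule measurable_ball_family_component)
  have [measurable]: "(\<lambda>u. gs_residual u j) \<in> borel_measurable (ball_family k :: (nat \<Rightarrow> 'a) measure)"
    unfolding gs_residual_def
    by (intro borel_measurable_scaleR borel_measurable_diff borel_measurable_sum borel_measurable_inner 1 2) auto
  show ?case unfolding gram_schmidt_eq sgn_div_norm by measurable
qed

lemma measurable_gs_residual:
  assumes "j < k"
  shows "(\<lambda>u. gs_residual u j) \<in> borel_measurable (ball_family k)"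
  unfolding gs_residual_def using assms
  by (intro borel_measurable_scaleR borel_measurable_diff borel_measurable_sum borel_measurable_inner
      measurable_gram_schmidt measurable_ball_family_component) auto

lemma AE_ball_measure_not_in_subspace:
  fixes V :: "'a::euclidean_space set"
  assumes "dim V < DIM('a)"
  shows "AE y in ball_measure. y \<notin> span V"
proof -
  obtain a where a: "a \<noteq> 0" "span V \<subseteq> {x. a \<bullet> x = 0}"
    using lowdim_subset_hyperplane[OF assms] by blast
  from AE_ball_measure_inner_nonzero[OF a(1)] show ?thesis
    by eventually_elim (use a(2) in \<open>auto simp: inner_commute\<close>)
qed

text \<open>Given the earlier points, the next residual vanishes only if the new point lies in the
  span of their frame, a proper subspace and hence a null set. Fubini in the last coordinate
  concludes, which is why the exceptional set is first shown to be measurable.\<close>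

lemma AE_gs_regular:
  assumes "k \<le> DIM('a::euclidean_space)"
  shows "AE u in (ball_family k :: (nat \<Rightarrow> 'a) measure). gs_regular k u"
  using assms
proof (induction k)
  case 0
  then show ?case by (simp add: gs_regular_def)
next
  case (Suc k)
  interpret B: prob_space "ball_measure :: 'a measure" by (rule prob_space_ball_measure)
  interpret product_sigma_finite "\<lambda>_::nat. ball_measure :: 'a measure" by standard
  have meas: "{u \<in> space (ball_family (Suc k)). gs_regular (Suc k) u} \<in> sets (ball_family (Suc k) :: (nat \<Rightarrow> 'a) measure)"
  proof -
    have "{u \<in> space (ball_family (Suc k)). \<forall>j\<in>{..<Suc k}. gs_residual u j \<noteq> 0} \<in> sets (ball_family (Suc k) :: (nat \<Rightarrow> 'a) measure)"
    proof (rule sets.sets_Collect_finite_All)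
      fix j assume "j \<in> {..<Suc k}"
      then have [measurable]: "(\<lambda>u. gs_residual u j) \<in> borel_measurable (ball_family (Suc k) :: (nat \<Rightarrow> 'a) measure)"
        by (intro measurable_gs_residual) auto
      show "{u \<in> space (ball_family (Suc k)). gs_residual u j \<noteq> 0} \<in> sets (ball_family (Suc k) :: (nat \<Rightarrow> 'a) measure)"
        by measurable
    qed simp
    moreover have "gs_regular (Suc k) u \<longleftrightarrow> (\<forall>j\<in>{..<Suc k}. gs_residual u j \<noteq> 0)" for u :: "nat \<Rightarrow> 'a"
      by (auto simp: gs_regular_def)
    ultimately show ?thesis by simp
  qed
  define E where "E = {u \<in> space (ball_family (Suc k) :: (nat \<Rightarrow> 'a) measure). \<not> gs_regular (Suc k) u}"
  have bad: "E \<in> sets (ball_family (Suc k) :: (nat \<Rightarrow> 'a) measure)"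
    unfolding E_def using sets.sets_Collect_neg[OF meas] .
  have "AE x in (ball_family k :: (nat \<Rightarrow> 'a) measure).
      (\<integral>\<^sup>+y. indicator E (x(k := y)) \<partial>ball_measure) = 0"
    using Suc.IH[OF Suc_leD[OF Suc.prems]] AE_space
  proof eventually_elim
    case (elim x)
    have "dim (gram_schmidt x ` {..<k}) \<le> card (gram_schmidt x ` {..<k})"
      by (intro dim_le_card') auto
    also have "\<dots> \<le> k" using card_image_le[of "{..<k}" "gram_schmidt x"] by simp
    finally have "dim (gram_schmidt x ` {..<k}) < DIM('a)" using Suc.prems by simp
    then have "AE y in ball_measure. y \<notin> span (gram_schmidt x ` {..<k})"
      by (rule AE_ball_measure_not_in_subspace)
    then have "AE y in ball_measure. indicator E (x(k := y)) = (0::ennreal)"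
    proof eventually_elim
      case (elim y)
      have g: "gram_schmidt (x(k := y)) i = gram_schmidt x i" if "i < k" for i
        using that by (intro gram_schmidt_cong) auto
      have r: "gs_residual (x(k := y)) j = gs_residual x j" if "j < k" for j
        using that by (intro gs_residual_cong) auto
      have "gs_residual (x(k := y)) k \<noteq> 0"
      proof
        assume "gs_residual (x(k := y)) k = 0"
        then have "y = (\<Sum>i<k. (y \<bullet> gram_schmidt x i) *\<^sub>R gram_schmidt x i)"
          by (simp add: gs_residual_def g)
        also have "\<dots> \<in> span (gram_schmidt x ` {..<k})" by (intro span_sum span_scale span_base) auto
        finally show False using elim by simp
      qed
      then have "gs_regular (Suc k) (x(k := y))"
        unfolding gs_regular_def
      proof (intro allI impI)
        fix j assume "j < Suc k"
        then consider "j < k" | "j = k" by linarith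
        then show "gs_residual (x(k := y)) j \<noteq> 0"
        proof cases
          case 1
          then have "gs_residual x j \<noteq> 0" using \<open>gs_regular k x\<close> by (simp add: gs_regular_def)
          then show ?thesis unfolding r[OF 1] .
        next
          case 2
          then show ?thesis using \<open>gs_residual (x(k := y)) k \<noteq> 0\<close> by blast
        qed
      qed
      then show ?case by (simp add: E_def)
    qed
    then have "(\<integral>\<^sup>+y. indicator E (x(k := y)) \<partial>ball_measure) = (\<integral>\<^sup>+y. 0 \<partial>(ball_measure :: 'a measure))"
      by (rule nn_integral_cong_AE)
    then show ?case by simp
  qed
  from nn_integral_cong_AE[OF this] have "(\<integral>\<^sup>+x. (\<integral>\<^sup>+y. indicator E (x(k := y)) \<partial>ball_measure)
      \<partial>(ball_family k :: (nat \<Rightarrow> 'a) measure)) = 0"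
    by simp
  moreover have "(\<integral>\<^sup>+x. (\<integral>\<^sup>+y. indicator E (x(k := y)) \<partial>ball_measure)
      \<partial>(ball_family k :: (nat \<Rightarrow> 'a) measure)) =
      (\<integral>\<^sup>+u. indicator E u \<partial>(ball_family (Suc k) :: (nat \<Rightarrow> 'a) measure))"
    unfolding lessThan_Suc
  proof (rule product_nn_integral_insert[symmetric])
    show "indicator E \<in> borel_measurable (Pi\<^sub>M (insert k {..<k}) (\<lambda>_. ball_measure))"
      using borel_measurable_indicator[OF bad] unfolding lessThan_Suc .
  qed simp_all
  ultimately have "emeasure (ball_family (Suc k)) E = 0"
    using nn_integral_indicator[OF bad] by simp
  then show ?case by (intro AE_I[OF _ _ bad]) (auto simp: E_def)
qed

text \<open>One coordinate at a time, by Fubini and the rotation invariance of the uniform law. The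
  restriction to \<open>{..<k}\<close> keeps the rotated family among the extensional functions that
  form the product space.\<close>

lemma nn_integral_ball_family_orthogonal:
  fixes F :: "(nat \<Rightarrow> 'a::euclidean_space) \<Rightarrow> ennreal" and h :: "'a \<Rightarrow> 'a"
  assumes h: "orthogonal_transformation h" and F: "F \<in> borel_measurable (ball_family k)"
  shows "(\<integral>\<^sup>+u. F (\<lambda>j\<in>{..<k}. h (u j)) \<partial>ball_family k) = (\<integral>\<^sup>+u. F u \<partial>ball_family k)"
  using F
proof (induction k arbitrary: F)
  case 0
  then show ?case by (simp add: PiM_empty nn_integral_count_space_finite)
next
  case (Suc k)
  interpret B: prob_space "ball_measure :: 'a measure" by (rule prob_space_ball_measure)
  interpret product_sigma_finite "\<lambda>_::nat. ball_measure :: 'a measure" by standard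
  have hm [measurable]: "h \<in> borel_measurable borel"
    using h by (intro borel_measurable_linear orthogonal_transformation_linear)
  have F' [measurable]: "F \<in> borel_measurable (Pi\<^sub>M (insert k {..<k}) (\<lambda>_. ball_measure))"
    using Suc.prems by (simp add: lessThan_Suc)
  have r: "(\<lambda>u. \<lambda>j\<in>{..<m}. h (u j)) \<in> measurable (ball_family m) (ball_family m)" for m
  proof (rule measurable_restrict)
    fix j assume "j \<in> {..<m}"
    then have "(\<lambda>u. h (u j)) \<in> borel_measurable (ball_family m)"
      by (intro measurable_compose[OF measurable_ball_family_component]) auto
    then show "(\<lambda>u. h (u j)) \<in> measurable (ball_family m) ball_measure"
      by (simp add: measurable_cong_sets[OF refl sets_ball_measure])
  qed
  have Fr: "(\<lambda>u. F (\<lambda>j\<in>{..<Suc k}. h (u j))) \<in> borel_measurable (ball_family (Suc k))"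
    by (rule measurable_compose[OF r Suc.prems])
  define G where "G x = (\<integral>\<^sup>+y. F (x(k := y)) \<partial>ball_measure)" for x
  have Gm: "G \<in> borel_measurable (ball_family k)"
    unfolding G_def[abs_def] by measurable
  have inner: "(\<integral>\<^sup>+y. F (\<lambda>j\<in>{..<Suc k}. h ((x(k := y)) j)) \<partial>ball_measure) = G (\<lambda>j\<in>{..<k}. h (x j))"
    if x: "x \<in> space (ball_family k)" for x
  proof -
    have "(\<lambda>j\<in>{..<Suc k}. h ((x(k := y)) j)) = (\<lambda>j\<in>{..<k}. h (x j))(k := h y)" for y
      by (auto simp: restrict_def fun_eq_iff less_Suc_eq)
    then have "(\<integral>\<^sup>+y. F (\<lambda>j\<in>{..<Suc k}. h ((x(k := y)) j)) \<partial>ball_measure) =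
        (\<integral>\<^sup>+y. F ((\<lambda>j\<in>{..<k}. h (x j))(k := h y)) \<partial>ball_measure)" by simp
    also have "\<dots> = (\<integral>\<^sup>+y. F ((\<lambda>j\<in>{..<k}. h (x j))(k := y)) \<partial>distr ball_measure borel h)"
    proof (rule nn_integral_distr[symmetric])
      have "(\<lambda>j\<in>{..<k}. h (x j)) \<in> space (ball_family k)" by (auto simp: space_PiM)
      then have "(\<lambda>y. F ((\<lambda>j\<in>{..<k}. h (x j))(k := y))) \<in> borel_measurable ball_measure"
        by (intro measurable_compose[OF measurable_component_update F']) auto
      then show "(\<lambda>y. F ((\<lambda>j\<in>{..<k}. h (x j))(k := y))) \<in> borel_measurable (distr ball_measure borel h)"
        by (simp add: measurable_cong_sets[OF sets_ball_measure refl])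
    qed (use hm in \<open>simp add: measurable_cong_sets[OF sets_ball_measure refl]\<close>)
    finally show ?thesis by (simp add: distr_ball_measure_orthogonal[OF h] G_def)
  qed
  have "(\<integral>\<^sup>+u. F (\<lambda>j\<in>{..<Suc k}. h (u j)) \<partial>ball_family (Suc k)) =
      (\<integral>\<^sup>+x. (\<integral>\<^sup>+y. F (\<lambda>j\<in>{..<Suc k}. h ((x(k := y)) j)) \<partial>ball_measure) \<partial>ball_family k)"
    using Fr unfolding lessThan_Suc[of k] by (intro product_nn_integral_insert) auto
  also have "\<dots> = (\<integral>\<^sup>+x. G (\<lambda>j\<in>{..<k}. h (x j)) \<partial>ball_family k)"
    by (rule nn_integral_cong) (rule inner)
  also have "\<dots> = (\<integral>\<^sup>+x. G x \<partial>ball_family k)" by (rule Suc.IH[OF Gm])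
  also have "\<dots> = (\<integral>\<^sup>+u. F u \<partial>ball_family (Suc k))"
    unfolding G_def lessThan_Suc[of k] by (rule product_nn_integral_insert[symmetric]) (use F' in auto)
  finally show ?case .
qed

section \<open>Random rotations\<close>

definition basis_enum :: "nat \<Rightarrow> 'a::euclidean_space" where
  "basis_enum = (SOME b. bij_betw b {..<DIM('a)} Basis)"

lemma bij_betw_basis_enum: "bij_betw (basis_enum :: nat \<Rightarrow> 'a::euclidean_space) {..<DIM('a)} Basis"
proof -
  obtain b :: "nat \<Rightarrow> 'a" where "bij_betw b {0..<card (Basis :: 'a set)} Basis"
    using ex_bij_betw_nat_finite[OF finite_Basis] by blast
  then have "\<exists>b. bij_betw b {..<DIM('a)} (Basis :: 'a set)"
    by (auto simp: atLeast0LessThan)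
  then show ?thesis unfolding basis_enum_def by (rule someI_ex)
qed

text \<open>For a regular family this is the rotation that carries the standard basis to the
  Gram--Schmidt frame, with inverse \<open>frame_adj\<close>. Applied to independent points of the
  ball it plays the part of a Haar distributed element of the orthogonal group, by formulas that are
  measurable in the points.\<close>

definition frame_map :: "(nat \<Rightarrow> 'a::euclidean_space) \<Rightarrow> 'a \<Rightarrow> 'a" where
  "frame_map X x = (\<Sum>j<DIM('a). (x \<bullet> basis_enum j) *\<^sub>R gram_schmidt X j)"

definition frame_adj :: "(nat \<Rightarrow> 'a::euclidean_space) \<Rightarrow> 'a \<Rightarrow> 'a" where
  "frame_adj X y = (\<Sum>j<DIM('a). (y \<bullet> gram_schmidt X j) *\<^sub>R basis_enum j)"

lemma linear_frame_map: "linear (frame_map X)"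
  unfolding frame_map_def
  by (intro linearI) (simp_all add: inner_add_left scaleR_add_left sum.distrib scaleR_sum_right)

lemma linear_frame_adj: "linear (frame_adj X)"
  unfolding frame_adj_def
  by (intro linearI) (simp_all add: inner_add_left scaleR_add_left sum.distrib scaleR_sum_right)

lemma sum_basis_enum: "(\<Sum>j<DIM('a). f (basis_enum j)) = (\<Sum>b\<in>(Basis :: 'a::euclidean_space set). f b)"
  by (rule sum.reindex_bij_betw[OF bij_betw_basis_enum])

lemma
  fixes X :: "nat \<Rightarrow> 'a::euclidean_space"
  assumes X: "gs_regular DIM('a) X"
  shows orthogonal_transformation_frame_map: "orthogonal_transformation (frame_map X)"
    and frame_adj_frame_map: "frame_adj X (frame_map X x) = x"
    and frame_map_frame_adj: "frame_map X (frame_adj X y) = y"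
proof -
  have gs: "frame_map X x \<bullet> gram_schmidt X j = x \<bullet> basis_enum j" if "j < DIM('a)" for x j
  proof -
    have "frame_map X x \<bullet> gram_schmidt X j = (\<Sum>i<DIM('a). if i = j then x \<bullet> basis_enum j else 0)"
      unfolding frame_map_def inner_sum_left
      using gram_schmidt_orthonormal[OF X] that by (intro sum.cong) auto
    then show ?thesis using that by simp
  qed
  have inner: "frame_map X x \<bullet> frame_map X y = x \<bullet> y" for x y
  proof -
    have "frame_map X x \<bullet> frame_map X y = (\<Sum>j<DIM('a). (y \<bullet> basis_enum j) * (x \<bullet> basis_enum j))"
      unfolding frame_map_def[of X y] inner_sum_right by (intro sum.cong) (auto simp: gs)
    also have "\<dots> = x \<bullet> y"
      using sum_basis_enum[of "\<lambda>b. (y \<bullet> b) * (x \<bullet> b)"] by (simp add: euclidean_inner[of x y] mult.commute)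
    finally show ?thesis .
  qed
  show orth: "orthogonal_transformation (frame_map X)"
    by (simp add: orthogonal_transformation_def linear_frame_map inner)
  have adj: "frame_adj X (frame_map X x) = x" for x
  proof -
    have "frame_adj X (frame_map X x) = (\<Sum>j<DIM('a). (x \<bullet> basis_enum j) *\<^sub>R basis_enum j)"
      unfolding frame_adj_def by (intro sum.cong) (auto simp: gs)
    also have "\<dots> = x"
      using sum_basis_enum[of "\<lambda>b. (x \<bullet> b) *\<^sub>R b"] by (simp add: euclidean_representation)
    finally show ?thesis .
  qed
  show "frame_adj X (frame_map X x) = x" by (rule adj)
  obtain x where "y = frame_map X x"
    using orthogonal_transformation_surj[OF orth] by (metis surjD)
  then show "frame_map X (frame_adj X y) = y" by (simp add: adj)
qed

lemma
  fixes h :: "'a::euclidean_space \<Rightarrow> 'a"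
  assumes h: "orthogonal_transformation h" and Y: "\<And>j. j < DIM('a) \<Longrightarrow> Y j = h (X j)"
  shows frame_map_orthogonal: "frame_map Y x = h (frame_map X x)"
    and frame_adj_orthogonal: "frame_adj Y (h y) = frame_adj X y"
proof -
  have gs: "gram_schmidt Y j = h (gram_schmidt X j)" if "j < DIM('a)" for j
  proof -
    have "gram_schmidt Y j = gram_schmidt (\<lambda>j. h (X j)) j" using that Y by (intro gram_schmidt_cong) auto
    then show ?thesis by (simp add: gram_schmidt_orthogonal_transformation[OF h])
  qed
  have lin: "linear h" using h by (rule orthogonal_transformation_linear)
  show "frame_map Y x = h (frame_map X x)"
    unfolding frame_map_def linear_sum[OF lin] by (intro sum.cong) (auto simp: gs linear_scale[OF lin])
  show "frame_adj Y (h y) = frame_adj X y"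
    unfolding frame_adj_def using h by (intro sum.cong) (auto simp: gs orthogonal_transformation_def)
qed

text \<open>A stand-in for the volume of the projection onto \<open>S\<close> that involves no identification of \<open>S\<close> with
  a coordinate space and depends measurably on the projection matrix.\<close>

definition shadow :: "'a::euclidean_space set \<Rightarrow> 'a set \<Rightarrow> ennreal" where
  "shadow S K = emeasure lborel (cylinder S (orthogonal_projection S ` K) (cball 0 1))"

lemma subspace_orthogonal_image:
  "orthogonal_transformation h \<Longrightarrow> subspace S \<Longrightarrow> subspace (h ` S)"
  by (intro linear_subspace_image orthogonal_transformation_linear)

lemma orthogonal_projection_orthogonal_image:
  fixes h :: "'a::euclidean_space \<Rightarrow> 'a"
  assumes h: "orthogonal_transformation h" and S: "subspace S"
  shows "orthogonal_projection (h ` S) (h x) = h (orthogonal_projection S x)"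
proof (rule orthogonal_projection_unique)
  show "subspace (h ` S)" by (rule subspace_orthogonal_image[OF h S])
  show "h (orthogonal_projection S x) \<in> h ` S" using orthogonal_projection_in[OF S] by blast
  fix z assume "z \<in> h ` S"
  then obtain s where s: "s \<in> S" "z = h s" by blast
  have "(h x - h (orthogonal_projection S x)) \<bullet> z = h (x - orthogonal_projection S x) \<bullet> h s"
    by (simp add: s linear_diff[OF orthogonal_transformation_linear[OF h]])
  also have "\<dots> = (x - orthogonal_projection S x) \<bullet> s" using h by (simp add: orthogonal_transformation_def)
  finally show "(h x - h (orthogonal_projection S x)) \<bullet> z = 0"
    using orthogonal_projection_orthogonal[OF S s(1)] by simp
qed

lemma emeasure_orthogonal_image:
  fixes h :: "'a::euclidean_space \<Rightarrow> 'a"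
  assumes h: "orthogonal_transformation h" and "h ` A \<in> sets borel"
  shows "emeasure lborel (h ` A) = emeasure lborel A"
  using assms
  by (intro emeasure_isometry_image)
     (auto simp: orthogonal_transformation_norm orthogonal_transformation_linear orthogonal_transformation_surj)

lemma compact_linear_image_euclidean:
  fixes f :: "'a::euclidean_space \<Rightarrow> 'b::real_normed_vector"
  shows "linear f \<Longrightarrow> compact K \<Longrightarrow> compact (f ` K)"
  by (intro compact_continuous_image linear_continuous_on) (simp_all add: linear_conv_bounded_linear)

lemma closed_shadow_cylinder:
  assumes S: "subspace (S :: 'a::euclidean_space set)" and K: "compact K"
  shows "closed (cylinder S (orthogonal_projection S ` K) (cball 0 1))"
  by (intro closed_cylinder S closed_cball compact_imp_closed compact_linear_image_euclidean linear_orthogonal_projection K)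

lemma shadow_orthogonal_image:
  fixes K :: "'a::euclidean_space set" and h :: "'a \<Rightarrow> 'a"
  assumes h: "orthogonal_transformation h" and S: "subspace S" and K: "compact K"
  shows "shadow (h ` S) (h ` K) = shadow S K"
proof -
  let ?P = "orthogonal_projection S" and ?P' = "orthogonal_projection (h ` S)"
  note lin = orthogonal_transformation_linear[OF h]
  note Ph = orthogonal_projection_orthogonal_image[OF h S]
  have inj: "inj h" using orthogonal_transformation_inj[OF h] .
  have "cylinder (h ` S) (?P' ` h ` K) (cball 0 1) = h ` cylinder S (?P ` K) (cball 0 1)"
  proof (intro equalityI subsetI)
    fix y assume y: "y \<in> cylinder (h ` S) (?P' ` h ` K) (cball 0 1)"
    obtain x where x: "y = h x" using orthogonal_transformation_surj[OF h] by (metis surjD)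
    from y obtain a where a: "a \<in> K" "h (?P x) = h (?P a)" "norm (h x - h (?P x)) \<le> 1"
      by (auto simp: cylinder_def x Ph)
    then have "?P x = ?P a" "norm (x - ?P x) \<le> 1"
      using inj by (auto simp: inj_eq linear_diff[OF lin, symmetric] orthogonal_transformation_norm[OF h])
    then show "y \<in> h ` cylinder S (?P ` K) (cball 0 1)"
      using a x by (auto simp: cylinder_def)
  next
    fix y assume "y \<in> h ` cylinder S (?P ` K) (cball 0 1)"
    then obtain x a where x: "y = h x" "a \<in> K" "?P x = ?P a" "norm (x - ?P x) \<le> 1"
      by (auto simp: cylinder_def)
    have "norm (h x - h (?P x)) \<le> 1"
      using x(4) by (simp add: linear_diff[OF lin, symmetric] orthogonal_transformation_norm[OF h])
    moreover have "h (?P x) \<in> ?P' ` h ` K"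
      using x(2,3) by (simp add: image_image Ph)
    ultimately show "y \<in> cylinder (h ` S) (?P' ` h ` K) (cball 0 1)"
      using x(1) by (simp add: cylinder_def Ph)
  qed
  note eq = this
  have "compact (h ` K)"
    by (rule compact_linear_image_euclidean[OF lin K])
  then have "closed (cylinder (h ` S) (?P' ` h ` K) (cball 0 1))"
    by (intro closed_shadow_cylinder subspace_orthogonal_image h S)
  then show ?thesis
    unfolding shadow_def eq by (intro emeasure_orthogonal_image h borel_closed)
qed

text \<open>\<open>shadow\<close> as a function of the projection matrix: this matrix generates the
  Borel sets of the Grassmannian, and rotations act on it by conjugation.\<close>

definition matrix_shadow :: "(real ^ 'n) set \<Rightarrow> real ^ 'n ^ 'n \<Rightarrow> ennreal" where
  "matrix_shadow K T = emeasure lborel {x. T *v x \<in> (*v) T ` K \<and> norm (x - T *v x) \<le> 1}"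

lemma borel_measurable_matrix_vector_mult [measurable (raw)]:
  fixes T :: "'w \<Rightarrow> real ^ 'n ^ 'm"
  assumes "T \<in> borel_measurable M" "x \<in> borel_measurable M"
  shows "(\<lambda>w. T w *v x w) \<in> borel_measurable M"
proof (rule borel_measurable_continuous_Pair[OF assms])
  show "continuous_on UNIV (\<lambda>p::(real ^ 'n ^ 'm) \<times> (real ^ 'n). fst p *v snd p)"
    unfolding matrix_vector_mult_def by (intro continuous_intros)
qed

text \<open>As \<open>K\<close> is compact, membership in its image can be tested by approximation
  from a countable dense subset. This exhibits a jointly measurable set of pairs of a matrix and a
  point, and the volumes of its sections depend measurably on the matrix.\<close>

lemma borel_measurable_matrix_shadow:
  fixes K :: "(real ^ 'n) set"
  assumes K: "compact K" "K \<noteq> {}"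
  shows "matrix_shadow K \<in> borel_measurable borel"
proof -
  obtain D where D: "countable D" "D \<subseteq> K" "K \<subseteq> closure D" using separable[of K] by blast
  have "D \<noteq> {}" using D K by auto
  define a where "a = from_nat_into D"
  have aK: "a i \<in> K" for i using from_nat_into[OF \<open>D \<noteq> {}\<close>] D by (auto simp: a_def)
  have dense: "K \<subseteq> closure (range a)" using D \<open>D \<noteq> {}\<close> by (simp add: a_def range_from_nat_into)
  have cont: "continuous_on A ((*v) T)" for A and T :: "real ^ 'n ^ 'n"
    by (intro linear_continuous_on) (simp add: matrix_vector_mul_bounded_linear)
  have char: "T *v x \<in> (*v) T ` K \<longleftrightarrow> (\<forall>m. \<exists>i. norm (T *v x - T *v a i) < 1 / real (Suc m))" for T :: "real ^ 'n ^ 'n" and x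
  proof
    assume "T *v x \<in> (*v) T ` K"
    then obtain c where c: "c \<in> K" "T *v x = T *v c" by auto
    have "T *v c \<in> closure ((*v) T ` range a)"
      using image_closure_subset[OF cont closed_closure closure_subset, of T "range a"] dense c by blast
    then have "\<exists>y\<in>(*v) T ` range a. dist y (T *v c) < 1 / real (Suc m)" for m
      unfolding closure_approachable by simp
    then show "\<forall>m. \<exists>i. norm (T *v x - T *v a i) < 1 / real (Suc m)"
      by (auto simp: c(2) dist_norm norm_minus_commute)
  next
    assume lhs: "\<forall>m. \<exists>i. norm (T *v x - T *v a i) < 1 / real (Suc m)"
    have "T *v x \<in> closure ((*v) T ` K)"
      unfolding closure_approachable
    proof (intro allI impI)
      fix e :: real assume "0 < e"
      then obtain m where "1 / real (Suc m) < e" using nat_approx_posE by blast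
      moreover obtain i where "norm (T *v x - T *v a i) < 1 / real (Suc m)" using lhs by blast
      ultimately have "dist (T *v a i) (T *v x) < e" by (simp add: dist_norm norm_minus_commute)
      then show "\<exists>y\<in>(*v) T ` K. dist y (T *v x) < e" using aK by blast
    qed
    moreover have "closed ((*v) T ` K)"
      by (intro compact_imp_closed compact_continuous_image cont K)
    ultimately show "T *v x \<in> (*v) T ` K" by simp
  qed
  define Q where "Q = {p :: (real ^ 'n ^ 'n) \<times> (real ^ 'n).
     (\<forall>m. \<exists>i. norm (fst p *v snd p - fst p *v a i) < 1 / real (Suc m)) \<and> norm (snd p - fst p *v snd p) \<le> 1}"
  have "{p \<in> space (borel \<Otimes>\<^sub>M lborel :: ((real ^ 'n ^ 'n) \<times> (real ^ 'n)) measure).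
     (\<forall>m. \<exists>i. norm (fst p *v snd p - fst p *v a i) < 1 / real (Suc m)) \<and> norm (snd p - fst p *v snd p) \<le> 1}
     \<in> sets (borel \<Otimes>\<^sub>M lborel)"
    by measurable
  then have Q: "Q \<in> sets (borel \<Otimes>\<^sub>M lborel)" by (simp add: Q_def space_pair_measure)
  have "matrix_shadow K T = emeasure lborel (Pair T -` Q)" for T
    unfolding matrix_shadow_def char Q_def by (rule arg_cong[where f = "emeasure lborel"]) auto
  then have "matrix_shadow K = (\<lambda>T. emeasure lborel (Pair T -` Q))" by (rule ext)
  then show ?thesis using lborel.measurable_emeasure_Pair[OF Q] by simp
qed

lemma borel_measurable_matrix:
  fixes L :: "'w \<Rightarrow> real ^ 'n \<Rightarrow> real ^ 'm"
  assumes "\<And>j. (\<lambda>w. L w (axis j 1)) \<in> borel_measurable M"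
  shows "(\<lambda>w. matrix (L w)) \<in> borel_measurable M"
proof (rule borel_measurable_euclidean_space[THEN iffD2], rule ballI)
  fix b :: "real ^ 'n ^ 'm" assume "b \<in> Basis"
  then obtain i j where b: "b = axis i (axis j 1)" by (auto simp: Basis_vec_def)
  have "matrix (L w) \<bullet> b = L w (axis j 1) \<bullet> axis i 1" for w
    by (simp add: b inner_axis matrix_def)
  then show "(\<lambda>w. matrix (L w) \<bullet> b) \<in> borel_measurable M"
    using assms[of j] by simp
qed

definition frame_conj :: "(nat \<Rightarrow> real ^ 'n) \<Rightarrow> real ^ 'n ^ 'n \<Rightarrow> real ^ 'n ^ 'n" where
  "frame_conj X A = matrix (\<lambda>x. frame_adj X (A *v frame_map X x))"

lemma frame_conj_mult_vec: "frame_conj X A *v x = frame_adj X (A *v frame_map X x)"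
proof -
  have "linear (\<lambda>x. frame_adj X (A *v frame_map X x))"
    using linear_compose[OF linear_compose[OF linear_frame_map matrix_vector_mul_linear] linear_frame_adj, of X A X]
    by (simp add: o_def)
  then show ?thesis unfolding frame_conj_def by (simp add: matrix_works)
qed

lemma borel_measurable_frame_conj:
  assumes A: "A \<in> borel_measurable M" and X: "X \<in> measurable M (ball_family CARD('n))"
  shows "(\<lambda>w. frame_conj (X w) (A w :: real ^ 'n ^ 'n)) \<in> borel_measurable M"
proof -
  have gs [measurable]: "(\<lambda>w. gram_schmidt (X w) j) \<in> borel_measurable M" if "j < CARD('n)" for j
    by (rule measurable_compose[OF X measurable_gram_schmidt[OF that]])
  show ?thesis
    unfolding frame_conj_def
  proof (rule borel_measurable_matrix)
    fix j :: 'n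
    have fm: "(\<lambda>w. frame_map (X w) (axis j 1)) \<in> borel_measurable M"
      unfolding frame_map_def by (intro borel_measurable_sum borel_measurable_scaleR gs) auto
    have "(\<lambda>w. A w *v frame_map (X w) (axis j 1)) \<in> borel_measurable M"
      by (intro borel_measurable_matrix_vector_mult A fm)
    then show "(\<lambda>w. frame_adj (X w) (A w *v frame_map (X w) (axis j 1))) \<in> borel_measurable M"
      unfolding frame_adj_def by (intro borel_measurable_sum borel_measurable_scaleR borel_measurable_inner gs) auto
  qed
qed

lemma matrix_orthogonal_projection_mult:
  "subspace S \<Longrightarrow> matrix (orthogonal_projection S) *v x = orthogonal_projection S (x :: real ^ 'n)"
  by (simp add: matrix_works linear_orthogonal_projection)

lemma matrix_shadow_orthogonal_projection:
  "subspace S \<Longrightarrow> matrix_shadow K (matrix (orthogonal_projection S)) = shadow S (K :: (real ^ 'n) set)"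
  by (simp add: matrix_shadow_def shadow_def cylinder_def matrix_orthogonal_projection_mult cong: image_cong)

text \<open>Conjugation rotates the subspace back; applying \<open>frame_map X\<close> to the whole
  picture preserves volumes and rotates the body instead.\<close>

lemma matrix_shadow_frame_conj:
  fixes K :: "(real ^ 'n) set"
  assumes X: "gs_regular CARD('n) X" and S: "subspace S" and K: "compact K"
  shows "matrix_shadow K (frame_conj X (matrix (orthogonal_projection S))) = shadow S (frame_map X ` K)"
proof -
  let ?P = "orthogonal_projection S" and ?Q = "frame_map X" and ?R = "frame_adj X"
  have X': "gs_regular DIM(real ^ 'n) X" using X by simp
  note orth = orthogonal_transformation_frame_map[OF X'] and RQ = frame_adj_frame_map[OF X'] and QR = frame_map_frame_adj[OF X']
  note lin = orthogonal_transformation_linear[OF orth]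
  have T: "frame_conj X (matrix ?P) *v x = ?R (?P (?Q x))" for x
    by (simp add: frame_conj_mult_vec matrix_orthogonal_projection_mult[OF S])
  have Rinj: "?R x = ?R y \<longleftrightarrow> x = y" for x y
  proof
    assume "?R x = ?R y"
    then have "?Q (?R x) = ?Q (?R y)" by simp
    then show "x = y" by (simp add: QR)
  qed simp
  have nrm: "norm (x - ?R (?P (?Q x))) = norm (?Q x - ?P (?Q x))" for x
  proof -
    have "norm (x - ?R (?P (?Q x))) = norm (?Q (x - ?R (?P (?Q x))))"
      by (simp add: orthogonal_transformation_norm[OF orth])
    then show ?thesis by (simp add: linear_diff[OF lin] QR)
  qed
  have eq: "cylinder S (?P ` ?Q ` K) (cball 0 1) =
     ?Q ` {x. frame_conj X (matrix ?P) *v x \<in> (*v) (frame_conj X (matrix ?P)) ` K \<and> norm (x - frame_conj X (matrix ?P) *v x) \<le> 1}"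
    (is "_ = ?Q ` ?A")
  proof (intro equalityI subsetI)
    fix y assume y: "y \<in> cylinder S (?P ` ?Q ` K) (cball 0 1)"
    have "?R y \<in> ?A" using y nrm[of "?R y"] by (auto simp: cylinder_def T QR image_iff Rinj)
    then show "y \<in> ?Q ` ?A" by (rule image_eqI[rotated]) (simp add: QR)
  next
    fix y assume "y \<in> ?Q ` ?A"
    then show "y \<in> cylinder S (?P ` ?Q ` K) (cball 0 1)"
      by (auto simp: cylinder_def T Rinj nrm)
  qed
  have "compact (?Q ` K)" by (rule compact_linear_image_euclidean[OF lin K])
  from closed_shadow_cylinder[OF S this] show ?thesis
    unfolding shadow_def matrix_shadow_def eq by (intro emeasure_orthogonal_image[symmetric] orth borel_closed)
qed

text \<open>The rotation of \<open>Y\<close> is that of \<open>X\<close> followed by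
  \<open>h\<close>, and projecting onto the rotated subspace is conjugate by \<open>h\<close> to
  projecting onto \<open>S\<close>; the occurrences of \<open>h\<close> cancel.\<close>

lemma frame_conj_orthogonal:
  fixes X :: "nat \<Rightarrow> real ^ 'n" and h :: "real ^ 'n \<Rightarrow> real ^ 'n"
  assumes h: "orthogonal_transformation h" and S: "subspace S" and Y: "\<And>j. j < CARD('n) \<Longrightarrow> Y j = h (X j)"
  shows "frame_conj Y (matrix (orthogonal_projection (h ` S))) = frame_conj X (matrix (orthogonal_projection S))"
proof -
  have Y': "\<And>j. j < DIM(real ^ 'n) \<Longrightarrow> Y j = h (X j)" using Y by simp
  have fm: "frame_map Y x = h (frame_map X x)" for x by (rule frame_map_orthogonal[OF h Y'])
  have fa: "frame_adj Y (h y) = frame_adj X y" for y by (rule frame_adj_orthogonal[OF h Y'])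
  show ?thesis
    unfolding frame_conj_def
    by (simp add: fm fa matrix_orthogonal_projection_mult[OF S]
        matrix_orthogonal_projection_mult[OF subspace_orthogonal_image[OF h S]]
        orthogonal_projection_orthogonal_image[OF h S])
qed

text \<open>Isometries of \<open>S\<close> onto \<open>T\<close> and between the orthogonal
  complements, whose dimensions also agree, are added along the orthogonal decomposition.\<close>

lemma orthogonal_transformation_between_subspaces:
  fixes S T :: "'a::euclidean_space set"
  assumes S: "subspace S" and T: "subspace T" and d: "dim S = dim T"
  obtains h :: "'a \<Rightarrow> 'a" where "orthogonal_transformation h" "h ` S = T"
proof -
  let ?c = "\<lambda>S. {y. \<forall>x\<in>S. orthogonal x (y::'a)}"
  have sub: "subspace (?c S)" for S by (rule subspace_orthogonal_to_vectors)
  have "dim (?c S) + dim S = DIM('a)" if "subspace S" for S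
    using dim_subspace_orthogonal_to_vectors[OF that subspace_UNIV] by simp
  from this[OF S] this[OF T] have dc: "dim (?c S) = dim (?c T)" using d by simp
  obtain f f' where f: "linear f" "linear f'" "f ` S = T" "f' ` T = S" "\<And>x. x \<in> S \<Longrightarrow> norm (f x) = norm x"
      "\<And>x. x \<in> T \<Longrightarrow> norm (f' x) = norm x" "\<And>x. x \<in> S \<Longrightarrow> f' (f x) = x" "\<And>x. x \<in> T \<Longrightarrow> f (f' x) = x"
    by (rule isometries_subspaces[OF S T d]) (rule that)
  obtain g g' where g: "linear g" "linear g'" "g ` ?c S = ?c T" "g' ` ?c T = ?c S" "\<And>x. x \<in> ?c S \<Longrightarrow> norm (g x) = norm x"
      "\<And>x. x \<in> ?c T \<Longrightarrow> norm (g' x) = norm x" "\<And>x. x \<in> ?c S \<Longrightarrow> g' (g x) = x" "\<And>x. x \<in> ?c T \<Longrightarrow> g (g' x) = x"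
    by (rule isometries_subspaces[OF sub sub dc]) (rule that)
  let ?P = "orthogonal_projection S"
  define h where "h x = f (?P x) + g (x - ?P x)" for x
  have P: "?P x \<in> S" "x - ?P x \<in> ?c S" for x
    using orthogonal_projection_in[OF S] orthogonal_projection_orthogonal[OF S]
    by (auto simp: orthogonal_def inner_commute)
  note linP = linear_orthogonal_projection[OF S]
  have lin: "linear h"
    unfolding h_def
    by (intro linearI)
       (simp_all add: linear_add[OF linP] linear_scale[OF linP] linear_add[OF f(1)] linear_scale[OF f(1)]
         linear_diff[OF g(1)] linear_add[OF g(1)] linear_scale[OF g(1)] algebra_simps)
  have "norm (h x) = norm x" for x
  proof -
    have "f (?P x) \<in> T" "g (x - ?P x) \<in> ?c T" using P[of x] f(3) g(3) by blast+
    then have "orthogonal (f (?P x)) (g (x - ?P x))" by simp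
    then have "(norm (h x))\<^sup>2 = (norm (f (?P x)))\<^sup>2 + (norm (g (x - ?P x)))\<^sup>2"
      unfolding h_def by (rule norm_add_Pythagorean)
    also have "\<dots> = (norm x)\<^sup>2"
      using f(5)[OF P(1)] g(5)[OF P(2)] orthogonal_projection_pythagoras[OF S, of x] by simp
    finally show ?thesis by (simp add: power2_eq_iff_nonneg)
  qed
  then have "orthogonal_transformation h" using lin by (simp add: orthogonal_transformation)
  moreover have "h ` S = T"
  proof -
    have "h x = f x" if "x \<in> S" for x
      using that by (simp add: h_def orthogonal_projection_ident[OF S] linear_0[OF g(1)])
    then have "h ` S = f ` S" by (rule image_cong[OF refl])
    then show ?thesis using f(3) by simp
  qed
  ultimately show thesis by (rule that)
qed

section \<open>Averages over random rotations and over the Grassmannian\<close>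

definition mean_shadow :: "(real ^ 'n) set \<Rightarrow> (real ^ 'n) set \<Rightarrow> ennreal" where
  "mean_shadow K S = (\<integral>\<^sup>+X. matrix_shadow K (frame_conj X (matrix (orthogonal_projection S))) \<partial>ball_family CARD('n))"

text \<open>Some rotation takes \<open>S\<close> to \<open>T\<close>; applying it to the random
  points as well preserves their law and makes the integrands equal.\<close>

lemma mean_shadow_cong:
  fixes K :: "(real ^ 'n) set"
  assumes K: "compact K" "K \<noteq> {}" and S: "subspace S" and T: "subspace T" and d: "dim S = dim T"
  shows "mean_shadow K S = mean_shadow K T"
proof -
  obtain h where h: "orthogonal_transformation h" "h ` S = T"
    using orthogonal_transformation_between_subspaces[OF S T d] .
  have meas: "(\<lambda>X. matrix_shadow K (frame_conj X (matrix (orthogonal_projection T)))) \<in> borel_measurable (ball_family CARD('n))"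
    by (intro measurable_compose[OF borel_measurable_frame_conj borel_measurable_matrix_shadow] K) auto
  have "mean_shadow K T =
      (\<integral>\<^sup>+X. matrix_shadow K (frame_conj (\<lambda>j\<in>{..<CARD('n)}. h (X j)) (matrix (orthogonal_projection T))) \<partial>ball_family CARD('n))"
    unfolding mean_shadow_def by (rule nn_integral_ball_family_orthogonal[OF h(1) meas, symmetric])
  also have "\<dots> = mean_shadow K S"
    unfolding mean_shadow_def h(2)[symmetric]
    by (intro nn_integral_cong arg_cong[of _ _ "matrix_shadow K"] frame_conj_orthogonal h S) simp
  finally show ?thesis by simp
qed

text \<open>The shadow of \<open>K\<close>, averaged over \<open>S\<close> and over an independent
  random rotation, is computed in both orders. For fixed \<open>S\<close> the result is
  \<open>mean_shadow K S\<close>, which depends on the dimension only; for a fixed rotation the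
  invariance of \<open>M\<close> removes the rotation from the body.\<close>

lemma invariant_grassmannian_mean_shadow:
  fixes K :: "(real ^ 'n) set" and M :: "(real ^ 'n) set measure"
  assumes M: "invariant_grassmannian_probability d M" and K: "compact K" "K \<noteq> {}"
    and T: "subspace T" "dim T = d"
  shows "(\<lambda>S. shadow S K) \<in> borel_measurable M"
    and "(\<integral>\<^sup>+S. shadow S K \<partial>M) = mean_shadow K T"
proof -
  interpret M: prob_space M using M by (simp add: invariant_grassmannian_probability_def)
  interpret N: prob_space "ball_family CARD('n) :: (nat \<Rightarrow> real ^ 'n) measure" by (rule prob_space_ball_family)
  interpret P: pair_sigma_finite M "ball_family CARD('n) :: (nat \<Rightarrow> real ^ 'n) measure" by standard
  have sets [measurable_cong]: "sets M = sets (grassmannian_borel d)"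
    and inv: "\<And>g :: real ^ 'n \<Rightarrow> real ^ 'n. orthogonal_transformation g \<Longrightarrow> distr M M (\<lambda>S. g ` S) = M"
    using M by (auto simp: invariant_grassmannian_probability_def)
  have space: "space M = grassmannian d"
    using sets_eq_imp_space_eq[OF sets] by (simp add: grassmannian_borel_def)
  have sub: "subspace S" if "S \<in> space M" for S using that by (simp add: space grassmannian_def)
  have proj [measurable]: "(\<lambda>S. matrix (orthogonal_projection S)) \<in> borel_measurable M"
    unfolding measurable_cong_sets[OF sets refl] grassmannian_borel_def by (rule measurable_vimage_algebra1) auto
  have meas: "(\<lambda>S. shadow S K') \<in> borel_measurable M" if "compact K'" "K' \<noteq> {}" for K'
  proof -
    have "(\<lambda>S. matrix_shadow K' (matrix (orthogonal_projection S))) \<in> borel_measurable M"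
      by (intro measurable_compose[OF proj borel_measurable_matrix_shadow] that)
    then show ?thesis
      by (rule measurable_cong[THEN iffD1, rotated]) (simp add: matrix_shadow_orthogonal_projection sub)
  qed
  show "(\<lambda>S. shadow S K) \<in> borel_measurable M" by (rule meas[OF K])
  have rot: "(\<integral>\<^sup>+S. shadow S (g ` K) \<partial>M) = (\<integral>\<^sup>+S. shadow S K \<partial>M)" if g: "orthogonal_transformation g" for g :: "real ^ 'n \<Rightarrow> real ^ 'n"
  proof -
    have lin: "linear g" using g by (rule orthogonal_transformation_linear)
    have cK: "compact (g ` K)"
      by (rule compact_linear_image_euclidean[OF lin K(1)])
    obtain g' where g': "orthogonal_transformation g'" "\<And>x. g' (g x) = x" "\<And>x. g (g' x) = x"
    proof (rule that[of "inv g"])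
      show "orthogonal_transformation (inv g)" by (rule orthogonal_transformation_inv[OF g])
      show "inv g (g x) = x" "g (inv g x) = x" for x
        using orthogonal_transformation_inj[OF g] orthogonal_transformation_surj[OF g] by (simp_all add: surj_f_inv_f)
    qed
    \<comment> \<open>Transporting the integral along the action requires the action to be
      measurable: the projection matrix of the image of \<open>S\<close> is that of \<open>S\<close>
      conjugated by \<open>g\<close>.\<close>
    have gm: "(\<lambda>S. g ` S) \<in> measurable M M"
      unfolding measurable_cong_sets[OF refl sets] grassmannian_borel_def
    proof (rule measurable_vimage_algebra2)
      show "(\<lambda>S. g ` S) \<in> space M \<rightarrow> grassmannian d"
        using g inj_on_subset[OF orthogonal_transformation_inj[OF g]]
        by (auto simp: space grassmannian_def subspace_orthogonal_image dim_image_eq[OF lin])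
      have "(\<lambda>S. matrix (\<lambda>x. g (matrix (orthogonal_projection S) *v g' x))) \<in> borel_measurable M"
      proof (rule borel_measurable_matrix)
        fix j :: 'n
        have [measurable]: "g \<in> borel_measurable borel" using lin by (rule borel_measurable_linear)
        show "(\<lambda>S. g (matrix (orthogonal_projection S) *v g' (axis j 1))) \<in> borel_measurable M" by measurable
      qed
      then show "(\<lambda>S. matrix (orthogonal_projection (g ` S))) \<in> borel_measurable M"
      proof (rule measurable_cong[THEN iffD1, rotated])
        fix S assume "S \<in> space M"
        then have S: "subspace S" by (rule sub)
        have "g (matrix (orthogonal_projection S) *v g' x) = orthogonal_projection (g ` S) x" for x
          using orthogonal_projection_orthogonal_image[OF g S, of "g' x"]
          by (simp add: g' matrix_orthogonal_projection_mult[OF S])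
        then show "matrix (\<lambda>x. g (matrix (orthogonal_projection S) *v g' x)) = matrix (orthogonal_projection (g ` S))"
          by simp
      qed
    qed
    have "(\<integral>\<^sup>+S. shadow S (g ` K) \<partial>M) = (\<integral>\<^sup>+S. shadow S (g ` K) \<partial>distr M M (\<lambda>S. g ` S))"
      by (simp add: inv[OF g])
    also have "\<dots> = (\<integral>\<^sup>+S. shadow (g ` S) (g ` K) \<partial>M)"
      by (rule nn_integral_distr[OF gm]) (use meas[OF cK] K in auto)
    also have "\<dots> = (\<integral>\<^sup>+S. shadow S K \<partial>M)"
      by (intro nn_integral_cong shadow_orthogonal_image g sub K)
    finally show ?thesis .
  qed
  have joint: "(\<lambda>(S, X). matrix_shadow K (frame_conj X (matrix (orthogonal_projection S)))) \<in>
      borel_measurable (M \<Otimes>\<^sub>M ball_family CARD('n))"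
    unfolding split_beta
    by (intro measurable_compose[OF borel_measurable_frame_conj borel_measurable_matrix_shadow] K
        measurable_compose[OF measurable_fst proj] measurable_snd)
  have "mean_shadow K T = (\<integral>\<^sup>+S. mean_shadow K T \<partial>M)"
    by (simp add: M.emeasure_space_1)
  also have "\<dots> = (\<integral>\<^sup>+S. mean_shadow K S \<partial>M)"
    using T by (intro nn_integral_cong mean_shadow_cong K) (auto simp: space grassmannian_def)
  also have "\<dots> = (\<integral>\<^sup>+X. (\<integral>\<^sup>+S. matrix_shadow K (frame_conj X (matrix (orthogonal_projection S))) \<partial>M) \<partial>ball_family CARD('n))"
    unfolding mean_shadow_def by (rule P.Fubini'[OF joint, symmetric])
  also have "\<dots> = (\<integral>\<^sup>+X. (\<integral>\<^sup>+S. shadow S K \<partial>M) \<partial>(ball_family CARD('n) :: (nat \<Rightarrow> real ^ 'n) measure))"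
  proof (rule nn_integral_cong_AE)
    have "AE X in (ball_family CARD('n) :: (nat \<Rightarrow> real ^ 'n) measure). gs_regular CARD('n) X"
      by (rule AE_gs_regular) simp
    then show "AE X in ball_family CARD('n). (\<integral>\<^sup>+S. matrix_shadow K (frame_conj X (matrix (orthogonal_projection S))) \<partial>M) =
        (\<integral>\<^sup>+S. shadow S K \<partial>M)"
    proof eventually_elim
      case (elim X)
      then have o: "orthogonal_transformation (frame_map X)"
        by (intro orthogonal_transformation_frame_map) simp
      have "(\<integral>\<^sup>+S. matrix_shadow K (frame_conj X (matrix (orthogonal_projection S))) \<partial>M) =
          (\<integral>\<^sup>+S. shadow S (frame_map X ` K) \<partial>M)"
        by (intro nn_integral_cong matrix_shadow_frame_conj elim sub K)
      then show ?case by (simp add: rot[OF o])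
    qed
  qed
  also have "\<dots> = (\<integral>\<^sup>+S. shadow S K \<partial>M)" by (simp add: N.emeasure_space_1)
  finally show "(\<integral>\<^sup>+S. shadow S K \<partial>M) = mean_shadow K T" by simp
qed

section \<open>Random zonotopes\<close>

lemma coeff_det_poly_scale: "coeff (det_poly A (r *\<^sub>R B)) m = r ^ m * coeff (det_poly A (B :: real ^ 'n ^ 'n)) m"
proof -
  have "det_poly A (r *\<^sub>R B) = pcompose (det_poly A B) [:0, r:]"
    by (rule poly_ext) (simp add: poly_det_poly poly_pcompose mult.commute)
  then show ?thesis by (simp add: coeff_pcompose_linear)
qed

lemma potential_add_zonotope:
  fixes K :: "(real ^ 'n) set"
  assumes pot: "potential K f G H" and r: "0 \<le> r"
  obtains f' G' where "potential (K + (*\<^sub>R) r ` zonotope k u) f' G'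
    (\<lambda>x. H x + (\<Sum>j<k. r *\<^sub>R (soft_abs'' (u j \<bullet> x) *\<^sub>R outer (u j))))"
proof -
  have "\<exists>f' G'. potential (K + (*\<^sub>R) r ` zonotope k u) f' G'
      (\<lambda>x. H x + (\<Sum>j<k. r *\<^sub>R (soft_abs'' (u j \<bullet> x) *\<^sub>R outer (u j))))"
    unfolding scaled_zonotope
    using potential_add[OF pot potential_sum[OF finite_lessThan potential_scale[OF potential_segment r]]] by blast
  then show thesis using that by blast
qed

context
  fixes K :: "(real ^ 'n) set" and f G H
  assumes pot: "potential K f G H" and K: "convex_body K"
begin

lemma emeasure_add_zonotope:
  assumes "0 \<le> r"
  shows "emeasure lborel (K + (*\<^sub>R) r ` zonotope k u) =
    (\<integral>\<^sup>+x. ennreal (det (H x + (\<Sum>j<k. r *\<^sub>R (soft_abs'' (u j \<bullet> x) *\<^sub>R outer (u j))))) \<partial>lborel)"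
proof -
  obtain f' G' where p: "potential (K + (*\<^sub>R) r ` zonotope k u) f' G'
    (\<lambda>x. H x + (\<Sum>j<k. r *\<^sub>R (soft_abs'' (u j \<bullet> x) *\<^sub>R outer (u j))))"
    using potential_add_zonotope[OF pot assms] .
  have "convex_body (K + (*\<^sub>R) r ` zonotope k u)"
    by (intro convex_body_add K convex_body_scale convex_body_zonotope)
  then show ?thesis using potential_emeasure[OF p] by (simp add: convex_body_def)
qed

lemma measurable_zonotope_integrand:
  "(\<lambda>(u, x). ennreal (det (H x + (\<Sum>j<k. r *\<^sub>R (soft_abs'' (u j \<bullet> x) *\<^sub>R outer (u j)))))) \<in>
    borel_measurable (ball_family k \<Otimes>\<^sub>M lborel)"
proof -
  have [measurable]: "H \<in> borel_measurable borel"
    using potentialD(3)[OF pot] by (rule borel_measurable_continuous_onI)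
  have [measurable]: "soft_abs'' \<in> borel_measurable borel"
    using soft_abs_derivs(3) by (rule borel_measurable_continuous_onI)
  have W: "(\<lambda>p. \<Sum>j<k. r *\<^sub>R (soft_abs'' (fst p j \<bullet> snd p) *\<^sub>R outer (fst p j))) \<in>
      borel_measurable (ball_family k \<Otimes>\<^sub>M lborel :: ((nat \<Rightarrow> real ^ 'n) \<times> (real ^ 'n)) measure)"
  proof (rule borel_measurable_sum)
    fix j assume "j \<in> {..<k}"
    then have fst: "(\<lambda>p. fst p j) \<in> borel_measurable (ball_family k \<Otimes>\<^sub>M lborel :: ((nat \<Rightarrow> real ^ 'n) \<times> (real ^ 'n)) measure)"
      by (intro measurable_compose[OF measurable_fst measurable_ball_family_component]) auto
    have snd: "snd \<in> borel_measurable (ball_family k \<Otimes>\<^sub>M lborel :: ((nat \<Rightarrow> real ^ 'n) \<times> (real ^ 'n)) measure)"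
      using measurable_snd[of "ball_family k :: (nat \<Rightarrow> real ^ 'n) measure" "lborel :: (real ^ 'n) measure"] by simp
    show "(\<lambda>p. r *\<^sub>R (soft_abs'' (fst p j \<bullet> snd p) *\<^sub>R outer (fst p j))) \<in>
        borel_measurable (ball_family k \<Otimes>\<^sub>M lborel :: ((nat \<Rightarrow> real ^ 'n) \<times> (real ^ 'n)) measure)"
      by (intro borel_measurable_scaleR borel_measurable_const borel_measurable_inner fst snd
          measurable_compose[OF fst borel_measurable_outer]
          measurable_compose[OF borel_measurable_inner \<open>soft_abs'' \<in> borel_measurable borel\<close>])
  qed
  show ?thesis unfolding split_beta using W by measurable
qed

lemma measurable_measure_add_zonotope:
  assumes "0 \<le> r"
  shows "(\<lambda>u. measure lborel (K + (*\<^sub>R) r ` zonotope k u)) \<in> borel_measurable (ball_family k)"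
  unfolding measure_def emeasure_add_zonotope[OF assms]
  by (intro borel_measurable_enn2real lborel.borel_measurable_nn_integral measurable_zonotope_integrand)

text \<open>Fubini takes the expectation inside the integral over \<open>x\<close>, where it turns
  the determinant into \<open>rising\<close> of a determinant polynomial; integrated over
  \<open>x\<close>, the coefficients of that polynomial become Steiner coefficients.\<close>

lemma mean_measure_add_zonotope:
  assumes r: "0 \<le> r"
  shows "integrable (ball_family k) (\<lambda>u. measure lborel (K + (*\<^sub>R) r ` zonotope k u))"
    and "(\<integral>u. measure lborel (K + (*\<^sub>R) r ` zonotope k u) \<partial>ball_family k) =
      (\<Sum>m\<le>k. real (k choose m) * fact m * (r * ball_mean TYPE('n)) ^ m * coeff (steiner_poly K) m)"
proof -
  let ?A = "\<Sum>m\<le>k. real (k choose m) * fact m * (r * ball_mean TYPE('n)) ^ m * coeff (steiner_poly K) m"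
  let ?h = "\<lambda>u x. ennreal (det (H x + (\<Sum>j<k. r *\<^sub>R (soft_abs'' (u j \<bullet> x) *\<^sub>R outer (u j)))))"
  let ?F = "\<lambda>x. rising k (det_poly (H x) (r *\<^sub>R zonoid_hessian x))"
  interpret N: prob_space "ball_family k :: (nat \<Rightarrow> real ^ 'n) measure" by (rule prob_space_ball_family)
  interpret P: pair_sigma_finite "ball_family k :: (nat \<Rightarrow> real ^ 'n) measure" lborel by standard
  have E: "(\<integral>\<^sup>+u. ?h u x \<partial>ball_family k) = ennreal (?F x) \<and> 0 \<le> ?F x" for x
  proof -
    have "(\<integral>u. r *\<^sub>R (soft_abs'' (u \<bullet> x) *\<^sub>R outer u) \<partial>ball_measure) = r *\<^sub>R zonoid_hessian x"
      unfolding zonoid_hessian_def by (rule integral_scaleR_right)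
    moreover have rank: "\<exists>c v. 0 \<le> c \<and> r *\<^sub>R (soft_abs'' (u \<bullet> x) *\<^sub>R outer u) = c *\<^sub>R outer v" for u
      using r soft_abs_bounds(3)[of "u \<bullet> x"]
      by (intro exI[of _ "r * soft_abs'' (u \<bullet> x)"] exI[of _ u]) simp
    ultimately show ?thesis
      using expectation_det_sum_rank_one[OF prob_space_ball_measure
          integrable_scaleR_right[OF integrable_soft_abs_outer[of x]] rank potentialD(6)[OF pot, of _ x], of k] by simp
  qed
  have F: "?F x = (\<Sum>m\<le>k. real (k choose m) * fact m * r ^ m * coeff (det_poly (H x) (zonoid_hessian x)) m)" for x
    by (simp add: rising_def coeff_det_poly_scale mult_ac)
  have intF: "integrable lborel ?F"
    unfolding F using coeff_steiner_poly(1)[OF pot K] by auto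
  have FA: "(\<integral>x. ?F x \<partial>lborel) = ?A"
    unfolding F using coeff_steiner_poly[OF pot K]
    by (simp add: power_mult_distrib mult_ac)
  have "(\<integral>\<^sup>+u. emeasure lborel (K + (*\<^sub>R) r ` zonotope k u) \<partial>ball_family k) = (\<integral>\<^sup>+u. (\<integral>\<^sup>+x. ?h u x \<partial>lborel) \<partial>ball_family k)"
    by (simp add: emeasure_add_zonotope[OF r])
  also have "\<dots> = (\<integral>\<^sup>+x. (\<integral>\<^sup>+u. ?h u x \<partial>ball_family k) \<partial>lborel)"
    by (rule P.Fubini'[OF measurable_zonotope_integrand, symmetric])
  also have "\<dots> = (\<integral>\<^sup>+x. ennreal (?F x) \<partial>lborel)" using E by simp
  also have "\<dots> = ennreal ?A"
    using nn_integral_eq_integral[OF intF] E FA by simp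
  finally have nn: "(\<integral>\<^sup>+u. emeasure lborel (K + (*\<^sub>R) r ` zonotope k u) \<partial>ball_family k) = ennreal ?A" .
  have "emeasure lborel (K + (*\<^sub>R) r ` zonotope k u) = ennreal (measure lborel (K + (*\<^sub>R) r ` zonotope k u))" for u
    by (intro convex_body_emeasure convex_body_add K convex_body_scale convex_body_zonotope)
  then have nn': "(\<integral>\<^sup>+u. ennreal (measure lborel (K + (*\<^sub>R) r ` zonotope k u)) \<partial>ball_family k) = ennreal ?A"
    using nn by simp
  have "0 \<le> ?A" unfolding FA[symmetric] using E by (intro integral_nonneg_AE) auto
  show "integrable (ball_family k) (\<lambda>u. measure lborel (K + (*\<^sub>R) r ` zonotope k u))"
    using nn' measurable_measure_add_zonotope[OF r] by (intro integrableI_nonneg) auto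
  then show "(\<integral>u. measure lborel (K + (*\<^sub>R) r ` zonotope k u) \<partial>ball_family k) = ?A"
    using nn' nn_integral_eq_integral[of "ball_family k" "\<lambda>u. measure lborel (K + (*\<^sub>R) r ` zonotope k u)"] \<open>0 \<le> ?A\<close>
    by (simp add: integral_nonneg_AE)
qed

end

section \<open>Projections onto the normal flats of zonotopes\<close>

definition normal_flat :: "nat \<Rightarrow> (nat \<Rightarrow> 'a::euclidean_space) \<Rightarrow> 'a set" where
  "normal_flat k u = {x. \<forall>j<k. x \<bullet> u j = 0}"

lemma subspace_normal_flat: "subspace (normal_flat k u)"
  by (auto simp: normal_flat_def subspace_def inner_add_left)

lemma normal_flat_orthogonal_span: "x \<in> normal_flat k u \<Longrightarrow> y \<in> span (u ` {..<k}) \<Longrightarrow> x \<bullet> y = 0"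
  using orthogonal_to_span[of y "u ` {..<k}" x] by (auto simp: normal_flat_def orthogonal_def)

lemma span_if_orthogonal_normal_flat:
  assumes "\<And>x. x \<in> normal_flat k u \<Longrightarrow> v \<bullet> x = 0"
  shows "v \<in> span (u ` {..<k})"
proof -
  obtain y z where yz: "y \<in> span (u ` {..<k})" "\<And>w. w \<in> span (u ` {..<k}) \<Longrightarrow> orthogonal z w" "v = y + z"
    using orthogonal_subspace_decomp_exists[of "u ` {..<k}" v] by blast
  have "z \<in> normal_flat k u" using yz(2) by (auto simp: normal_flat_def orthogonal_def span_base)
  then have "v \<bullet> z = 0" "y \<bullet> z = 0"
    using assms normal_flat_orthogonal_span[OF _ yz(1), of z] inner_commute[of y z] by auto
  then have "z = 0" using yz(3) by (simp add: inner_add_left)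
  then show ?thesis using yz by simp
qed

lemma dim_normal_flat:
  fixes u :: "nat \<Rightarrow> 'a::euclidean_space"
  assumes "independent_family k u"
  shows "dim (normal_flat k u) + k = DIM('a)"
proof -
  have "normal_flat k u = {y \<in> UNIV. \<forall>x\<in>span (u ` {..<k}). orthogonal x y}"
  proof (intro equalityI subsetI)
    fix x assume "x \<in> normal_flat k u"
    then show "x \<in> {y \<in> UNIV. \<forall>x\<in>span (u ` {..<k}). orthogonal x y}"
      using normal_flat_orthogonal_span[of x k u] by (auto simp: orthogonal_def inner_commute[of _ x])
  next
    fix x assume "x \<in> {y \<in> UNIV. \<forall>x\<in>span (u ` {..<k}). orthogonal x y}"
    then have "orthogonal (u j) x" if "j < k" for j using that by (simp add: span_base)
    then show "x \<in> normal_flat k u" by (simp add: normal_flat_def orthogonal_def inner_commute)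
  qed
  moreover have "dim (span (u ` {..<k})) = k"
    using independent_family[OF assms] by (simp add: dim_eq_card_independent card_image)
  ultimately show ?thesis
    using dim_subspace_orthogonal_to_vectors[OF subspace_span subspace_UNIV, of "u ` {..<k}"] by simp
qed

lemma zonotope_in_span: "z \<in> zonotope k u \<Longrightarrow> z \<in> span (u ` {..<k})"
  unfolding mem_zonotope by (auto intro!: span_sum span_scale intro: span_base)

lemma norm_zonotope_le: "(\<And>j. j < k \<Longrightarrow> norm (u j) \<le> 1) \<Longrightarrow> z \<in> zonotope k u \<Longrightarrow> norm z \<le> real k"
proof -
  assume u: "\<And>j. j < k \<Longrightarrow> norm (u j) \<le> 1" and "z \<in> zonotope k u"
  then obtain s where s: "\<And>j. j < k \<Longrightarrow> \<bar>s j\<bar> \<le> 1" "z = (\<Sum>j<k. s j *\<^sub>R u j)" unfolding mem_zonotope by blast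
  have "norm z \<le> (\<Sum>j<k. norm (s j *\<^sub>R u j))" unfolding s(2) by (rule norm_sum)
  also have "\<dots> \<le> (\<Sum>j<k. 1 * 1)"
    using u s by (intro sum_mono) (auto intro!: mult_le_one)
  finally show "norm z \<le> real k" by simp
qed

lemma subspace_identification:
  assumes "subspace S" "dim S = DIM('b)"
  shows "linear (subspace_identification S :: 'a::euclidean_space \<Rightarrow> 'b::euclidean_space)"
    and "x \<in> S \<Longrightarrow> norm (subspace_identification S x :: 'b) = norm x"
    and "(subspace_identification S :: 'a \<Rightarrow> 'b) ` S = UNIV"
proof -
  have "\<exists>f :: 'a \<Rightarrow> 'b. linear f \<and> (\<forall>x\<in>S. norm (f x) = norm x) \<and> f ` S = UNIV"
  proof -
    have "dim S = dim (UNIV :: 'b set)" using assms by simp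
    then obtain f :: "'a \<Rightarrow> 'b" and g where "linear f" "linear g" "f ` S = UNIV" "g ` UNIV = S"
      "\<And>x. x \<in> S \<Longrightarrow> norm (f x) = norm x" "\<And>x. x \<in> UNIV \<Longrightarrow> norm (g x) = norm x"
      "\<And>x. x \<in> S \<Longrightarrow> g (f x) = x" "\<And>x. x \<in> UNIV \<Longrightarrow> f (g x) = x"
      by (rule isometries_subspaces[OF assms(1) subspace_UNIV]) (rule that)
    then show ?thesis by blast
  qed
  from someI_ex[OF this]
  show "linear (subspace_identification S :: 'a \<Rightarrow> 'b)" "x \<in> S \<Longrightarrow> norm (subspace_identification S x :: 'b) = norm x"
    "(subspace_identification S :: 'a \<Rightarrow> 'b) ` S = UNIV"
    by (simp_all add: subspace_identification_def)
qed

definition projected_volume :: "'b::euclidean_space itself \<Rightarrow> 'a::euclidean_space set \<Rightarrow> 'a set \<Rightarrow> real" where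
  "projected_volume _ S K = measure lborel ((subspace_identification S :: 'a \<Rightarrow> 'b) ` orthogonal_projection S ` K)"

lemma projection_cball:
  assumes S: "subspace (S :: 'a::euclidean_space set)"
  shows "orthogonal_projection S ` cball 0 r = S \<inter> cball 0 r"
proof (intro equalityI subsetI)
  fix y assume "y \<in> orthogonal_projection S ` cball 0 r"
  then show "y \<in> S \<inter> cball 0 r"
    using orthogonal_projection_in[OF S] norm_orthogonal_projection_le(1)[OF S] by (fastforce intro: order_trans)
next
  fix y assume "y \<in> S \<inter> cball 0 r"
  then show "y \<in> orthogonal_projection S ` cball 0 r"
    using orthogonal_projection_ident[OF S, of y] by (metis IntD1 IntD2 image_eqI)
qed

lemma projected_volume_cball:
  assumes S: "subspace (S :: 'a::euclidean_space set)" "dim S = DIM('b::euclidean_space)"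
  shows "projected_volume TYPE('b) S (cball 0 r) = measure lborel (cball (0::'b) r)"
  unfolding projected_volume_def projection_cball[OF S(1)]
  using isometry_image_ball[OF S(1) subspace_identification[OF S]] by simp

lemma shadow_eq_projected_volume:
  assumes S: "subspace (S :: 'a::euclidean_space set)" "dim S = DIM('b::euclidean_space)" and K: "compact K"
  shows "shadow S K = ennreal (relative_volume S (cball 0 1) * projected_volume TYPE('b) S K / measure lborel (cball (0::'b) 1))"
proof -
  let ?C = "cylinder S (orthogonal_projection S ` K) (cball 0 1)"
  have c: "compact (orthogonal_projection S ` K)" "orthogonal_projection S ` K \<subseteq> S"
    using K orthogonal_projection_in[OF S(1)]
    by (auto intro: compact_linear_image_euclidean linear_orthogonal_projection[OF S(1)])
  have "measure lborel ?C * measure lborel (cball (0::'b) 1) = relative_volume S (cball 0 1) * projected_volume TYPE('b) S K"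
    unfolding relative_volume_def projected_volume_def
    by (rule measure_cylinder[OF S(1) subspace_identification[OF S] c compact_cball])
  moreover have "0 < measure lborel (cball (0::'b) 1)" by (simp add: content_cball_pos)
  ultimately have "measure lborel ?C = relative_volume S (cball 0 1) * projected_volume TYPE('b) S K / measure lborel (cball (0::'b) 1)"
    by (simp add: field_simps)
  moreover have "emeasure lborel ?C = ennreal (measure lborel ?C)"
    using emeasure_bounded_finite[OF bounded_cylinder[OF compact_imp_bounded[OF c(1)] bounded_cball[of "0::'a" 1], of S]]
    by (simp add: emeasure_eq_ennreal_measure less_top)
  ultimately show ?thesis by (simp add: shadow_def)
qed

lemma relative_volume_cball_pos:
  assumes S: "subspace (S :: 'a::euclidean_space set)"
  shows "0 < relative_volume S (cball 0 1)"
proof -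
  have "0 < measure lborel (cball (0::'a) 1)" by (simp add: content_cball_pos)
  also have "\<dots> \<le> relative_volume S (cball 0 1)"
    unfolding relative_volume_def
  proof (rule measure_mono_fmeasurable)
    show "cball 0 1 \<subseteq> cylinder S (cball 0 1) (cball 0 1)"
    proof
      fix x :: 'a assume "x \<in> cball 0 1"
      then show "x \<in> cylinder S (cball 0 1) (cball 0 1)"
        using norm_orthogonal_projection_le[OF S, of x] by (simp add: cylinder_def)
    qed
    show "cylinder S (cball 0 1) (cball 0 1) \<in> fmeasurable lborel"
      using closed_cylinder[OF S closed_cball closed_cball] emeasure_bounded_finite[OF bounded_cylinder[OF bounded_cball bounded_cball]]
      by (auto simp: fmeasurable_def)
  qed simp
  finally show ?thesis .
qed

text \<open>The unit ball projects onto the unit ball of \<open>S\<close>, so this relative volume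
  is the shadow of the unit ball, and shadows are rotation invariant. Hence \<open>shadow\<close>
  and \<open>projected_volume\<close> differ by one constant for all subspaces of a given
  dimension.\<close>

lemma relative_volume_cball_cong:
  fixes S T :: "'a::euclidean_space set"
  assumes S: "subspace S" and T: "subspace T" and d: "dim S = dim T"
  shows "relative_volume S (cball 0 1) = relative_volume T (cball 0 1)"
proof -
  have cyl: "cylinder S (orthogonal_projection S ` cball 0 1) (cball 0 1) = cylinder S (cball 0 1) (cball 0 1)" if "subspace S" for S :: "'a set"
    unfolding projection_cball[OF that] using orthogonal_projection_in[OF that] by (auto simp: cylinder_def)
  obtain h :: "'a \<Rightarrow> 'a" where h: "orthogonal_transformation h" "h ` S = T"
    using orthogonal_transformation_between_subspaces[OF S T d] .
  have "h ` cball 0 1 = cball 0 1"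
    using image_orthogonal_transformation_cball[OF h(1), of 0 1] linear_0[OF orthogonal_transformation_linear[OF h(1)]] by simp
  then have "shadow T (cball 0 1) = shadow S (cball 0 1)"
    using shadow_orthogonal_image[OF h(1) S compact_cball, of 0 1] h(2) by simp
  then show ?thesis unfolding shadow_def cyl[OF S] cyl[OF T] relative_volume_def by (simp add: measure_def)
qed

lemma tendsto_volume_add_zonotope:
  fixes K :: "(real ^ 'n) set"
  assumes K: "convex_body K" and u: "independent_family k u" and dk: "CARD('d::finite) + k = CARD('n)"
  shows "(\<lambda>N. measure lborel (K + (*\<^sub>R) (real (Suc N)) ` zonotope k u) / real (Suc N) ^ k) \<longlonglongrightarrow>
    relative_volume (normal_flat k u) (zonotope k u) * projected_volume TYPE(real ^ 'd) (normal_flat k u) K /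
      measure lborel (cball (0 :: real ^ 'd) 1)"
proof -
  let ?S = "normal_flat k u" and ?Z = "zonotope k u"
  have S: "subspace ?S" "dim ?S = DIM(real ^ 'd)"
    using subspace_normal_flat[of k u] dim_normal_flat[OF u] dk by auto
  note f = subspace_identification[OF S]
  have k: "DIM(real ^ 'n) - DIM(real ^ 'd) = k" using dk by simp
  have Z: "compact ?Z" "convex ?Z" using convex_body_zonotope[of k u] by (auto simp: convex_body_def)
  have orth: "z \<bullet> s = 0" if "z \<in> ?Z" "s \<in> ?S" for z s
    using normal_flat_orthogonal_span[OF that(2) zonotope_in_span[OF that(1)]] by (simp add: inner_commute)
  obtain R where R: "\<And>a. a \<in> K \<Longrightarrow> norm a \<le> R"
    using compact_imp_bounded[of K] K unfolding convex_body_def bounded_iff by blast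
  obtain \<rho> where \<rho>: "0 < \<rho>" "\<And>y. y \<in> span (u ` {..<k}) \<Longrightarrow> norm y \<le> R \<Longrightarrow> y \<in> (*\<^sub>R) \<rho> ` ?Z"
    by (rule zonotope_absorbs[OF u, of R]) (rule that)
  have perp: "a - orthogonal_projection ?S a \<in> span (u ` {..<k})" "norm (a - orthogonal_projection ?S a) \<le> R" if "a \<in> K" for a
    using norm_orthogonal_projection_le(2)[OF S(1), of a] R[OF that]
    by (auto intro!: span_if_orthogonal_normal_flat orthogonal_projection_orthogonal[OF S(1)])
  have "((\<lambda>r. measure lborel (K + (*\<^sub>R) r ` ?Z) / r ^ k) \<longlongrightarrow>
      relative_volume ?S ?Z * measure lborel ((subspace_identification ?S :: _ \<Rightarrow> real ^ 'd) ` orthogonal_projection ?S ` K) /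
        measure lborel (cball (0 :: real ^ 'd) 1)) at_top"
  proof (rule volume_add_large_scaled[OF S(1) f _ Z orth \<rho>(1), unfolded k])
    show "compact K" using K by (simp add: convex_body_def)
    show "a - orthogonal_projection ?S a \<in> (*\<^sub>R) \<rho> ` ?Z" "- (a - orthogonal_projection ?S a) \<in> (*\<^sub>R) \<rho> ` ?Z" if "a \<in> K" for a
      using perp[OF that] span_neg[OF perp(1)[OF that]] by (auto intro!: \<rho>(2) simp del: minus_diff_eq)
  qed
  then have "((\<lambda>r. measure lborel (K + (*\<^sub>R) r ` ?Z) / r ^ k) \<longlongrightarrow>
      relative_volume ?S ?Z * projected_volume TYPE(real ^ 'd) ?S K / measure lborel (cball (0 :: real ^ 'd) 1)) at_top"
    by (simp add: projected_volume_def)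
  moreover have "filterlim (\<lambda>N. real (Suc N)) at_top sequentially"
    by (rule filterlim_compose[OF filterlim_real_sequentially filterlim_Suc])
  ultimately show ?thesis by (rule filterlim_compose)
qed

text \<open>Dominated convergence needs a constant independent of \<open>u\<close>, whereas the
  factor from \<open>zonotope_absorbs\<close> depends on \<open>u\<close>. Therefore both the
  zonotope, of norm at most k, and the deviation of \<open>K\<close> from its projection, of norm at
  most R, are enclosed in a ball.\<close>

lemma volume_add_zonotope_bound:
  fixes K :: "(real ^ 'n) set"
  assumes dk: "CARD('d::finite) + k = CARD('n)" and K: "convex_body K"
  shows "\<exists>C. \<forall>u r. independent_family k u \<longrightarrow> (\<forall>j<k. norm (u j) \<le> 1) \<longrightarrow> 1 \<le> r \<longrightarrow>
    measure lborel (K + (*\<^sub>R) r ` zonotope k u) / r ^ k \<le> C"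
proof -
  obtain R where "\<forall>a\<in>K. norm a \<le> R"
    using compact_imp_bounded[of K] K unfolding convex_body_def bounded_iff by blast
  moreover obtain a where "a \<in> K" using K by (auto simp: convex_body_def)
  ultimately have R: "\<And>a. a \<in> K \<Longrightarrow> norm a \<le> R" and "0 \<le> R" using norm_ge_zero order_trans by blast+
  let ?\<kappa> = "measure lborel (cball (0 :: real ^ 'd) 1)"
  have \<kappa>: "0 < ?\<kappa>" by (simp add: content_cball_pos)
  \<comment> \<open>Over the unit ball of the flat, a cross section of radius
    \<open>R + real k\<close> stays inside the ball of radius \<open>1 + (R + real k)\<close>, which
    bounds the relative volume for all \<open>u\<close> at once.\<close>
  define C where "C = measure lborel (cball (0 :: real ^ 'n) (1 + (R + real k))) * measure lborel (cball (0 :: real ^ 'd) R) / ?\<kappa>"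
  have "measure lborel (K + (*\<^sub>R) r ` zonotope k u) / r ^ k \<le> C"
    if u: "independent_family k u" "\<And>j. j < k \<Longrightarrow> norm (u j) \<le> 1" and r: "1 \<le> r" for u and r :: real
  proof -
    let ?S = "normal_flat k u" and ?Z = "zonotope k u" and ?B = "cball (0 :: real ^ 'n) (R + real k)"
    let ?P = "orthogonal_projection ?S"
    have S: "subspace ?S" "dim ?S = DIM(real ^ 'd)"
      using subspace_normal_flat[of k u] dim_normal_flat[OF u(1)] dk by auto
    note f = subspace_identification[OF S]
    note lin = linear_orthogonal_projection[OF S(1)]
    have k: "DIM(real ^ 'n) - DIM(real ^ 'd) = k" using dk by simp
    have sub: "K + (*\<^sub>R) r ` ?Z \<subseteq> cylinder ?S (?S \<inter> cball 0 R) ((*\<^sub>R) r ` ?B)"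
    proof
      fix x assume "x \<in> K + (*\<^sub>R) r ` ?Z"
      then obtain a z where az: "a \<in> K" "z \<in> ?Z" "x = a + r *\<^sub>R z" by (auto elim!: set_plus_elim)
      have "?P z = 0"
        using normal_flat_orthogonal_span[OF _ zonotope_in_span[OF az(2)]]
        by (intro orthogonal_projection_zero[OF S(1)]) (simp add: inner_commute)
      moreover have "?P x = ?P a + r *\<^sub>R ?P z" unfolding az(3) linear_add[OF lin] linear_scale[OF lin] ..
      ultimately have Px: "?P x = ?P a" by simp
      have 1: "norm (?P a) \<le> R" "norm (a - ?P a) \<le> R"
        using norm_orthogonal_projection_le[OF S(1), of a] R[OF az(1)] by auto
      have "x - ?P x = (a - ?P a) + r *\<^sub>R z" unfolding Px unfolding az(3) by simp
      then have "norm (x - ?P x) \<le> norm (a - ?P a) + norm (r *\<^sub>R z)" using norm_triangle_ineq by metis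
      also have "\<dots> \<le> r * R + r * real k"
        using 1(2) norm_zonotope_le[OF u(2) az(2)] r \<open>0 \<le> R\<close>
        by (intro add_mono) (auto intro: order_trans[OF _ mult_right_mono[of 1 r R]] mult_left_mono)
      finally have "norm (x - ?P x) \<le> r * (R + real k)" by (simp add: distrib_left)
      then have "x - ?P x = r *\<^sub>R ((1 / r) *\<^sub>R (x - ?P x))" "(1 / r) *\<^sub>R (x - ?P x) \<in> ?B"
        using r by (auto simp: divide_le_eq mult.commute)
      then have "x - ?P x \<in> (*\<^sub>R) r ` ?B" by (rule image_eqI)
      then show "x \<in> cylinder ?S (?S \<inter> cball 0 R) ((*\<^sub>R) r ` ?B)"
        using 1 orthogonal_projection_in[OF S(1)] by (simp add: cylinder_def Px)
    qed
    have cB: "compact ((*\<^sub>R) r ` ?B)" by (intro compact_scaling compact_cball)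
    have cS: "compact (?S \<inter> cball 0 R)" by (intro closed_Int_compact closed_subspace S compact_cball)
    let ?C = "cylinder ?S (?S \<inter> cball 0 R) ((*\<^sub>R) r ` ?B)"
    have fm: "?C \<in> fmeasurable lborel"
      using closed_cylinder[OF S(1) compact_imp_closed[OF cS] compact_imp_closed[OF cB]]
        emeasure_bounded_finite[OF bounded_cylinder[OF compact_imp_bounded[OF cS] compact_imp_bounded[OF cB], of ?S]]
      by (auto simp: fmeasurable_def)
    have "measure lborel (K + (*\<^sub>R) r ` ?Z) \<le> measure lborel ?C"
      by (rule measure_mono_fmeasurable[OF sub _ fm])
         (simp add: convex_body_sets convex_body_add K convex_body_scale convex_body_zonotope)
    also have "measure lborel ?C * ?\<kappa> = r ^ k * relative_volume ?S ?B * measure lborel (cball (0 :: real ^ 'd) R)"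
      using measure_cylinder_scaled[OF S(1) f cS _ compact_cball[of 0 "R + real k"], of r] r
      unfolding k by (simp add: isometry_image_ball[OF S(1) f])
    then have "measure lborel ?C = r ^ k * (relative_volume ?S ?B * measure lborel (cball (0 :: real ^ 'd) R) / ?\<kappa>)"
      using \<kappa> by (simp add: field_simps)
    finally have "measure lborel (K + (*\<^sub>R) r ` ?Z) / r ^ k \<le> relative_volume ?S ?B * measure lborel (cball (0 :: real ^ 'd) R) / ?\<kappa>"
      using r by (simp add: divide_le_eq mult.commute)
    also have "\<dots> \<le> C"
      unfolding C_def
    proof (intro divide_right_mono mult_right_mono)
      show "relative_volume ?S ?B \<le> measure lborel (cball (0 :: real ^ 'n) (1 + (R + real k)))"
        unfolding relative_volume_def
      proof (rule measure_mono_fmeasurable)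
        show "cylinder ?S (cball 0 1) ?B \<subseteq> cball 0 (1 + (R + real k))"
        proof
          fix x assume "x \<in> cylinder ?S (cball 0 1) ?B"
          then show "x \<in> cball 0 (1 + (R + real k))"
            using norm_triangle_ineq[of "?P x" "x - ?P x"] by (simp add: cylinder_def)
        qed
        show "cylinder ?S (cball 0 1) ?B \<in> sets lborel"
          using closed_cylinder[OF S(1) closed_cball closed_cball] by auto
        show "cball (0 :: real ^ 'n) (1 + (R + real k)) \<in> fmeasurable lborel"
          using emeasure_lborel_cball_finite[of "0 :: real ^ 'n" "1 + (R + real k)"] by (auto simp: fmeasurable_def)
      qed
    qed (use \<kappa> in auto)
    finally show ?thesis .
  qed
  then show ?thesis by blast
qed

text \<open>A limit of measurable functions is measurable in \<open>u\<close>, while the closed form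
  that it has almost surely contains a chosen identification of every flat. The index
  \<open>Suc N\<close> avoids division by 0.\<close>

definition zonotope_density :: "nat \<Rightarrow> (real ^ 'n) set \<Rightarrow> (nat \<Rightarrow> real ^ 'n) \<Rightarrow> real" where
  "zonotope_density k K u = lim (\<lambda>N. measure lborel (K + (*\<^sub>R) (real (Suc N)) ` zonotope k u) / real (Suc N) ^ k)"

lemma AE_ball_family_norm:
  "AE u in (ball_family k :: (nat \<Rightarrow> 'a::euclidean_space) measure). \<forall>j\<in>{..<k}. norm (u j) \<le> 1"
proof (rule AE_finite_allI)
  fix j assume "j \<in> {..<k}"
  then show "AE u in (ball_family k :: (nat \<Rightarrow> 'a) measure). norm (u j) \<le> 1"
    by (intro AE_PiM_component prob_space_ball_measure AE_ball_measure_norm)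
qed simp

text \<open>The mean of the limit is the limit of the means by dominated convergence, and each mean
  is a polynomial of degree at most k in the scale, divided by the k-th power of the scale.\<close>

lemma integral_zonotope_density:
  fixes K :: "(real ^ 'n) set"
  assumes dk: "CARD('d::finite) + k = CARD('n)" and K: "convex_body K"
  shows "integrable (ball_family k) (zonotope_density k K)"
    and "(\<integral>u. zonotope_density k K u \<partial>ball_family k) = fact k * ball_mean TYPE('n) ^ k * coeff (steiner_poly K) k"
    and "AE u in ball_family k. zonotope_density k K u = relative_volume (normal_flat k u) (zonotope k u) *
      projected_volume TYPE(real ^ 'd) (normal_flat k u) K / measure lborel (cball (0 :: real ^ 'd) 1)"
proof -
  let ?V = "\<lambda>N u. measure lborel (K + (*\<^sub>R) (real (Suc N)) ` zonotope k u) / real (Suc N) ^ k"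
  let ?M = "ball_family k :: (nat \<Rightarrow> real ^ 'n) measure"
  let ?c = "ball_mean TYPE('n)"
  interpret prob_space ?M by (rule prob_space_ball_family)
  obtain f G H where pot: "potential K f G H"
    using exists_potential[of K] K by (auto simp: convex_body_def)
  obtain C where C: "\<And>u r. independent_family k u \<Longrightarrow> (\<And>j. j < k \<Longrightarrow> norm (u j) \<le> 1) \<Longrightarrow> 1 \<le> r \<Longrightarrow>
    measure lborel (K + (*\<^sub>R) r ` zonotope k u) / r ^ k \<le> C"
    using volume_add_zonotope_bound[OF dk K] by blast
  have reg: "AE u in ?M. gs_regular k u" by (rule AE_gs_regular) (use dk in simp)
  have lim: "AE u in ?M. (\<lambda>N. ?V N u) \<longlonglongrightarrow> zonotope_density k K u \<and>
      zonotope_density k K u = relative_volume (normal_flat k u) (zonotope k u) *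
      projected_volume TYPE(real ^ 'd) (normal_flat k u) K / measure lborel (cball (0 :: real ^ 'd) 1)"
    using reg
  proof eventually_elim
    case (elim u)
    note t = tendsto_volume_add_zonotope[OF K gs_regular_independent[OF elim] dk]
    then show ?case using limI[OF t] by (simp add: zonotope_density_def)
  qed
  then show "AE u in ?M. zonotope_density k K u = relative_volume (normal_flat k u) (zonotope k u) *
      projected_volume TYPE(real ^ 'd) (normal_flat k u) K / measure lborel (cball (0 :: real ^ 'd) 1)"
    by eventually_elim simp
  have meas: "?V N \<in> borel_measurable ?M" for N
    by (intro borel_measurable_divide measurable_measure_add_zonotope[OF pot K]) auto
  have measL: "zonotope_density k K \<in> borel_measurable ?M"
    unfolding zonotope_density_def[abs_def] by (intro borel_measurable_lim_metric meas)
  have bound: "AE u in ?M. norm (?V N u) \<le> C" for N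
    using reg AE_ball_family_norm
  proof eventually_elim
    case (elim u)
    then have "?V N u \<le> C" by (intro C gs_regular_independent) auto
    then show ?case by simp
  qed
  have limAE: "AE u in ?M. (\<lambda>N. ?V N u) \<longlonglongrightarrow> zonotope_density k K u" using lim by eventually_elim (erule conjunct1)
  show int: "integrable ?M (zonotope_density k K)"
    by (rule integrable_dominated_convergence[OF measL meas _ limAE bound]) simp
  have conv: "(\<lambda>N. \<integral>u. ?V N u \<partial>?M) \<longlonglongrightarrow> (\<integral>u. zonotope_density k K u \<partial>?M)"
    by (rule integral_dominated_convergence[OF measL meas _ limAE bound]) simp
  have val: "(\<integral>u. ?V N u \<partial>?M) = (\<Sum>m\<le>k. real (k choose m) * fact m * ?c ^ m * coeff (steiner_poly K) m * (1 / real (Suc N)) ^ (k - m))" for N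
  proof -
    have "(\<integral>u. ?V N u \<partial>?M) = (\<Sum>m\<le>k. real (k choose m) * fact m * (real (Suc N) * ?c) ^ m * coeff (steiner_poly K) m) / real (Suc N) ^ k"
      using mean_measure_add_zonotope(2)[OF pot K, of "real (Suc N)" k] by simp
    also have "\<dots> = (\<Sum>m\<le>k. real (k choose m) * fact m * ?c ^ m * coeff (steiner_poly K) m * (1 / real (Suc N)) ^ (k - m))"
      unfolding sum_divide_distrib
    proof (rule sum.cong)
      fix m assume "m \<in> {..k}"
      then have "real (Suc N) ^ k = real (Suc N) ^ (k - m) * real (Suc N) ^ m" by (simp add: power_add[symmetric])
      then show "real (k choose m) * fact m * (real (Suc N) * ?c) ^ m * coeff (steiner_poly K) m / real (Suc N) ^ k =
          real (k choose m) * fact m * ?c ^ m * coeff (steiner_poly K) m * (1 / real (Suc N)) ^ (k - m)"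
        by (simp add: power_mult_distrib power_divide del: of_nat_Suc)
    qed simp
    finally show ?thesis .
  qed
  have "(\<lambda>N. 1 / real (Suc N)) \<longlonglongrightarrow> 0"
    using LIMSEQ_inverse_real_of_nat by (simp add: inverse_eq_divide)
  then have "(\<lambda>N. \<Sum>m\<le>k. real (k choose m) * fact m * ?c ^ m * coeff (steiner_poly K) m * (1 / real (Suc N)) ^ (k - m)) \<longlonglongrightarrow>
      (\<Sum>m\<le>k. real (k choose m) * fact m * ?c ^ m * coeff (steiner_poly K) m * 0 ^ (k - m))"
    by (intro tendsto_sum tendsto_mult tendsto_const tendsto_power)
  \<comment> \<open>Only \<open>m = k\<close> survives, since \<open>0 ^ 0 = 1\<close>.\<close>
  also have "(\<Sum>m\<le>k. real (k choose m) * fact m * ?c ^ m * coeff (steiner_poly K) m * 0 ^ (k - m)) =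
      (\<Sum>m\<le>k. if m = k then fact k * ?c ^ k * coeff (steiner_poly K) k else 0)"
    by (intro sum.cong) auto
  also have "\<dots> = fact k * ?c ^ k * coeff (steiner_poly K) k" by simp
  finally show "(\<integral>u. zonotope_density k K u \<partial>?M) = fact k * ?c ^ k * coeff (steiner_poly K) k"
    using conv unfolding val by (rule LIMSEQ_unique[rotated])
qed

lemma steiner_poly_orthogonal_image:
  fixes K :: "(real ^ 'n) set" and h :: "real ^ 'n \<Rightarrow> real ^ 'n"
  assumes h: "orthogonal_transformation h" and K: "convex_body K"
  shows "convex_body (h ` K)" "steiner_poly (h ` K) = steiner_poly K"
proof -
  note lin = orthogonal_transformation_linear[OF h]
  show cb: "convex_body (h ` K)"
    using K lin by (auto simp: convex_body_def compact_linear_image_euclidean convex_linear_image)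
  have ball: "h ` cball 0 1 = cball 0 1"
    using image_orthogonal_transformation_cball[OF h, of 0 1] linear_0[OF lin] by simp
  have "measure lborel (h ` K + (*\<^sub>R) r ` cball 0 1) = measure lborel (K + (*\<^sub>R) r ` cball 0 1)" for r
  proof -
    have "h ` (K + (*\<^sub>R) r ` cball 0 1) = h ` K + h ` (*\<^sub>R) r ` cball 0 1"
      unfolding set_plus_image image_image by (force simp: linear_add[OF lin] image_iff)
    also have "h ` (*\<^sub>R) r ` cball 0 1 = (*\<^sub>R) r ` h ` cball 0 1"
      by (simp add: image_image linear_scale[OF lin])
    finally have eq: "h ` K + (*\<^sub>R) r ` cball 0 1 = h ` (K + (*\<^sub>R) r ` cball 0 1)" by (simp add: ball)
    have "convex_body (h ` K + (*\<^sub>R) r ` cball 0 1)" by (intro convex_body_add cb convex_body_scale convex_body_cball) simp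
    then have "emeasure lborel (h ` (K + (*\<^sub>R) r ` cball 0 1)) = emeasure lborel (K + (*\<^sub>R) r ` cball 0 1)"
      unfolding eq by (intro emeasure_orthogonal_image h convex_body_sets)
    then show ?thesis unfolding eq by (simp add: measure_def)
  qed
  then show "steiner_poly (h ` K) = steiner_poly K" by (simp add: steiner_poly_def)
qed

lemma convex_scale_add:
  fixes B :: "'a::real_vector set"
  assumes B: "convex B" and ab: "0 \<le> a" "0 \<le> b"
  shows "(*\<^sub>R) a ` B + (*\<^sub>R) b ` B = (*\<^sub>R) (a + b) ` B"
proof (intro equalityI subsetI)
  fix z assume "z \<in> (*\<^sub>R) a ` B + (*\<^sub>R) b ` B"
  then obtain x y where xy: "x \<in> B" "y \<in> B" "z = a *\<^sub>R x + b *\<^sub>R y" by (auto elim!: set_plus_elim)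
  show "z \<in> (*\<^sub>R) (a + b) ` B"
  proof (cases "a + b = 0")
    case True
    then have "a = 0" "b = 0" using ab by auto
    then show ?thesis using xy by auto
  next
    case False
    then have "(a / (a + b)) *\<^sub>R x + (b / (a + b)) *\<^sub>R y \<in> B"
      using xy ab by (intro convexD[OF B]) (auto simp: add_divide_distrib[symmetric])
    moreover have "z = (a + b) *\<^sub>R ((a / (a + b)) *\<^sub>R x + (b / (a + b)) *\<^sub>R y)"
      using False by (simp add: xy scaleR_add_right)
    ultimately show ?thesis by blast
  qed
next
  fix z assume "z \<in> (*\<^sub>R) (a + b) ` B"
  then obtain x where "x \<in> B" "z = a *\<^sub>R x + b *\<^sub>R x" by (auto simp: scaleR_add_left)
  then show "z \<in> (*\<^sub>R) a ` B + (*\<^sub>R) b ` B" by (auto intro: set_plus_intro)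
qed

text \<open>From B + s B = (1 + s) B the Steiner polynomial of the unit ball is Vol(B) (1 + s)^n.
  This supplies the normalisation when bodies are compared with the ball.\<close>

lemma steiner_poly_unit_ball:
  assumes "k \<le> CARD('n)"
  shows "coeff (steiner_poly (cball (0 :: real ^ 'n) 1)) k = real (CARD('n) choose k) * measure lborel (cball (0 :: real ^ 'n) 1)"
proof -
  let ?n = "CARD('n)" and ?B = "cball (0 :: real ^ 'n) 1"
  have "steiner_poly ?B = smult (measure lborel ?B) ([:1, 1:] ^ ?n)"
  proof (rule poly_eqI_degree[of "real ` {..?n}"])
    fix x assume "x \<in> real ` {..?n}"
    then have x: "0 \<le> x" by auto
    have "?B + (*\<^sub>R) x ` ?B = cball 0 (1 + x)"
    proof -
      have "?B + (*\<^sub>R) x ` ?B = (*\<^sub>R) (1 + x) ` ?B"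
        using convex_scale_add[of ?B 1 x] x by simp
      also have "\<dots> = cball 0 (1 + x)"
        using x cball_scale[of "1 + x" "0 :: real ^ 'n" 1] by simp
      finally show ?thesis .
    qed
    then have "poly (steiner_poly ?B) x = measure lborel (cball (0 :: real ^ 'n) (1 + x))"
      using poly_steiner_poly[OF convex_body_cball[of 1 "0 :: real ^ 'n"] x] by simp
    also have "\<dots> = measure lborel ?B * (1 + x) ^ ?n" using x by (simp add: content_cball)
    finally show "poly (steiner_poly ?B) x = poly (smult (measure lborel ?B) ([:1, 1:] ^ ?n)) x" by simp
  next
    have c: "card (real ` {..?n}) = Suc ?n" by (simp add: card_image)
    show "degree (steiner_poly ?B) < card (real ` {..?n})" using degree_steiner_poly[of ?B] c by simp
    have "degree (smult (measure lborel ?B) ([:1, 1:] ^ ?n)) \<le> ?n"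
      by (rule order_trans[OF degree_smult_le]) (rule order_trans[OF degree_power_le], simp)
    then show "degree (smult (measure lborel ?B) ([:1, 1:] ^ ?n)) < card (real ` {..?n})" using c by simp
  qed
  then show ?thesis using assms by (simp add: coeff_linear_poly_power)
qed

section \<open>Mean projected volumes\<close>

text \<open>For a regular family the frame spans the same space as \<open>u\<close>, so removing the
  components along it projects onto the normal flat, by a formula that is measurable in
  \<open>u\<close>.\<close>

definition gs_projection_matrix :: "nat \<Rightarrow> (nat \<Rightarrow> real ^ 'n) \<Rightarrow> real ^ 'n ^ 'n" where
  "gs_projection_matrix k u = matrix (\<lambda>x. x - (\<Sum>j<k. (x \<bullet> gram_schmidt u j) *\<^sub>R gram_schmidt u j))"

lemma gs_projection_matrix:
  fixes u :: "nat \<Rightarrow> real ^ 'n"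
  assumes u: "gs_regular k u"
  shows "gs_projection_matrix k u = matrix (orthogonal_projection (normal_flat k u))"
proof -
  have "orthogonal_projection (normal_flat k u) x = x - (\<Sum>j<k. (x \<bullet> gram_schmidt u j) *\<^sub>R gram_schmidt u j)" (is "_ = ?y") for x
  proof (rule orthogonal_projection_unique[OF subspace_normal_flat])
    have gs: "?y \<bullet> gram_schmidt u i = 0" if "i < k" for i
    proof -
      have "(\<Sum>j<k. (x \<bullet> gram_schmidt u j) * (gram_schmidt u j \<bullet> gram_schmidt u i)) =
          (\<Sum>j<k. if j = i then x \<bullet> gram_schmidt u i else 0)"
        using gram_schmidt_orthonormal[OF u] that by (intro sum.cong) auto
      then show ?thesis using that by (simp add: inner_diff_left inner_sum_left)
    qed
    have "orthogonal ?y b" if "b \<in> span (gram_schmidt u ` {..<k})" for b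
      using that gs by (intro orthogonal_to_span[OF that]) (auto simp: orthogonal_def)
    then show "?y \<in> normal_flat k u"
      unfolding span_gram_schmidt[OF u] by (auto simp: normal_flat_def orthogonal_def span_base)
    fix z assume z: "z \<in> normal_flat k u"
    have "gram_schmidt u j \<bullet> z = 0" if "j < k" for j
    proof -
      have "gram_schmidt u j \<in> span (gram_schmidt u ` {..<k})" using that by (intro span_base) auto
      then show ?thesis
        unfolding span_gram_schmidt[OF u] by (subst inner_commute) (rule normal_flat_orthogonal_span[OF z])
    qed
    then show "(x - ?y) \<bullet> z = 0" by (simp add: inner_sum_left)
  qed
  then have "orthogonal_projection (normal_flat k u) = (\<lambda>x. x - (\<Sum>j<k. (x \<bullet> gram_schmidt u j) *\<^sub>R gram_schmidt u j))"
    by (rule ext)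
  then show ?thesis by (simp only: gs_projection_matrix_def)
qed

lemma borel_measurable_gs_projection_matrix:
  "gs_projection_matrix k \<in> borel_measurable (ball_family k :: (nat \<Rightarrow> real ^ 'n) measure)"
  unfolding gs_projection_matrix_def[abs_def]
  by (intro borel_measurable_matrix borel_measurable_diff borel_measurable_const borel_measurable_sum borel_measurable_scaleR
      borel_measurable_inner measurable_gram_schmidt) auto

text \<open>Rotating \<open>K\<close> by a random frame does not change its Steiner polynomial, but turns the normal
  flat of each zonotope into a uniformly distributed one.\<close>

lemma steiner_poly_mean_shadow:
  fixes K :: "(real ^ 'n) set" and T :: "(real ^ 'n) set"
  assumes dk: "CARD('d::finite) + k = CARD('n)" and K: "convex_body K" and T: "subspace T" "dim T = CARD('d)"
  shows "ennreal (relative_volume T (cball 0 1) * coeff (steiner_poly K) k) =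
    ennreal (coeff (steiner_poly (cball (0 :: real ^ 'n) 1)) k) * mean_shadow K T"
proof -
  let ?N = "ball_family CARD('n) :: (nat \<Rightarrow> real ^ 'n) measure"
  let ?M = "ball_family k :: (nat \<Rightarrow> real ^ 'n) measure"
  let ?B = "cball (0 :: real ^ 'n) 1" and ?\<kappa> = "measure lborel (cball (0 :: real ^ 'd) 1)"
  let ?\<gamma> = "relative_volume T (cball 0 1)"
  let ?c = "fact k * ball_mean TYPE('n) ^ k"
  interpret M: prob_space ?M by (rule prob_space_ball_family)
  interpret N: prob_space ?N by (rule prob_space_ball_family)
  interpret P: pair_sigma_finite ?M ?N by standard
  have \<gamma>: "0 < ?\<gamma>" by (rule relative_volume_cball_pos[OF T(1)])
  have \<kappa>: "0 < ?\<kappa>" by (simp add: content_cball_pos)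
  have c: "0 < ?c" using ball_mean_pos[where 'n='n] by simp
  have B: "convex_body ?B" by (intro convex_body_cball) simp
  have cK: "compact K" "K \<noteq> {}" using K by (auto simp: convex_body_def)
  note dB = integral_zonotope_density[OF dk B]
  have regk: "AE u in ?M. gs_regular k u" by (rule AE_gs_regular) (use dk in simp)
  have regn: "AE X in ?N. gs_regular CARD('n) X" by (rule AE_gs_regular) simp
  have flat: "subspace (normal_flat k u)" "dim (normal_flat k u) = DIM(real ^ 'd)" "dim (normal_flat k u) = dim T"
    if "gs_regular k u" for u :: "nat \<Rightarrow> real ^ 'n"
    using subspace_normal_flat[of k u] dim_normal_flat[OF gs_regular_independent[OF that]] dk T by auto
  \<comment> \<open>The unit ball projects to a unit ball of volume \<open>?\<kappa>\<close>, so
    this density is almost surely the relative volume of the zonotope alone. It is the weight with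
    which the normal flat occurs.\<close>
  let ?L = "zonotope_density k ?B"
  have L0: "AE u in ?M. 0 \<le> ?L u"
    using dB(3)
    by eventually_elim (simp add: relative_volume_def projected_volume_def)
  have measL: "(\<lambda>u. ennreal (?L u)) \<in> borel_measurable ?M" using dB(1) by simp
  let ?\<Phi> = "\<lambda>u X. ennreal (?L u) * matrix_shadow K (frame_conj X (gs_projection_matrix k u))"
  have joint: "(\<lambda>(u, X). ?\<Phi> u X) \<in> borel_measurable (?M \<Otimes>\<^sub>M ?N)"
    unfolding split_beta
    by (intro borel_measurable_times_ennreal measurable_compose[OF measurable_fst measL]
        measurable_compose[OF borel_measurable_frame_conj borel_measurable_matrix_shadow] cK
        measurable_compose[OF measurable_fst borel_measurable_gs_projection_matrix] measurable_snd)
  \<comment> \<open>First order of integration: for a fixed rotation, weight times shadow is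
    \<open>?\<gamma>\<close> times the density of the rotated body, and the mean of that density
    involves only the Steiner polynomial, which the rotation does not change.\<close>
  have inner: "(\<integral>\<^sup>+u. ?\<Phi> u X \<partial>?M) = ennreal (?\<gamma> * (?c * coeff (steiner_poly K) k))" if X: "gs_regular CARD('n) X" for X
  proof -
    have o: "orthogonal_transformation (frame_map X)"
      by (rule orthogonal_transformation_frame_map) (use X in simp)
    let ?K = "frame_map X ` K"
    note K' = steiner_poly_orthogonal_image[OF o K]
    note dK = integral_zonotope_density[OF dk K'(1)]
    have L0': "AE u in ?M. 0 \<le> zonotope_density k ?K u"
      using dK(3) by eventually_elim (simp add: relative_volume_def projected_volume_def)
    have "AE u in ?M. ?\<Phi> u X = ennreal (?\<gamma> * zonotope_density k ?K u)"
      using regk dK(3) dB(3) L0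
    proof eventually_elim
      case (elim u)
      note S = flat[OF elim(1)]
      have "?\<Phi> u X = ennreal (?L u) * shadow (normal_flat k u) ?K"
        by (simp add: gs_projection_matrix[OF elim(1)] matrix_shadow_frame_conj[OF X S(1) cK(1)])
      also have "shadow (normal_flat k u) ?K = ennreal (?\<gamma> * projected_volume TYPE(real ^ 'd) (normal_flat k u) ?K / ?\<kappa>)"
        using shadow_eq_projected_volume[OF S(1,2), of ?K] K'(1) relative_volume_cball_cong[OF S(1) T(1) S(3)]
        by (simp add: convex_body_def)
      also have "ennreal (?L u) * \<dots> = ennreal (?L u * (?\<gamma> * projected_volume TYPE(real ^ 'd) (normal_flat k u) ?K / ?\<kappa>))"
        by (rule ennreal_mult'[symmetric, OF elim(4)])
      also have "?L u * (?\<gamma> * projected_volume TYPE(real ^ 'd) (normal_flat k u) ?K / ?\<kappa>) = ?\<gamma> * zonotope_density k ?K u"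
      proof -
        have "?L u = relative_volume (normal_flat k u) (zonotope k u)"
          using elim(3) \<kappa> by (simp add: projected_volume_cball[OF S(1,2)])
        then show ?thesis by (simp add: elim(2))
      qed
      finally show ?case .
    qed
    then have "(\<integral>\<^sup>+u. ?\<Phi> u X \<partial>?M) = (\<integral>\<^sup>+u. ennreal (?\<gamma> * zonotope_density k ?K u) \<partial>?M)"
      by (rule nn_integral_cong_AE)
    also have "\<dots> = ennreal (\<integral>u. ?\<gamma> * zonotope_density k ?K u \<partial>?M)"
      using dK(1) L0' \<gamma> by (intro nn_integral_eq_integral) auto
    also have "(\<integral>u. ?\<gamma> * zonotope_density k ?K u \<partial>?M) = ?\<gamma> * (?c * coeff (steiner_poly K) k)"
      using dK(2) by (simp add: K'(2))
    finally show ?thesis .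
  qed
  have "ennreal (?\<gamma> * (?c * coeff (steiner_poly K) k)) = (\<integral>\<^sup>+X. (\<integral>\<^sup>+u. ?\<Phi> u X \<partial>?M) \<partial>?N)"
  proof -
    have "AE X in ?N. (\<integral>\<^sup>+u. ?\<Phi> u X \<partial>?M) = ennreal (?\<gamma> * (?c * coeff (steiner_poly K) k))"
      using regn by eventually_elim (rule inner)
    then have "(\<integral>\<^sup>+X. (\<integral>\<^sup>+u. ?\<Phi> u X \<partial>?M) \<partial>?N) = (\<integral>\<^sup>+X. ennreal (?\<gamma> * (?c * coeff (steiner_poly K) k)) \<partial>?N)"
      by (rule nn_integral_cong_AE)
    then show ?thesis by (simp only: nn_integral_const N.emeasure_space_1 mult_1_right)
  qed
  also have "\<dots> = (\<integral>\<^sup>+u. (\<integral>\<^sup>+X. ?\<Phi> u X \<partial>?N) \<partial>?M)"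
    by (rule P.Fubini'[OF joint])
  \<comment> \<open>Second order: for a fixed \<open>u\<close> the rotations average the shadow to a
    value independent of the flat, and the weight factors out.\<close>
  also have "\<dots> = (\<integral>\<^sup>+u. ennreal (?L u) * mean_shadow K T \<partial>?M)"
    using regk
  proof (intro nn_integral_cong_AE, eventually_elim)
    fix u :: "nat \<Rightarrow> real ^ 'n" assume u: "gs_regular k u"
    note S = flat[OF u]
    have "(\<integral>\<^sup>+X. ?\<Phi> u X \<partial>?N) = ennreal (?L u) * (\<integral>\<^sup>+X. matrix_shadow K (frame_conj X (gs_projection_matrix k u)) \<partial>?N)"
      by (intro nn_integral_cmult measurable_compose[OF borel_measurable_frame_conj borel_measurable_matrix_shadow] cK) auto
    also have "(\<integral>\<^sup>+X. matrix_shadow K (frame_conj X (gs_projection_matrix k u)) \<partial>?N) = mean_shadow K (normal_flat k u)"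
      by (simp add: gs_projection_matrix[OF u] mean_shadow_def)
    also have "\<dots> = mean_shadow K T" by (rule mean_shadow_cong[OF cK S(1) T(1) S(3)])
    finally show "(\<integral>\<^sup>+X. ?\<Phi> u X \<partial>?N) = ennreal (?L u) * mean_shadow K T" .
  qed
  also have "\<dots> = (\<integral>\<^sup>+u. ennreal (?L u) \<partial>?M) * mean_shadow K T"
    by (rule nn_integral_multc[OF measL])
  also have "(\<integral>\<^sup>+u. ennreal (?L u) \<partial>?M) = ennreal (?c * coeff (steiner_poly ?B) k)"
    using nn_integral_eq_integral[OF dB(1) L0] dB(2) by simp
  also have "?\<gamma> * (?c * coeff (steiner_poly K) k) = ?c * (?\<gamma> * coeff (steiner_poly K) k)"
    by (rule mult.left_commute)
  \<comment> \<open>The constant \<open>?c\<close>, which contains \<open>ball_mean\<close>, is the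
    same for \<open>K\<close> and for the ball and cancels.\<close>
  finally have "ennreal ?c * ennreal (?\<gamma> * coeff (steiner_poly K) k) =
      ennreal ?c * (ennreal (coeff (steiner_poly ?B) k) * mean_shadow K T)"
    unfolding ennreal_mult'[OF less_imp_le[OF c]] mult.assoc[of "ennreal ?c"] .
  then show ?thesis
    unfolding ennreal_mult_cancel_left ennreal_eq_0_iff using c by (auto simp only: ennreal_neq_top not_le[symmetric])
qed

text \<open>The coefficient is a positive multiple of the mean of a density that is almost surely a
  quotient of volumes. The sign is needed to pass from \<open>ennreal\<close> identities to real
  ones.\<close>

lemma coeff_steiner_poly_nonneg:
  fixes K :: "(real ^ 'n) set"
  assumes dk: "CARD('d::finite) + k = CARD('n)" and K: "convex_body K"
  shows "0 \<le> coeff (steiner_poly K) k"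
proof -
  have "AE u in ball_family k. 0 \<le> zonotope_density k K u"
    using integral_zonotope_density(3)[OF dk K]
    by eventually_elim (simp add: relative_volume_def projected_volume_def)
  then have "0 \<le> (\<integral>u. zonotope_density k K u \<partial>ball_family k)"
    by (rule integral_nonneg_AE)
  then have "0 \<le> (fact k * ball_mean TYPE('n) ^ k) * coeff (steiner_poly K) k"
    using integral_zonotope_density(2)[OF dk K] by simp
  moreover have "0 < fact k * ball_mean TYPE('n) ^ k" using ball_mean_pos[where 'n='n] by simp
  ultimately show ?thesis by (simp add: zero_le_mult_iff)
qed

lemma integral_projected_volume:
  fixes K :: "(real ^ 'n) set" and M :: "(real ^ 'n) set measure"
  assumes M: "invariant_grassmannian_probability CARD('d::finite) M"
    and dk: "CARD('d) + k = CARD('n)" and K: "convex_body K"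
  shows "integrable M (\<lambda>S. projected_volume TYPE(real ^ 'd) S K)"
    and "(\<integral>S. projected_volume TYPE(real ^ 'd) S K \<partial>M) =
      measure lborel (cball (0 :: real ^ 'd) 1) * coeff (steiner_poly K) k / coeff (steiner_poly (cball (0 :: real ^ 'n) 1)) k"
proof -
  interpret prob_space M using M by (simp add: invariant_grassmannian_probability_def)
  have space: "space M = grassmannian CARD('d)"
    using M sets_eq_imp_space_eq[of M "grassmannian_borel CARD('d)"]
    by (simp add: invariant_grassmannian_probability_def grassmannian_borel_def)
  \<comment> \<open>The space of a probability measure is nonempty, which supplies a reference
    subspace.\<close>
  obtain T where "T \<in> space M" using not_empty by blast
  then have T: "subspace T" "dim T = CARD('d)" by (auto simp: space grassmannian_def)
  let ?B = "cball (0 :: real ^ 'n) 1" and ?\<kappa> = "measure lborel (cball (0 :: real ^ 'd) 1)"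
  let ?\<gamma> = "relative_volume T (cball 0 1)" and ?q = "coeff (steiner_poly ?B) k"
  let ?J = "\<lambda>S. projected_volume TYPE(real ^ 'd) S K"
  have cK: "compact K" "K \<noteq> {}" using K by (auto simp: convex_body_def)
  have \<gamma>: "0 < ?\<gamma>" by (rule relative_volume_cball_pos[OF T(1)])
  have \<kappa>: "0 < ?\<kappa>" by (simp add: content_cball_pos)
  have q: "0 < ?q"
    using dk by (subst steiner_poly_unit_ball) (auto simp: content_cball_pos)
  have qK: "0 \<le> coeff (steiner_poly K) k" by (rule coeff_steiner_poly_nonneg[OF dk K])
  have J0: "0 \<le> ?J S" for S by (simp add: projected_volume_def)
  have sh: "shadow S K = ennreal (?\<gamma> / ?\<kappa>) * ennreal (?J S)" if "S \<in> space M" for S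
  proof -
    have S: "subspace S" "dim S = DIM(real ^ 'd)" "dim S = dim T" using that T by (auto simp: space grassmannian_def)
    have "shadow S K = ennreal (?\<gamma> / ?\<kappa> * ?J S)"
      using shadow_eq_projected_volume[OF S(1,2) cK(1)] relative_volume_cball_cong[OF S(1) T(1) S(3)] by simp
    then show ?thesis using \<gamma> \<kappa> by (simp add: ennreal_mult'[symmetric])
  qed
  note ms = invariant_grassmannian_mean_shadow[OF M cK T]
  \<comment> \<open>Up to a constant factor the integrand is the shadow, whose measurability is not
    affected by the identifications chosen for the subspaces.\<close>
  have J_meas: "?J \<in> borel_measurable M"
  proof -
    have "(\<lambda>S. enn2real (shadow S K) * (?\<kappa> / ?\<gamma>)) \<in> borel_measurable M" using ms(1) by measurable
    then show ?thesis
    proof (rule measurable_cong[THEN iffD1, rotated])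
      fix S assume "S \<in> space M"
      then show "enn2real (shadow S K) * (?\<kappa> / ?\<gamma>) = ?J S"
        using \<gamma> \<kappa> J0[of S] by (simp add: sh enn2real_mult)
    qed
  qed
  have "ennreal (?\<gamma> * coeff (steiner_poly K) k) = ennreal ?q * (\<integral>\<^sup>+S. shadow S K \<partial>M)"
    using steiner_poly_mean_shadow[OF dk K T] ms(2) by simp
  also have "(\<integral>\<^sup>+S. shadow S K \<partial>M) = (\<integral>\<^sup>+S. ennreal (?\<gamma> / ?\<kappa>) * ennreal (?J S) \<partial>M)"
    by (rule nn_integral_cong) (rule sh)
  also have "\<dots> = ennreal (?\<gamma> / ?\<kappa>) * (\<integral>\<^sup>+S. ennreal (?J S) \<partial>M)"
    using J_meas by (intro nn_integral_cmult) auto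
  also have "ennreal ?q * (ennreal (?\<gamma> / ?\<kappa>) * (\<integral>\<^sup>+S. ennreal (?J S) \<partial>M)) =
      ennreal (?q * (?\<gamma> / ?\<kappa>)) * (\<integral>\<^sup>+S. ennreal (?J S) \<partial>M)"
    by (subst ennreal_mult'[OF less_imp_le[OF q]]) (rule mult.assoc[symmetric])
  finally have "ennreal (?q * (?\<gamma> / ?\<kappa>)) * (\<integral>\<^sup>+S. ennreal (?J S) \<partial>M) = ennreal (?\<gamma> * coeff (steiner_poly K) k)"
    by (rule sym)
  also have "?\<gamma> * coeff (steiner_poly K) k = (?q * (?\<gamma> / ?\<kappa>)) * (?\<kappa> * coeff (steiner_poly K) k / ?q)"
    using q \<kappa> \<gamma> by (simp add: field_simps)
  also have "ennreal \<dots> = ennreal (?q * (?\<gamma> / ?\<kappa>)) * ennreal (?\<kappa> * coeff (steiner_poly K) k / ?q)"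
    using q \<gamma> \<kappa> by (intro ennreal_mult') auto
  finally have nn: "(\<integral>\<^sup>+S. ennreal (?J S) \<partial>M) = ennreal (?\<kappa> * coeff (steiner_poly K) k / ?q)"
    using q \<gamma> \<kappa> by (subst (asm) ennreal_mult_cancel_left) auto
  show int: "integrable M ?J"
    using nn J_meas J0 by (intro integrableI_nonneg) auto
  show "(\<integral>S. ?J S \<partial>M) = ?\<kappa> * coeff (steiner_poly K) k / ?q"
    using nn nn_integral_eq_integral[OF int] J0 q qK \<kappa>
    by (simp add: integral_nonneg_AE)
qed

section \<open>Mixed volumes as combinations of volumes of single bodies\<close>

lemma set_sum_scaled_convex:
  fixes B :: "'a::real_vector set"
  assumes B: "convex B" "B \<noteq> {}" and "finite I" "\<And>i. i \<in> I \<Longrightarrow> 0 \<le> t i"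
  shows "(\<Sum>i\<in>I. (*\<^sub>R) (t i) ` B) = (*\<^sub>R) (\<Sum>i\<in>I. t i) ` B"
  using assms(3,4)
proof (induction I rule: finite_induct)
  case empty
  then show ?case using B(2) by (auto simp: set_zero)
next
  case (insert i I)
  then show ?case using convex_scale_add[OF B(1), of "t i" "sum t I"] by (simp add: sum_nonneg)
qed

text \<open>Projection commutes with Minkowski combinations, so interpolation writes the mixed
  volume through projected volumes of single bodies, with weights independent of \<open>S\<close>.
  The number of nodes is left free: the same \<open>N\<close> in both dimensions makes the weights
  agree with those of the mixed volume that contains balls.\<close>

lemma mixed_volume_projections:
  fixes A :: "nat \<Rightarrow> (real ^ 'n) set"
  assumes S: "subspace S" "dim S = CARD('d::finite)" and A: "\<And>i. i < CARD('d) \<Longrightarrow> convex_body (A i)" and N: "CARD('d) \<le> N"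
  shows "mixed_volume (\<lambda>i. (subspace_identification S :: real ^ 'n \<Rightarrow> real ^ 'd) ` orthogonal_projection S ` A i) =
    (\<Sum>\<kappa>\<in>PiE {..<CARD('d)} (\<lambda>_. {..N}). (\<Prod>i<CARD('d). coeff (lagrange N (\<kappa> i)) 1) *
      projected_volume TYPE(real ^ 'd) S (\<Sum>i<CARD('d). (*\<^sub>R) (real (\<kappa> i)) ` A i)) / fact CARD('d)"
proof -
  let ?d = "CARD('d)"
  have S': "dim S = DIM(real ^ 'd)" using S by simp
  define \<pi> where "\<pi> = (\<lambda>x. (subspace_identification S :: real ^ 'n \<Rightarrow> real ^ 'd) (orthogonal_projection S x))"
  have lin: "linear \<pi>"
    unfolding \<pi>_def using linear_compose[OF linear_orthogonal_projection[OF S(1)] subspace_identification(1)[OF S(1) S']]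
    by (simp add: o_def)
  have img: "(subspace_identification S :: real ^ 'n \<Rightarrow> real ^ 'd) ` orthogonal_projection S ` K = \<pi> ` K" for K
    by (simp add: \<pi>_def image_image)
  have body: "convex_body (\<pi> ` A i)" if "i < ?d" for i
    using A[OF that] lin by (auto simp: convex_body_def compact_linear_image_euclidean convex_linear_image)
  have sum_img: "(\<Sum>i<?d. (*\<^sub>R) (t i) ` \<pi> ` A i) = \<pi> ` (\<Sum>i<?d. (*\<^sub>R) (t i) ` A i)" for t
    by (simp add: set_sum_linear_image[OF lin] image_image linear_scale[OF lin])
  let ?X = "PiE {..<?d} (\<lambda>_. {..N})"
  \<comment> \<open>No variable belongs to a ball here: the sum over \<open>{?d..<?d}\<close> is
    empty and the second factor is a constant polynomial.\<close>
  have rep: "measure lebesgue (\<Sum>i<DIM(real ^ 'd). (\<lambda>x. t i *\<^sub>R x) ` \<pi> ` A i) =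
      (\<Sum>\<kappa>\<in>?X. (\<Prod>i<?d. poly (lagrange N (\<kappa> i)) (t i)) *
        poly [:projected_volume TYPE(real ^ 'd) S (\<Sum>i<?d. (*\<^sub>R) (real (\<kappa> i)) ` A i):] (\<Sum>i\<in>{?d..<?d}. t i))"
    if t: "\<And>i. 0 \<le> t i" for t
  proof -
    have "convex_body (\<Sum>i<?d. (*\<^sub>R) (t i) ` \<pi> ` A i)"
      by (intro convex_body_sum convex_body_scale body) auto
    then have "measure lebesgue (\<Sum>i<DIM(real ^ 'd). (\<lambda>x. t i *\<^sub>R x) ` \<pi> ` A i) = measure lborel (\<Sum>i<?d. (*\<^sub>R) (t i) ` \<pi> ` A i)"
      using convex_body_measure_lebesgue by simp
    also have "\<dots> = (\<Sum>\<kappa>\<in>?X. measure lborel (\<Sum>i<?d. (*\<^sub>R) (if i \<in> {..<?d} then real (\<kappa> i) else t i) ` \<pi> ` A i) *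
        (\<Prod>i<?d. poly (lagrange N (\<kappa> i)) (t i)))"
      by (rule volume_interpolation[OF body _ t N]) auto
    also have "\<dots> = (\<Sum>\<kappa>\<in>?X. (\<Prod>i<?d. poly (lagrange N (\<kappa> i)) (t i)) *
        poly [:projected_volume TYPE(real ^ 'd) S (\<Sum>i<?d. (*\<^sub>R) (real (\<kappa> i)) ` A i):] (\<Sum>i\<in>{?d..<?d}. t i))"
      unfolding projected_volume_def img sum_img[symmetric] by (intro sum.cong) simp_all
    finally show ?thesis .
  qed
  have "orthant_partials [0..<?d] (\<lambda>t. measure lebesgue (\<Sum>i<DIM(real ^ 'd). (\<lambda>x. t i *\<^sub>R x) ` \<pi> ` A i)) (\<lambda>_. 0) =
      (\<Sum>\<kappa>\<in>?X. (\<Prod>i<?d. coeff (lagrange N (\<kappa> i)) 1) * (fact (?d - ?d) *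
        coeff [:projected_volume TYPE(real ^ 'd) S (\<Sum>i<?d. (*\<^sub>R) (real (\<kappa> i)) ` A i):] (?d - ?d)))"
    by (rule orthant_partials_separated_0[OF rep order_refl])
  then show ?thesis
    by (simp add: mixed_volume_def img)
qed

text \<open>Only the first \<open>d\<close> variables are interpolated. Convexity of the ball merges
  the other summands into one ball scaled by the sum of their variables, so the remaining
  derivatives act on a Steiner polynomial in one variable, and the factorial comes from its
  coefficient of that order.\<close>

lemma mixed_volume_with_balls:
  fixes A :: "nat \<Rightarrow> (real ^ 'n) set"
  assumes d: "d \<le> CARD('n)" and A: "\<And>i. i < d \<Longrightarrow> convex_body (A i)"
  shows "mixed_volume (\<lambda>i. if i < d then A i else cball 0 1) =
    (\<Sum>\<kappa>\<in>PiE {..<d} (\<lambda>_. {..CARD('n)}). (\<Prod>i<d. coeff (lagrange CARD('n) (\<kappa> i)) 1) *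
      (fact (CARD('n) - d) * coeff (steiner_poly (\<Sum>i<d. (*\<^sub>R) (real (\<kappa> i)) ` A i)) (CARD('n) - d))) / fact CARD('n)"
proof -
  let ?n = "CARD('n)" and ?X = "PiE {..<d} (\<lambda>_. {..CARD('n)})"
  let ?K = "\<lambda>i. if i < d then A i else cball 0 1"
  have body: "convex_body (?K i)" for i using A[of i] convex_body_cball[of 1 "0 :: real ^ 'n"] by simp
  have rep: "measure lebesgue (\<Sum>i<DIM(real ^ 'n). (\<lambda>x. t i *\<^sub>R x) ` ?K i) =
      (\<Sum>\<kappa>\<in>?X. (\<Prod>i<d. poly (lagrange ?n (\<kappa> i)) (t i)) *
        poly (steiner_poly (\<Sum>i<d. (*\<^sub>R) (real (\<kappa> i)) ` A i)) (\<Sum>i\<in>{d..<?n}. t i))"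
    if t: "\<And>i. 0 \<le> t i" for t
  proof -
    have split: "(\<Sum>i<?n. (*\<^sub>R) (if i \<in> {..<d} then real (\<kappa> i) else t i) ` ?K i) =
        (\<Sum>i<d. (*\<^sub>R) (real (\<kappa> i)) ` A i) + (*\<^sub>R) (\<Sum>i\<in>{d..<?n}. t i) ` cball 0 1" for \<kappa>
    proof -
      have u: "{..<?n} = {..<d} \<union> {d..<?n}" "{..<d} \<inter> {d..<?n} = {}" using d by auto
      have "(\<Sum>i<?n. (*\<^sub>R) (if i \<in> {..<d} then real (\<kappa> i) else t i) ` ?K i) =
          (\<Sum>i<d. (*\<^sub>R) (if i \<in> {..<d} then real (\<kappa> i) else t i) ` ?K i) +
          (\<Sum>i\<in>{d..<?n}. (*\<^sub>R) (if i \<in> {..<d} then real (\<kappa> i) else t i) ` ?K i)"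
        unfolding u(1) by (rule sum.union_disjoint) (use u in auto)
      also have "\<dots> = (\<Sum>i<d. (*\<^sub>R) (real (\<kappa> i)) ` A i) + (\<Sum>i\<in>{d..<?n}. (*\<^sub>R) (t i) ` cball 0 1)"
        by (intro arg_cong2[of _ _ _ _ "(+)"] sum.cong) auto
      also have "(\<Sum>i\<in>{d..<?n}. (*\<^sub>R) (t i) ` cball (0 :: real ^ 'n) 1) = (*\<^sub>R) (\<Sum>i\<in>{d..<?n}. t i) ` cball 0 1"
        by (rule set_sum_scaled_convex) (use t in auto)
      finally show ?thesis .
    qed
    have "convex_body (\<Sum>i<?n. (*\<^sub>R) (t i) ` ?K i)"
      by (intro convex_body_sum convex_body_scale body) auto
    then have "measure lebesgue (\<Sum>i<DIM(real ^ 'n). (\<lambda>x. t i *\<^sub>R x) ` ?K i) = measure lborel (\<Sum>i<?n. (*\<^sub>R) (t i) ` ?K i)"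
      using convex_body_measure_lebesgue by simp
    also have "\<dots> = (\<Sum>\<kappa>\<in>?X. measure lborel (\<Sum>i<?n. (*\<^sub>R) (if i \<in> {..<d} then real (\<kappa> i) else t i) ` ?K i) *
        (\<Prod>i<d. poly (lagrange ?n (\<kappa> i)) (t i)))"
      by (rule volume_interpolation[OF body _ t order_refl]) (use d in auto)
    also have "\<dots> = (\<Sum>\<kappa>\<in>?X. (\<Prod>i<d. poly (lagrange ?n (\<kappa> i)) (t i)) *
        poly (steiner_poly (\<Sum>i<d. (*\<^sub>R) (real (\<kappa> i)) ` A i)) (\<Sum>i\<in>{d..<?n}. t i))"
    proof (rule sum.cong)
      fix \<kappa> :: "nat \<Rightarrow> nat"
      have s: "0 \<le> (\<Sum>i\<in>{d..<?n}. t i)" by (intro sum_nonneg t)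
      have K: "convex_body (\<Sum>i<d. (*\<^sub>R) (real (\<kappa> i)) ` A i)" by (intro convex_body_sum convex_body_scale A) auto
      show "measure lborel (\<Sum>i<?n. (*\<^sub>R) (if i \<in> {..<d} then real (\<kappa> i) else t i) ` ?K i) * (\<Prod>i<d. poly (lagrange ?n (\<kappa> i)) (t i)) =
          (\<Prod>i<d. poly (lagrange ?n (\<kappa> i)) (t i)) * poly (steiner_poly (\<Sum>i<d. (*\<^sub>R) (real (\<kappa> i)) ` A i)) (\<Sum>i\<in>{d..<?n}. t i)"
        unfolding split poly_steiner_poly[OF K s] by (rule mult.commute)
    qed simp
    finally show ?thesis .
  qed
  have "orthant_partials [0..<?n] (\<lambda>t. measure lebesgue (\<Sum>i<DIM(real ^ 'n). (\<lambda>x. t i *\<^sub>R x) ` ?K i)) (\<lambda>_. 0) =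
      (\<Sum>\<kappa>\<in>?X. (\<Prod>i<d. coeff (lagrange ?n (\<kappa> i)) 1) * (fact (?n - d) *
        coeff (steiner_poly (\<Sum>i<d. (*\<^sub>R) (real (\<kappa> i)) ` A i)) (?n - d)))"
    by (rule orthant_partials_separated_0[OF rep d])
  then show ?thesis by (simp add: mixed_volume_def)
qed

theorem theorem1:
  fixes A :: "nat \<Rightarrow> (real ^ 'n) set"
    and M :: "(real ^ 'n) set measure"
  assumes "CARD('d::finite) \<le> CARD('n)"
    and "\<And>i. i < CARD('d) \<Longrightarrow> A i \<noteq> {} \<and> compact (A i) \<and> convex (A i)"
    and "invariant_grassmannian_probability CARD('d) M"
  shows "(\<integral>S. mixed_volume
              (\<lambda>i. (subspace_identification S :: real ^ 'n \<Rightarrow> real ^ 'd)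
                     ` orthogonal_projection S ` A i) \<partial>M)
         \<le> measure lebesgue (cball (0 :: real ^ 'd) 1) / measure lebesgue (cball (0 :: real ^ 'n) 1)
            * mixed_volume (\<lambda>i. if i < CARD('d) then A i else cball 0 1)"
proof -
  let ?d = "CARD('d)" and ?n = "CARD('n)"
  let ?X = "PiE {..<?d} (\<lambda>_. {..?n})"
  let ?w = "\<lambda>\<kappa>. \<Prod>i<?d. coeff (lagrange ?n (\<kappa> i)) 1"
  let ?K = "\<lambda>\<kappa>. \<Sum>i<?d. (*\<^sub>R) (real (\<kappa> i)) ` A i"
  let ?k = "?n - ?d"
  let ?\<kappa>d = "measure lborel (cball (0 :: real ^ 'd) 1)" and ?\<kappa>n = "measure lborel (cball (0 :: real ^ 'n) 1)"
  have A: "\<And>i. i < ?d \<Longrightarrow> convex_body (A i)" using assms(2) by (auto simp: convex_body_def)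
  have K: "convex_body (?K \<kappa>)" for \<kappa> by (intro convex_body_sum convex_body_scale A) auto
  have dk: "?d + ?k = ?n" using assms(1) by simp
  note pv = integral_projected_volume[OF assms(3) dk K]
  have space: "space M = grassmannian ?d"
    using assms(3) sets_eq_imp_space_eq[of M "grassmannian_borel ?d"]
    by (simp add: invariant_grassmannian_probability_def grassmannian_borel_def)
  have pos: "0 < ?\<kappa>n" by (simp add: content_cball_pos)
  \<comment> \<open>The binomial coefficient is written in factorials: \<open>fact ?k\<close> meets
    the factor from the ball variables, \<open>fact ?n\<close> and \<open>fact ?d\<close> the
    normalisations of the two mixed volumes.\<close>
  have q: "coeff (steiner_poly (cball (0 :: real ^ 'n) 1)) ?k = fact ?n / (fact ?k * fact ?d) * ?\<kappa>n"
    using steiner_poly_unit_ball[of ?k, where 'n='n] binomial_fact[of ?k ?n, where 'a=real] assms(1) by simp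
  \<comment> \<open>With \<open>?n\<close> as the number \<open>N\<close> of
    \<open>mixed_volume_projections\<close>, both sides become combinations over the same
    \<open>\<kappa>\<close> with the same weights \<open>?w\<close>, which have both signs; the
    single bodies \<open>?K \<kappa>\<close> then match term by term.\<close>
  have "(\<integral>S. mixed_volume (\<lambda>i. (subspace_identification S :: real ^ 'n \<Rightarrow> real ^ 'd) ` orthogonal_projection S ` A i) \<partial>M) =
      (\<integral>S. (\<Sum>\<kappa>\<in>?X. ?w \<kappa> * projected_volume TYPE(real ^ 'd) S (?K \<kappa>)) / fact ?d \<partial>M)"
    by (intro Bochner_Integration.integral_cong refl mixed_volume_projections A assms(1)) (auto simp: space grassmannian_def)
  also have "\<dots> = (\<Sum>\<kappa>\<in>?X. ?w \<kappa> * (\<integral>S. projected_volume TYPE(real ^ 'd) S (?K \<kappa>) \<partial>M)) / fact ?d"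
    using pv(1) by simp
  also have "\<dots> = (\<Sum>\<kappa>\<in>?X. ?w \<kappa> * coeff (steiner_poly (?K \<kappa>)) ?k) * (?\<kappa>d / (fact ?n / (fact ?k * fact ?d) * ?\<kappa>n)) / fact ?d"
    unfolding pv(2) q sum_distrib_right
    by (intro arg_cong2[of _ _ _ _ "(/)"] sum.cong refl) (simp only: times_divide_eq_right mult_ac)
  also have "\<dots> = ?\<kappa>d / ?\<kappa>n * ((\<Sum>\<kappa>\<in>?X. ?w \<kappa> * (fact ?k * coeff (steiner_poly (?K \<kappa>)) ?k)) / fact ?n)"
  proof -
    have "(\<Sum>\<kappa>\<in>?X. ?w \<kappa> * (fact ?k * coeff (steiner_poly (?K \<kappa>)) ?k)) = fact ?k * (\<Sum>\<kappa>\<in>?X. ?w \<kappa> * coeff (steiner_poly (?K \<kappa>)) ?k)"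
      by (simp add: sum_distrib_left mult_ac)
    then show ?thesis using pos by (simp add: field_simps)
  qed
  also have "\<dots> = ?\<kappa>d / ?\<kappa>n * mixed_volume (\<lambda>i. if i < ?d then A i else cball 0 1)"
    using mixed_volume_with_balls[OF assms(1) A] by simp
  finally show ?thesis
    by (simp add: convex_body_measure_lebesgue convex_body_cball)
qed

end
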